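(* Let $\mathcal{M}$ and $\mathcal{N}$ be diffeological étale manifolds of dimensions $m$ and $n$, respectively, and let $f:\mathcal{M}\to\mathcal{N}$ be a smooth map. (i) If $df_x:T_x\mathcal{M}\to T_{f(x)}\mathcal{N}$ is an epimorphism at each point $x\in\mathcal{M}$, then $f$ is a diffeological submersion. (ii) If $df_x:T_x\mathcal{M}\to T_{f(x)}\mathcal{N}$ is a monomorphism at each point $x\in\mathcal{M}$, then $f$ is a diffeological immersion. (iii) If $df_x:T_x\mathcal{M}\to T_{f(x)}\mathcal{N}$ is an isomorphism at each point $x\in\mathcal{M}$, then $f$ is a diffeological étale map.
   Context: An $n$-domain is an open subset of $\mathbb{R}^n$; a domain is an $n$-domain for some $n\ge 0$. A parametrization in a set $X$ is a map from a domain to $X$. A diffeology on $X$ is a set $\mathcal{D}$ of parametrizations in $X$ such that: (D1) the images of the elements of $\mathcal{D}$ cover $X$; (D2) $P\circ F\in\mathcal{D}$ for every $P:U\to X$ in $\mathcal{D}$ and every smooth map $F:V\to U$ between domains; (D3) if a family of $n$-parametrizations $P_i:U_i\to X$ in $\mathcal{D}$ agree on overlaps, their common extension to $\bigcup_i U_i$ is in $\mathcal{D}$. A diffeological space is a set with a diffeology, whose elements are called plots. A map $f:X\to Y$ is smooth if $f\circ P$ is a plot in $Y$ for every plot $P$ in $X$; a diffeomorphism is a smooth bijection with smooth inverse. A subset of $X$ is D-open if its preimage under every plot is open; this defines the D-topology. Subsets carry the subspace diffeology (plots with values in the subset), and the plots of a product are the tuples of plots. Domains carry their usual smooth parametrizations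 as plots. For smooth maps $f:X\to Y$ and $g:Z\to Y$, the pullback of $f$ by $g$ is $g^*f:g^*X\to Z$, $(z,x)\mapsto z$, where $g^*X=\{(z,x)\in Z\times X: g(z)=f(x)\}$. Internal tangent space: for $x\in X$, consider the category whose objects are the plots $P:U\to X$ with $0\in U$ and $P(0)=x$ (plots centered at $x$), and whose morphisms from $Q:V\to X$ to $P:U\to X$ are the germs at $0$ of smooth maps $F:W\to U$, $W\subseteq V$ an open neighborhood of $0$, with $F(0)=0$ and $Q|_W=P\circ F$. The internal tangent space $T_xX$ is the colimit in real vector spaces of the functor sending $P:U\to X$ to $T_0U$ and the germ of $F$ to $dF_0$; write $dP_0:T_0U\to T_xX$ for the structure maps. For smooth $f:X\to Y$, the internal tangent map $df_x:T_xX\to T_{f(x)}Y$ is the unique linear map with $df_x\circ dP_0=d(f\circ P)_0$ for every plot $P$ centered at $x$. Submersion: a smooth map $f:X\to Y$ such that for each $x_0\in X$ there are a D-open $O\subseteq Y$ and a smooth map $\sigma:O\to X$ with $f\circ\sigma(y)=y$ for all $y\in O$ and $x_0\in\sigma(O)$. Diffeological submersion: a smooth map $f:X\to Y$ whose pullback $P^*f$ by every plot $P$ in $Y$ is a submersion. Diffeological immersion: a smooth map $f:X\to Y$ such that for every plot $P:U\to Y$ and every $(r_0,x_0)\in P^*X$ there exist a D-open neighborhood $O$ of $(r_0,x_0)$ in $P^*X$, an open neighborhood $V\subseteq U$ of $P^*f(O)$ and a smooth map $\varrho:V\to U\times X$ such that $\varrho\circ P^*f(r,x)=(r,x)$ for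 all $(r,x)\in O$. Étale map: a map $f:X\to Y$ such that every $x_0\in X$ has a D-open neighborhood $O\subseteq X$, and $f(x_0)$ a D-open neighborhood $O'\subseteq Y$, with $f|_O:O\to O'$ a diffeomorphism. Diffeological étale map: a smooth map whose pullback by every plot in the target is étale. Diffeological étale $n$-manifold (diffeological étale manifold of dimension $n$): a diffeological space $\mathcal{M}$ admitting a family of diffeological étale maps from $n$-domains into $\mathcal{M}$ (diffeological étale charts) whose images cover $\mathcal{M}$. *)

theory Defs
  imports "HOL-Analysis.Analysis" "HOL-Library.Function_Algebras" "HOL-Library.Set_Algebras"
begin

section \<open>Domains and smooth maps between them\<close>

text \<open>
  The dimension of a domain has to range over all natural numbers inside a single definition, so
  \<open>\<real>\<^sup>n\<close> is rendered by the library's \<^const>\<open>Euclidean_space\<close> \<open>n\<close>: the functions \<open>nat \<Rightarrow> real\<close> that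
  vanish from index \<open>n\<close> on, with the (Euclidean) product topology.
\<close>

abbreviation Rn :: "nat \<Rightarrow> (nat \<Rightarrow> real) set" where
  "Rn n \<equiv> topspace (Euclidean_space n)"

definition ndomain :: "nat \<Rightarrow> (nat \<Rightarrow> real) set \<Rightarrow> bool" where
  "ndomain n U \<longleftrightarrow> openin (Euclidean_space n) U"

definition partial_deriv :: "nat \<Rightarrow> ((nat \<Rightarrow> real) \<Rightarrow> real) \<Rightarrow> (nat \<Rightarrow> real) \<Rightarrow> real" where
  "partial_deriv i g x = deriv (\<lambda>t. g (x(i := t))) (x i)"

text \<open>\<open>C_k k n U g\<close>: the function \<open>g\<close> is of class \<open>C\<^sup>k\<close> on the \<open>n\<close>-domain \<open>U\<close>. Values of \<open>g\<close> outside
  \<open>U\<close> are irrelevant, because \<open>U\<close> is open in \<open>\<real>\<^sup>n\<close> and only directions \<open>i < n\<close> are used.\<close>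

primrec C_k :: "nat \<Rightarrow> nat \<Rightarrow> (nat \<Rightarrow> real) set \<Rightarrow> ((nat \<Rightarrow> real) \<Rightarrow> real) \<Rightarrow> bool" where
  "C_k 0 n U g \<longleftrightarrow>
     continuous_map (subtopology (Euclidean_space n) U) euclideanreal g"
| "C_k (Suc k) n U g \<longleftrightarrow>
     continuous_map (subtopology (Euclidean_space n) U) euclideanreal g \<and>
     (\<forall>i<n. (\<forall>x\<in>U. (\<lambda>t. g (x(i := t))) differentiable (at (x i))) \<and>
            C_k k n U (partial_deriv i g))"

definition smooth_map ::
    "nat \<Rightarrow> (nat \<Rightarrow> real) set \<Rightarrow> nat \<Rightarrow> (nat \<Rightarrow> real) set \<Rightarrow> ((nat \<Rightarrow> real) \<Rightarrow> nat \<Rightarrow> real) \<Rightarrow> bool" where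
  "smooth_map m V n U F \<longleftrightarrow> F \<in> V \<rightarrow> U \<and> (\<forall>i<n. \<forall>k. C_k k m V (\<lambda>x. F x i))"

text \<open>The differential at the origin of a map \<open>F\<close> defined near the origin of \<open>\<real>\<^sup>m\<close>.\<close>

definition diff0 :: "nat \<Rightarrow> ((nat \<Rightarrow> real) \<Rightarrow> nat \<Rightarrow> real) \<Rightarrow> (nat \<Rightarrow> real) \<Rightarrow> nat \<Rightarrow> real" where
  "diff0 m F v = (\<lambda>i. \<Sum>j<m. partial_deriv j (\<lambda>x. F x i) 0 * v j)"


section \<open>Diffeological spaces\<close>

text \<open>A parametrization is a triple \<open>(n, U, P)\<close> of a dimension, an \<open>n\<close>-domain and a map on \<open>U\<close>.
  As HOL functions are total, \<open>P\<close> is required to be \<^const>\<open>undefined\<close> outside \<open>U\<close>, so that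
  equality of triples is equality of parametrizations.\<close>

type_synonym 'a param = "nat \<times> (nat \<Rightarrow> real) set \<times> ((nat \<Rightarrow> real) \<Rightarrow> 'a)"

record 'a diff_space =
  points :: "'a set"
  plots :: "'a param set"

definition params :: "'a set \<Rightarrow> 'a param set" where
  "params X = {(n, U, P). ndomain n U \<and> P \<in> U \<rightarrow>\<^sub>E X}"

text \<open>In the last (gluing) axiom \<open>Q\<close> is the common extension; its existence subsumes that the members
  of the family \<open>\<F>\<close> agree on overlaps.\<close>

definition diffeological_space :: "'a diff_space \<Rightarrow> bool" where
  "diffeological_space X \<longleftrightarrow>
     plots X \<subseteq> params (points X) \<and>
     (\<Union>(n, U, P) \<in> plots X. P ` U) = points X \<and>
     (\<forall>(n, U, P) \<in> plots X. \<forall>m V F. ndomain m V \<and> smooth_map m V n U F \<longrightarrow>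
        (m, V, compose V P F) \<in> plots X) \<and>
     (\<forall>n \<F> Q. (\<forall>(U, P) \<in> \<F>. (n, U, P) \<in> plots X) \<and>
        Q \<in> extensional (\<Union>(U, P) \<in> \<F>. U) \<and>
        (\<forall>(U, P) \<in> \<F>. \<forall>u \<in> U. Q u = P u) \<longrightarrow>
        (n, (\<Union>(U, P) \<in> \<F>. U), Q) \<in> plots X)"

definition D_open :: "'a diff_space \<Rightarrow> 'a set \<Rightarrow> bool" where
  "D_open X A \<longleftrightarrow>
     A \<subseteq> points X \<and> (\<forall>(n, U, P) \<in> plots X. openin (Euclidean_space n) {u \<in> U. P u \<in> A})"

definition domain_space :: "nat \<Rightarrow> (nat \<Rightarrow> real) set \<Rightarrow> (nat \<Rightarrow> real) diff_space" where
  "domain_space n U =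
     \<lparr>points = U, plots = {(m, V, F). (m, V, F) \<in> params U \<and> smooth_map m V n U F}\<rparr>"

definition subspace_diff :: "'a diff_space \<Rightarrow> 'a set \<Rightarrow> 'a diff_space" where
  "subspace_diff X A = \<lparr>points = A, plots = {(n, U, P) \<in> plots X. P ` U \<subseteq> A}\<rparr>"

definition prod_diff :: "'a diff_space \<Rightarrow> 'b diff_space \<Rightarrow> ('a \<times> 'b) diff_space" where
  "prod_diff X Y =
     \<lparr>points = points X \<times> points Y,
      plots = {(n, U, P) \<in> params (points X \<times> points Y).
        (n, U, compose U fst P) \<in> plots X \<and> (n, U, compose U snd P) \<in> plots Y}\<rparr>"

text \<open>The values of maps between diffeological spaces outside the points of the source are
  irrelevant.\<close>

definition diff_smooth :: "'a diff_space \<Rightarrow> 'b diff_space \<Rightarrow> ('a \<Rightarrow> 'b) \<Rightarrow> bool" where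
  "diff_smooth X Y f \<longleftrightarrow>
     f \<in> points X \<rightarrow> points Y \<and> (\<forall>(n, U, P) \<in> plots X. (n, U, compose U f P) \<in> plots Y)"

definition diffeomorphism :: "'a diff_space \<Rightarrow> 'b diff_space \<Rightarrow> ('a \<Rightarrow> 'b) \<Rightarrow> bool" where
  "diffeomorphism X Y f \<longleftrightarrow>
     bij_betw f (points X) (points Y) \<and> diff_smooth X Y f \<and>
     diff_smooth Y X (inv_into (points X) f)"

text \<open>The pullback \<open>g\<^sup>*f : g\<^sup>*X \<rightarrow> Z\<close> of \<open>f : X \<rightarrow> Y\<close> by \<open>g : Z \<rightarrow> Y\<close> is \<^const>\<open>fst\<close> on the following
  space.\<close>

definition pullback ::
    "'z diff_space \<Rightarrow> ('z \<Rightarrow> 'y) \<Rightarrow> 'x diff_space \<Rightarrow> ('x \<Rightarrow> 'y) \<Rightarrow> ('z \<times> 'x) diff_space" where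
  "pullback Z g X f =
     subspace_diff (prod_diff Z X) {(z, x). z \<in> points Z \<and> x \<in> points X \<and> g z = f x}"


section \<open>Submersions, immersions, etale maps and manifolds\<close>

definition submersion :: "'a diff_space \<Rightarrow> 'b diff_space \<Rightarrow> ('a \<Rightarrow> 'b) \<Rightarrow> bool" where
  "submersion X Y f \<longleftrightarrow>
     diff_smooth X Y f \<and>
     (\<forall>x0 \<in> points X. \<exists>W \<sigma>. D_open Y W \<and> diff_smooth (subspace_diff Y W) X \<sigma> \<and>
        (\<forall>y\<in>W. f (\<sigma> y) = y) \<and> x0 \<in> \<sigma> ` W)"

definition diff_submersion :: "'a diff_space \<Rightarrow> 'b diff_space \<Rightarrow> ('a \<Rightarrow> 'b) \<Rightarrow> bool" where
  "diff_submersion X Y f \<longleftrightarrow>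
     diff_smooth X Y f \<and>
     (\<forall>(n, U, P) \<in> plots Y.
        submersion (pullback (domain_space n U) P X f) (domain_space n U) fst)"

definition diff_immersion :: "'a diff_space \<Rightarrow> 'b diff_space \<Rightarrow> ('a \<Rightarrow> 'b) \<Rightarrow> bool" where
  "diff_immersion X Y f \<longleftrightarrow>
     diff_smooth X Y f \<and>
     (\<forall>(n, U, P) \<in> plots Y. \<forall>z0 \<in> points (pullback (domain_space n U) P X f).
        \<exists>W V \<rho>. D_open (pullback (domain_space n U) P X f) W \<and> z0 \<in> W \<and>
          ndomain n V \<and> V \<subseteq> U \<and> fst ` W \<subseteq> V \<and>
          diff_smooth (domain_space n V) (prod_diff (domain_space n U) X) \<rho> \<and>
          (\<forall>z\<in>W. \<rho> (fst z) = z))"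

definition etale :: "'a diff_space \<Rightarrow> 'b diff_space \<Rightarrow> ('a \<Rightarrow> 'b) \<Rightarrow> bool" where
  "etale X Y f \<longleftrightarrow>
     f \<in> points X \<rightarrow> points Y \<and>
     (\<forall>x0 \<in> points X. \<exists>W W'. D_open X W \<and> x0 \<in> W \<and> D_open Y W' \<and> f x0 \<in> W' \<and>
        diffeomorphism (subspace_diff X W) (subspace_diff Y W') f)"

definition diff_etale :: "'a diff_space \<Rightarrow> 'b diff_space \<Rightarrow> ('a \<Rightarrow> 'b) \<Rightarrow> bool" where
  "diff_etale X Y f \<longleftrightarrow>
     diff_smooth X Y f \<and>
     (\<forall>(n, U, P) \<in> plots Y.
        etale (pullback (domain_space n U) P X f) (domain_space n U) fst)"

definition diff_etale_manifold :: "nat \<Rightarrow> 'a diff_space \<Rightarrow> bool" where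
  "diff_etale_manifold n X \<longleftrightarrow>
     diffeological_space X \<and>
     (\<exists>\<A>. (\<forall>(U, \<phi>) \<in> \<A>. ndomain n U \<and> diff_etale (domain_space n U) X \<phi>) \<and>
          (\<Union>(U, \<phi>) \<in> \<A>. \<phi> ` U) = points X)"


section \<open>Internal tangent spaces\<close>

definition centered_plots :: "'a diff_space \<Rightarrow> 'a \<Rightarrow> 'a param set" where
  "centered_plots X x = {(n, U, P) \<in> plots X. 0 \<in> U \<and> P 0 = x}"

text \<open>\<open>represents_morphism (k, V, Q) (n, U, P) F\<close>: the map \<open>F\<close>, restricted to some open neighbourhood
  \<open>W\<close> of \<open>0\<close>, represents a germ that is a morphism from \<open>Q\<close> to \<open>P\<close>.\<close>

definition represents_morphism ::
    "'a param \<Rightarrow> 'a param \<Rightarrow> ((nat \<Rightarrow> real) \<Rightarrow> nat \<Rightarrow> real) \<Rightarrow> bool" where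
  "represents_morphism = (\<lambda>(k, V, Q) (n, U, P) F.
     \<exists>W \<subseteq> V. ndomain k W \<and> 0 \<in> W \<and> smooth_map k W n U F \<and> F 0 = 0 \<and> (\<forall>w\<in>W. Q w = P (F w)))"

text \<open>
  The colimit is constructed as usual: the direct sum of the spaces \<open>T\<^sub>0U = \<real>\<^sup>n\<close> over all plots
  \<open>(n, U, P)\<close> centered at \<open>x\<close>, modulo the subspace spanned by the identifications
  \<open>\<iota>\<^sub>Q v - \<iota>\<^sub>P (dF\<^sub>0 v)\<close> for all morphisms \<open>F\<close> from \<open>Q\<close> to \<open>P\<close>. An element of the direct sum is a
  finitely supported family indexed by plots; tangent vectors are cosets, which are written
  with the operations \<open>+o\<close> and \<open>+\<close> on sets from \<^theory>\<open>HOL-Library.Set_Algebras\<close>.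
\<close>

definition fam_scale :: "real \<Rightarrow> ('a param \<Rightarrow> nat \<Rightarrow> real) \<Rightarrow> 'a param \<Rightarrow> nat \<Rightarrow> real" where
  "fam_scale c \<xi> = (\<lambda>p i. c * \<xi> p i)"

global_interpretation fam: vector_space fam_scale
  by unfold_locales (auto simp: fam_scale_def fun_eq_iff algebra_simps)

definition tangent_sum :: "'a diff_space \<Rightarrow> 'a \<Rightarrow> ('a param \<Rightarrow> nat \<Rightarrow> real) set" where
  "tangent_sum X x =
     {\<xi>. (\<forall>p. if p \<in> centered_plots X x then \<xi> p \<in> Rn (fst p) else \<xi> p = 0) \<and>
         finite {p. \<xi> p \<noteq> 0}}"

definition tangent_inj :: "'a param \<Rightarrow> (nat \<Rightarrow> real) \<Rightarrow> 'a param \<Rightarrow> nat \<Rightarrow> real" where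
  "tangent_inj p v = (\<lambda>q. if q = p then v else 0)"

definition tangent_relations :: "'a diff_space \<Rightarrow> 'a \<Rightarrow> ('a param \<Rightarrow> nat \<Rightarrow> real) set" where
  "tangent_relations X x =
     fam.span {tangent_inj q v - tangent_inj p (diff0 (fst q) F v) | q p F v.
       q \<in> centered_plots X x \<and> p \<in> centered_plots X x \<and> represents_morphism q p F \<and>
       v \<in> Rn (fst q)}"

type_synonym 'a tangent = "('a param \<Rightarrow> nat \<Rightarrow> real) set"

definition tangent_space :: "'a diff_space \<Rightarrow> 'a \<Rightarrow> 'a tangent set" where
  "tangent_space X x = (\<lambda>\<xi>. \<xi> +o tangent_relations X x) ` tangent_sum X x"

text \<open>Addition of cosets is \<open>+\<close> on sets. In the scalar multiplication the relations are added
  because for \<open>c = 0\<close> the image of a coset is only \<open>{0}\<close>.\<close>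

definition tangent_scale :: "'a diff_space \<Rightarrow> 'a \<Rightarrow> real \<Rightarrow> 'a tangent \<Rightarrow> 'a tangent" where
  "tangent_scale X x c A = fam_scale c ` A + tangent_relations X x"

definition tangent_linear ::
    "'a diff_space \<Rightarrow> 'a \<Rightarrow> 'b diff_space \<Rightarrow> 'b \<Rightarrow> ('a tangent \<Rightarrow> 'b tangent) \<Rightarrow> bool" where
  "tangent_linear X x Y y L \<longleftrightarrow>
     L \<in> tangent_space X x \<rightarrow> tangent_space Y y \<and>
     (\<forall>A \<in> tangent_space X x. \<forall>B \<in> tangent_space X x. L (A + B) = L A + L B) \<and>
     (\<forall>c. \<forall>A \<in> tangent_space X x. L (tangent_scale X x c A) = tangent_scale Y y c (L A))"

text \<open>The structure map \<open>dP\<^sub>0\<close> of the colimit, for a plot \<open>p = (n, U, P)\<close> centered at \<open>x\<close>.\<close>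

definition plot_diff :: "'a diff_space \<Rightarrow> 'a \<Rightarrow> 'a param \<Rightarrow> (nat \<Rightarrow> real) \<Rightarrow> 'a tangent" where
  "plot_diff X x p v = tangent_inj p v +o tangent_relations X x"

definition tangent_map ::
    "'a diff_space \<Rightarrow> 'b diff_space \<Rightarrow> ('a \<Rightarrow> 'b) \<Rightarrow> 'a \<Rightarrow> 'a tangent \<Rightarrow> 'b tangent" where
  "tangent_map X Y f x = (THE L.
     L \<in> extensional (tangent_space X x) \<and> tangent_linear X x Y (f x) L \<and>
     (\<forall>(n, U, P) \<in> centered_plots X x. \<forall>v \<in> Rn n.
        L (plot_diff X x (n, U, P) v) = plot_diff Y (f x) (n, U, compose U f P) v))"

end

theory Submission
  imports Defs "HOL-Homology.Invariance_of_Domain"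
begin

text \<open>
  In charts \<open>\<phi>\<close> around \<open>x0\<close> and \<open>\<psi>\<close> around \<open>f x0\<close>, the local lifting property of diffeological etale
  maps turns \<open>f\<close> into a smooth map \<open>g\<close> with \<open>\<psi> \<circ> g = f \<circ> \<phi>\<close> and a plot \<open>P\<close> of the target into a smooth map \<open>h\<close>
  with \<open>\<psi> \<circ> h = P\<close>. Lifts through a chart exist and have unique germs, so the structure map
  \<open>d\<phi>\<^sub>0 : \<real>\<^sup>m \<rightarrow> T\<^bsub>x0\<^esub>M\<close> is bijective, and injectivity or surjectivity of the internal tangent map passes to
  \<open>dg\<^sub>0\<close>. If \<open>dg\<^sub>0\<close> is onto, \<open>g\<close> has a local section \<open>s\<close>, and \<open>r \<mapsto> (r, \<phi> (s (h r)))\<close> is a section of the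
  pullback. If \<open>dg\<^sub>0\<close> is injective, \<open>g\<close> has a local retraction \<open>\<rho>\<close>, and \<open>r \<mapsto> (r, \<phi> (\<rho> (h r)))\<close> is a
  retraction of the pullback on the pairs \<open>(r, \<phi> a)\<close> with \<open>g a = h r\<close>; these form a D-open set by
  uniqueness of lifts through \<open>\<psi>\<close>. The two together make the pullback etale.

  As the dimensions vary, the inverse function theorem is needed on \<open>Rn m\<close> for a term \<open>m\<close>. The one-sided
  inverses of \<open>g\<close> are obtained by exchanging the coordinates for components of \<open>g\<close> one at a time,
  so that only the inverse function theorem for a map changing a single coordinate is required.
\<close>

section \<open>Domains and their topology\<close>

text \<open>Charts need not be injective: a plot may have several lifts through a chart, and only
  the germ with a prescribed starting value is determined. So equal points in the target do not give
  equal parameters, and the immersion part must be phrased with \<open>g a = h r\<close> instead of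
  \<open>f (\<phi> a) = P r\<close>. In the category of centered plots, existence and uniqueness of
  lifts say that a centered chart is a terminal object; this is why the colimit is attained there.
  Smoothness is defined by iterated partial derivatives, so differentiability along curves has to be
  recovered from the mean value theorem. It takes the form of an identity for increments along an
  arbitrary filter, because the same identity must also differentiate an inverse of which only
  continuity is known. That continuity comes from invariance of domain, once the mean value theorem
  has given injectivity.\<close>

lemma Rn_iff: "x \<in> Rn n \<longleftrightarrow> (\<forall>i\<ge>n. x i = 0)"
  by (simp add: topspace_Euclidean_space)

lemma Euclidean_space_eq: "Euclidean_space n = top_of_set (Rn n)"
  by (simp add: topspace_Euclidean_space) (simp add: Euclidean_space_def euclidean_product_topology)

lemma ndomain_subset: "ndomain n U \<Longrightarrow> U \<subseteq> Rn n"
  unfolding ndomain_def by (rule openin_subset)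

lemma ndomain_openin: "ndomain n U \<longleftrightarrow> openin (top_of_set (Rn n)) U"
  unfolding ndomain_def by (subst Euclidean_space_eq) (rule refl)

lemma continuous_map_Rn:
  "U \<subseteq> Rn n \<Longrightarrow>
    continuous_map (subtopology (Euclidean_space n) U) euclideanreal g \<longleftrightarrow> continuous_on U g"
  by (subst Euclidean_space_eq)
     (simp add: subtopology_subtopology Int_absorb1)

lemma ndomain_Int: "ndomain n U \<Longrightarrow> ndomain n V \<Longrightarrow> ndomain n (U \<inter> V)"
  unfolding ndomain_def by (rule openin_Int)

lemma ndomain_Rn: "ndomain n (Rn n)"
  unfolding ndomain_def by (rule openin_topspace)

lemma ndomain_vimage:
  assumes "ndomain n U" "continuous_on U g" "open S"
  shows "ndomain n {x \<in> U. g x \<in> S}"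
proof -
  have "openin (top_of_set U) (U \<inter> g -` S)"
    using assms(2,3) by (rule continuous_openin_preimage_gen)
  then have "openin (top_of_set (Rn n)) (U \<inter> g -` S)"
    using assms(1) unfolding ndomain_openin by (rule openin_trans)
  moreover have "U \<inter> g -` S = {x \<in> U. g x \<in> S}" by auto
  ultimately show ?thesis by (simp add: ndomain_openin)
qed

text \<open>Sup-norm balls of \<open>Rn n\<close>. Moving one coordinate below \<open>n\<close> to a
  value within \<open>e\<close> of the centre's stays inside, as the coordinate-by-coordinate
  arguments require.\<close>

definition cube :: "nat \<Rightarrow> (nat \<Rightarrow> real) \<Rightarrow> real \<Rightarrow> (nat \<Rightarrow> real) set" where
  "cube n x e = {y \<in> Rn n. \<forall>i<n. \<bar>y i - x i\<bar> < e}"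

lemma continuous_on_coord: "continuous_on S (\<lambda>x::nat \<Rightarrow> real. x i)"
  by (rule continuous_on_subset[OF continuous_on_product_coordinates]) simp

lemma ndomain_cube: "ndomain n (cube n x e)"
proof -
  have "open {y. \<forall>i\<in>{..<n}. (y::nat \<Rightarrow> real) i \<in> ball (x i) e}"
    by (rule product_topology_basis') auto
  moreover have "cube n x e = Rn n \<inter> {y. \<forall>i\<in>{..<n}. y i \<in> ball (x i) e}"
    by (auto simp: cube_def dist_real_def abs_minus_commute)
  ultimately show ?thesis
    unfolding ndomain_openin openin_open by blast
qed

lemma ndomain_contains_cube:
  assumes "ndomain n U" "x \<in> U"
  obtains e where "0 < e" "cube n x e \<subseteq> U"
proof -
  obtain T where T: "open T" "U = Rn n \<inter> T"
    using assms(1) unfolding ndomain_openin openin_open by blast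
  have "openin (product_topology (\<lambda>i. euclidean) UNIV) T" "x \<in> T"
    using T assms(2) by (auto simp: euclidean_product_topology)
  from product_topology_open_contains_basis[OF this] obtain X where
    X: "x \<in> Pi\<^sub>E UNIV X" "\<And>i. open (X i)" "Pi\<^sub>E UNIV X \<subseteq> T" by auto
  have "\<exists>e>0. ball (x i) e \<subseteq> X i" for i
  proof (rule openE[OF X(2)])
    show "x i \<in> X i" using X(1) by auto
  qed blast
  then have "\<forall>i. \<exists>e. 0 < e \<and> ball (x i) e \<subseteq> X i" by blast
  then obtain d where "\<forall>i. 0 < d i \<and> ball (x i) (d i) \<subseteq> X i"
    unfolding choice_iff by blast
  then have d: "\<And>i. 0 < d i" "\<And>i. ball (x i) (d i) \<subseteq> X i" by auto
  \<comment> \<open>The extra 1 keeps the set nonempty for \<open>n = 0\<close>. Only the first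
    \<open>n\<close> radii count, since all later coordinates of \<open>x\<close> and of
    \<open>y\<close> vanish.\<close>
  define e where "e = Min (insert 1 (d ` {..<n}))"
  have e: "0 < e" "\<And>i. i < n \<Longrightarrow> e \<le> d i"
    using d(1) by (auto simp: e_def)
  have "cube n x e \<subseteq> U"
  proof
    fix y assume y: "y \<in> cube n x e"
    have "y i \<in> X i" for i
    proof (cases "i < n")
      case True
      then have "\<bar>y i - x i\<bar> < d i" using y e(2)[of i] by (force simp: cube_def)
      then show ?thesis using d(2)[of i] by (auto simp: dist_real_def abs_minus_commute)
    next
      case False
      then have "y i = x i" using y T assms(2) by (auto simp: cube_def Rn_iff)
      then show ?thesis using X(1) by auto
    qed
    then show "y \<in> U" using X(3) y T(2) by (auto simp: cube_def)
  qed
  with e(1) show ?thesis using that by blast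
qed

lemma mem_cube_self: "x \<in> Rn n \<Longrightarrow> 0 < e \<Longrightarrow> x \<in> cube n x e"
  by (simp add: cube_def)

lemma ndomainI:
  assumes "\<And>x. x \<in> U \<Longrightarrow> \<exists>W. ndomain n W \<and> x \<in> W \<and> W \<subseteq> U"
  shows "ndomain n U"
  using assms unfolding ndomain_def by (subst openin_subopen) blast

lemma tendsto_coordinatewise:
  fixes f :: "'a \<Rightarrow> nat \<Rightarrow> real"
  shows "(f \<longlongrightarrow> l) F \<longleftrightarrow> (\<forall>i. ((\<lambda>x. f x i) \<longlongrightarrow> l i) F)"
  using limitin_componentwise[of "\<lambda>i. euclidean" UNIV f l F]
  by (simp add: euclidean_product_topology)

lemma upd_in_Rn: "x \<in> Rn n \<Longrightarrow> i < n \<Longrightarrow> x(i := t) \<in> Rn n"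
  by (auto simp: Rn_iff)

lemma ndomain_upd_eventually:
  assumes "ndomain n U" "x \<in> U" "i < n"
  shows "\<forall>\<^sub>F t in nhds (x i). x(i := t) \<in> U"
proof -
  obtain e where e: "0 < e" "cube n x e \<subseteq> U"
    using ndomain_contains_cube assms by metis
  have "\<forall>\<^sub>F t in nhds (x i). dist t (x i) < e"
    using e(1) eventually_nhds_metric by blast
  then show ?thesis
  proof eventually_elim
    case (elim t)
    then have "x(i := t) \<in> cube n x e"
      using assms ndomain_subset[OF assms(1)] e(1)
      by (auto simp: cube_def dist_real_def intro!: upd_in_Rn)
    with e(2) show ?case by blast
  qed
qed

section \<open>Differential calculus on domains\<close>

lemma C_k_continuous_on: "C_k k n U g \<Longrightarrow> U \<subseteq> Rn n \<Longrightarrow> continuous_on U g"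
  by (cases k) (auto simp: continuous_map_Rn)

lemma C_k_Suc_leD: "C_k (Suc k) n U g \<Longrightarrow> C_k k n U g"
proof (induction k arbitrary: g)
  case (Suc k)
  then show ?case by (subst C_k.simps(2)) auto
qed auto

lemma C_k_has_partial_deriv:
  assumes "C_k (Suc k) n U g" "i < n" "x \<in> U"
  shows "((\<lambda>t. g (x(i := t))) has_real_derivative partial_deriv i g x) (at (x i))"
  using assms by (auto simp: partial_deriv_def DERIV_deriv_iff_real_differentiable)

lemma C_k_has_partial_deriv_upd:
  assumes "C_k (Suc k) n U g" "i < n" "x(i := s) \<in> U"
  shows "((\<lambda>t. g (x(i := t))) has_real_derivative partial_deriv i g (x(i := s))) (at s)"
  using C_k_has_partial_deriv[OF assms] by simp

lemma partial_deriv_eqI: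
  "((\<lambda>t. g (x(i := t))) has_real_derivative d) (at (x i)) \<Longrightarrow> partial_deriv i g x = d"
  unfolding partial_deriv_def by (rule DERIV_imp_deriv)

lemma upd_eventually_eq:
  assumes "ndomain n U" "x \<in> U" "i < n" "\<And>x. x \<in> U \<Longrightarrow> g x = h x"
  shows "\<forall>\<^sub>F t in nhds (x i). g (x(i := t)) = h (x(i := t))"
  using ndomain_upd_eventually[OF assms(1-3)] by eventually_elim (rule assms(4))

lemma partial_deriv_cong:
  assumes "ndomain n U" "x \<in> U" "i < n" "\<And>x. x \<in> U \<Longrightarrow> g x = h x"
  shows "partial_deriv i g x = partial_deriv i h x"
  unfolding partial_deriv_def
  by (rule deriv_cong_ev[OF upd_eventually_eq[OF assms]]) auto

text \<open>Coordinate lines through a point of the open set \<open>U\<close> stay in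
  \<open>U\<close> for a while, so partial derivatives on \<open>U\<close> see only the values on
  \<open>U\<close>, at every order.\<close>

lemma C_k_cong_imp:
  assumes "ndomain n U" "\<And>x. x \<in> U \<Longrightarrow> g x = h x" "C_k k n U g"
  shows "C_k k n U h"
  using assms(2,3)
proof (induction k arbitrary: g h)
  case 0
  then show ?case
    using continuous_on_cong[of U U g h] by (simp add: continuous_map_Rn ndomain_subset[OF assms(1)])
next
  case (Suc k)
  have eq: "\<forall>\<^sub>F t in nhds (x i). g (x(i := t)) = h (x(i := t))" if "i < n" "x \<in> U" for i x
    by (rule upd_eventually_eq[OF assms(1) that(2,1)]) (rule Suc.prems(1))
  have "(\<lambda>t. h (x(i := t))) differentiable (at (x i))" if "i < n" "x \<in> U" for i x
    using C_k_has_partial_deriv[OF Suc.prems(2) that] DERIV_cong_ev[OF refl eq[OF that] refl]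
    unfolding real_differentiable_def by blast
  moreover have "C_k k n U (partial_deriv i h)" if "i < n" for i
  proof (rule Suc.IH[of "partial_deriv i g"])
    show "C_k k n U (partial_deriv i g)" using Suc.prems(2) that by simp
    show "partial_deriv i g x = partial_deriv i h x" if "x \<in> U" for x
      using partial_deriv_cong[OF assms(1) that \<open>i < n\<close> Suc.prems(1)] .
  qed
  moreover have "continuous_on U h"
    using C_k_continuous_on[OF Suc.prems(2) ndomain_subset[OF assms(1)]] Suc.prems(1)
    by (simp cong: continuous_on_cong)
  ultimately show ?case
    using ndomain_subset[OF assms(1)] by (simp add: continuous_map_Rn)
qed

text \<open>Trades the \<open>deriv\<close> inside \<open>partial_deriv\<close> for closed formulas
  \<open>D i\<close>, so that closure under products, inverses and composition becomes an induction
  on \<open>k\<close> with the usual differentiation rule.\<close>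

lemma C_k_SucI:
  assumes U: "ndomain n U" and "continuous_on U g"
    and d: "\<And>i x. i < n \<Longrightarrow> x \<in> U \<Longrightarrow> ((\<lambda>t. g (x(i := t))) has_real_derivative D i x) (at (x i))"
    and D: "\<And>i. i < n \<Longrightarrow> C_k k n U (D i)"
  shows "C_k (Suc k) n U g"
proof -
  have "C_k k n U (partial_deriv i g)" if "i < n" for i
    by (rule C_k_cong_imp[OF U _ D[OF that]]) (simp add: partial_deriv_eqI[OF d[OF that]])
  moreover have "(\<lambda>t. g (x(i := t))) differentiable (at (x i))" if "i < n" "x \<in> U" for i x
    using d[OF that] unfolding real_differentiable_def by blast
  ultimately show ?thesis
    using assms(2) ndomain_subset[OF U] by (simp add: continuous_map_Rn)
qed

lemma C_k_subset: "C_k k n U g \<Longrightarrow> V \<subseteq> U \<Longrightarrow> C_k k n V g"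
proof (induction k arbitrary: g)
  case 0
  then show ?case by (simp add: continuous_map_from_subtopology_mono)
next
  case (Suc k)
  then show ?case by (auto intro: continuous_map_from_subtopology_mono)
qed

lemma C_k_const: "ndomain n U \<Longrightarrow> C_k k n U (\<lambda>x. c)"
  by (induction k arbitrary: c) (auto simp: partial_deriv_def[abs_def])

lemma C_k_coord: "ndomain n U \<Longrightarrow> C_k k n U (\<lambda>x. x j)"
proof (cases k)
  case 0
  assume "ndomain n U"
  with 0 show ?thesis by (simp add: continuous_map_Rn ndomain_subset continuous_on_coord)
next
  case (Suc l)
  assume U: "ndomain n U"
  show ?thesis unfolding Suc
  proof (rule C_k_SucI[OF U continuous_on_coord, where D = "\<lambda>i x. if i = j then 1 else 0"])
    show "((\<lambda>t. (x(i := t)) j) has_real_derivative (if i = j then 1 else 0)) (at (x i))" for i x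
      by (cases "i = j") (auto intro!: derivative_eq_intros)
  qed (rule C_k_const[OF U])
qed

lemma C_k_add:
  assumes U: "ndomain n U"
  shows "C_k k n U f \<Longrightarrow> C_k k n U g \<Longrightarrow> C_k k n U (\<lambda>x. f x + g x)"
proof (induction k arbitrary: f g)
  case 0
  then show ?case by (auto intro: continuous_map_add)
next
  case (Suc k)
  show ?case
  proof (rule C_k_SucI[OF U])
    show "continuous_on U (\<lambda>x. f x + g x)"
      using Suc.prems[THEN C_k_continuous_on] ndomain_subset[OF U] by (intro continuous_intros) auto
    show "((\<lambda>t. f (x(i := t)) + g (x(i := t))) has_real_derivative
        partial_deriv i f x + partial_deriv i g x) (at (x i))" if "i < n" "x \<in> U" for i x
      using Suc.prems that by (intro DERIV_add C_k_has_partial_deriv)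
    show "C_k k n U (\<lambda>x. partial_deriv i f x + partial_deriv i g x)" if "i < n" for i
      using Suc that by auto
  qed
qed

lemma C_k_mult:
  assumes U: "ndomain n U"
  shows "C_k k n U f \<Longrightarrow> C_k k n U g \<Longrightarrow> C_k k n U (\<lambda>x. f x * g x)"
proof (induction k arbitrary: f g)
  case 0
  then show ?case by (auto intro: continuous_map_real_mult)
next
  case (Suc k)
  show ?case
  proof (rule C_k_SucI[OF U])
    show "continuous_on U (\<lambda>x. f x * g x)"
      using Suc.prems[THEN C_k_continuous_on] ndomain_subset[OF U] by (intro continuous_intros) auto
    show "((\<lambda>t. f (x(i := t)) * g (x(i := t))) has_real_derivative
        partial_deriv i f x * g x + partial_deriv i g x * f x) (at (x i))" if "i < n" "x \<in> U" for i x
      using DERIV_mult[OF C_k_has_partial_deriv[OF Suc.prems(1) that]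
          C_k_has_partial_deriv[OF Suc.prems(2) that]] by (simp del: fun_upd_apply)
    show "C_k k n U (\<lambda>x. partial_deriv i f x * g x + partial_deriv i g x * f x)" if "i < n" for i
      using Suc.prems that Suc.prems[THEN C_k_Suc_leD] by (intro C_k_add[OF U] Suc.IH) auto
  qed
qed

lemma C_k_uminus: "ndomain n U \<Longrightarrow> C_k k n U f \<Longrightarrow> C_k k n U (\<lambda>x. - f x)"
  using C_k_mult[OF _ C_k_const[of n U k "-1"], of f] by simp

lemma C_k_sum:
  assumes U: "ndomain n U"
  shows "(\<And>a. a \<in> A \<Longrightarrow> C_k k n U (f a)) \<Longrightarrow> C_k k n U (\<lambda>x. \<Sum>a\<in>A. f a x)"
  by (induction A rule: infinite_finite_induct) (simp_all del: C_k.simps add: C_k_const[OF U] C_k_add[OF U])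

text \<open>The derivative of \<open>1/f\<close> contains \<open>1/f\<close> only undifferentiated,
  so the induction hypothesis one order lower suffices.\<close>

lemma C_k_inverse:
  assumes U: "ndomain n U" and nz: "\<And>x. x \<in> U \<Longrightarrow> f x \<noteq> 0"
  shows "C_k k n U f \<Longrightarrow> C_k k n U (\<lambda>x. inverse (f x))"
proof (induction k)
  case 0
  then have "continuous_on U f" by (rule C_k_continuous_on[OF _ ndomain_subset[OF U]])
  then have "continuous_on U (\<lambda>x. inverse (f x))" by (rule continuous_on_inverse) (use nz in auto)
  then show ?case by (simp add: continuous_map_Rn ndomain_subset[OF U])
next
  case (Suc k)
  show ?case
  proof (rule C_k_SucI[OF U])
    show "continuous_on U (\<lambda>x. inverse (f x))"
      using Suc.prems[THEN C_k_continuous_on] ndomain_subset[OF U] nz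
      by (intro continuous_intros) auto
    show "((\<lambda>t. inverse (f (x(i := t)))) has_real_derivative
        - (inverse (f x) * partial_deriv i f x * inverse (f x))) (at (x i))"
      if "i < n" "x \<in> U" for i x
      using DERIV_inverse'[OF C_k_has_partial_deriv[OF Suc.prems that]] nz[OF that(2)]
      by (simp del: fun_upd_apply)
    have "C_k k n U (\<lambda>x. inverse (f x))" using Suc.IH C_k_Suc_leD[OF Suc.prems] .
    then show "C_k k n U (\<lambda>x. - (inverse (f x) * partial_deriv i f x * inverse (f x)))" if "i < n" for i
      using Suc.prems that by (intro C_k_uminus[OF U] C_k_mult[OF U]) auto
  qed
qed

text \<open>The mean value theorem along the edges of the coordinate path from \<open>x0\<close> to \<open>x\<close>.\<close>

lemma C_1_mean_value:
  assumes C: "C_k (Suc 0) n U G" and U: "cube n x0 e \<subseteq> U" and x0: "x0 \<in> Rn n" and "x \<in> cube n x0 e"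
  obtains \<xi> where "\<And>i. i < n \<Longrightarrow> \<xi> i \<in> U" "\<And>i l. \<bar>\<xi> i l - x0 l\<bar> \<le> \<bar>x l - x0 l\<bar>"
    "G x - G x0 = (\<Sum>i<n. partial_deriv i G (\<xi> i) * (x i - x0 i))"
proof -
  \<comment> \<open>\<open>z i\<close> is the vertex of the path at which the first \<open>i\<close>
    coordinates have moved from \<open>x0\<close> to \<open>x\<close>; the next edge varies
    coordinate \<open>i\<close> alone.\<close>
  define z where "z i l = (if l < i then x l else x0 l)" for i l :: nat
  have x: "x \<in> Rn n" using assms by (simp add: cube_def)
  \<comment> \<open>Each edge stays in the closed box around \<open>x0\<close> with half-widths
    \<open>|x l - x0 l|\<close>. This coordinatewise bound later makes the intermediate points
    converge to \<open>x0\<close>.\<close>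
  have line: "(z i)(i := t) \<in> U \<and> (\<forall>l. \<bar>((z i)(i := t)) l - x0 l\<bar> \<le> \<bar>x l - x0 l\<bar>)"
    if "i < n" "\<bar>t - x0 i\<bar> \<le> \<bar>x i - x0 i\<bar>" for i t
  proof -
    have 1: "\<forall>l. \<bar>((z i)(i := t)) l - x0 l\<bar> \<le> \<bar>x l - x0 l\<bar>"
      using that by (auto simp: z_def)
    moreover have "(z i)(i := t) \<in> Rn n" using x x0 that by (auto simp: Rn_iff z_def)
    moreover have "\<forall>l<n. \<bar>((z i)(i := t)) l - x0 l\<bar> < e"
      using 1 \<open>x \<in> cube n x0 e\<close> unfolding cube_def by (blast intro: le_less_trans)
    ultimately have "(z i)(i := t) \<in> cube n x0 e"
      unfolding cube_def by blast
    then show ?thesis using 1 U by blast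
  qed
  have "\<exists>\<xi>. \<xi> \<in> U \<and> (\<forall>l. \<bar>\<xi> l - x0 l\<bar> \<le> \<bar>x l - x0 l\<bar>) \<and>
      G (z (Suc i)) - G (z i) = partial_deriv i G \<xi> * (x i - x0 i)" if i: "i < n" for i
  proof -
    have z: "z (Suc i) = (z i)(i := x i)" "z i = (z i)(i := x0 i)"
      by (auto simp: z_def fun_eq_iff)
    have d: "((\<lambda>t. G ((z i)(i := t))) has_real_derivative partial_deriv i G ((z i)(i := t))) (at t)"
      if "\<bar>t - x0 i\<bar> \<le> \<bar>x i - x0 i\<bar>" for t
      using C_k_has_partial_deriv_upd[OF C i] line[OF i that] by blast
    have "\<exists>t. \<bar>t - x0 i\<bar> \<le> \<bar>x i - x0 i\<bar> \<and>
      G ((z i)(i := x i)) - G ((z i)(i := x0 i)) = (x i - x0 i) * partial_deriv i G ((z i)(i := t))"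
    proof (cases "x i" "x0 i" rule: linorder_cases)
      case less
      from MVT2[OF this, of "\<lambda>t. G ((z i)(i := t))" "\<lambda>t. partial_deriv i G ((z i)(i := t))"]
      obtain t where "t > x i" "t < x0 i" "G ((z i)(i := x0 i)) - G ((z i)(i := x i)) =
          (x0 i - x i) * partial_deriv i G ((z i)(i := t))"
        using d less by auto
      then show ?thesis by (intro exI[of _ t]) (auto simp: algebra_simps)
    next
      case greater
      from MVT2[OF this, of "\<lambda>t. G ((z i)(i := t))" "\<lambda>t. partial_deriv i G ((z i)(i := t))"]
      obtain t where "t < x i" "t > x0 i" "G ((z i)(i := x i)) - G ((z i)(i := x0 i)) =
          (x i - x0 i) * partial_deriv i G ((z i)(i := t))"
        using d greater by auto
      then show ?thesis by (intro exI[of _ t]) (auto simp: algebra_simps)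
    qed (auto intro: exI[of _ "x0 i"])
    then obtain t where t: "\<bar>t - x0 i\<bar> \<le> \<bar>x i - x0 i\<bar>"
      "G (z (Suc i)) - G (z i) = (x i - x0 i) * partial_deriv i G ((z i)(i := t))"
      unfolding z(1) using z(2) by auto
    then show ?thesis
      using line[OF i t(1)] by (intro exI[of _ "(z i)(i := t)"]) (simp add: mult.commute del: fun_upd_apply)
  qed
  then have "\<forall>i. \<exists>\<xi>. i < n \<longrightarrow> \<xi> \<in> U \<and> (\<forall>l. \<bar>\<xi> l - x0 l\<bar> \<le> \<bar>x l - x0 l\<bar>) \<and>
      G (z (Suc i)) - G (z i) = partial_deriv i G \<xi> * (x i - x0 i)" by blast
  then obtain \<eta> where \<eta>: "\<And>i. i < n \<Longrightarrow> \<eta> i \<in> U"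
      "\<And>i l. i < n \<Longrightarrow> \<bar>\<eta> i l - x0 l\<bar> \<le> \<bar>x l - x0 l\<bar>"
      "\<And>i. i < n \<Longrightarrow> G (z (Suc i)) - G (z i) = partial_deriv i G (\<eta> i) * (x i - x0 i)"
    unfolding choice_iff by blast
  \<comment> \<open>The default \<open>x0\<close> makes the bound on \<open>\<xi> i l\<close> hold
    for every \<open>i\<close>, not only for \<open>i < n\<close>.\<close>
  define \<xi> where "\<xi> i = (if i < n then \<eta> i else x0)" for i
  have "z n = x" "z 0 = x0" using x x0 by (auto simp: z_def Rn_iff fun_eq_iff)
  then have "G x - G x0 = (\<Sum>i<n. G (z (Suc i)) - G (z i))"
    using sum_lessThan_telescope[of "\<lambda>i. G (z i)" n] by simp
  also have "\<dots> = (\<Sum>i<n. partial_deriv i G (\<xi> i) * (x i - x0 i))"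
    using \<eta>(3) by (intro sum.cong) (auto simp: \<xi>_def)
  finally show ?thesis
    using \<eta>(1,2) by (intro that[of \<xi>]) (auto simp: \<xi>_def)
qed

text \<open>The coefficients \<open>q\<close> are partial derivatives at the intermediate points of
  the mean value theorem, which are squeezed towards \<open>x0\<close>. Nothing beyond convergence
  is asked of \<open>\<gamma>\<close>, so the lemma serves both the chain rule and the derivative of
  an inverse function.\<close>

lemma C_1_caratheodory:
  assumes U: "ndomain n U" and C: "C_k (Suc 0) n U G" and x0: "x0 \<in> U"
    and \<gamma>: "(\<gamma> \<longlongrightarrow> x0) F" "\<forall>\<^sub>F t in F. \<gamma> t \<in> Rn n"
  obtains q where "\<And>i. i < n \<Longrightarrow> ((\<lambda>t. q t i) \<longlongrightarrow> partial_deriv i G x0) F"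
    "\<forall>\<^sub>F t in F. G (\<gamma> t) - G x0 = (\<Sum>i<n. q t i * (\<gamma> t i - x0 i))"
proof -
  obtain e where e: "0 < e" "cube n x0 e \<subseteq> U" using ndomain_contains_cube[OF U x0] .
  have x0n: "x0 \<in> Rn n" using U x0 ndomain_subset by blast
  have "\<forall>\<^sub>F t in F. \<bar>\<gamma> t i - x0 i\<bar> < e" for i
    using tendstoD[OF \<gamma>(1)[unfolded tendsto_coordinatewise, rule_format, of i] e(1)]
    by (simp add: dist_real_def)
  then have "\<forall>\<^sub>F t in F. \<forall>i\<in>{..<n}. \<bar>\<gamma> t i - x0 i\<bar> < e"
    by (intro eventually_ball_finite) auto
  with \<gamma>(2) have ev: "\<forall>\<^sub>F t in F. \<gamma> t \<in> cube n x0 e"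
    by eventually_elim (auto simp: cube_def)
  \<comment> \<open>The guard \<open>\<gamma> t \<in> cube n x0 e\<close> allows intermediate points
    to be chosen for all \<open>t\<close> at once; it holds eventually.\<close>
  have "\<forall>t. \<exists>\<xi>. \<gamma> t \<in> cube n x0 e \<longrightarrow> (\<forall>i<n. \<xi> i \<in> U) \<and> (\<forall>i l. \<bar>\<xi> i l - x0 l\<bar> \<le> \<bar>\<gamma> t l - x0 l\<bar>) \<and>
      G (\<gamma> t) - G x0 = (\<Sum>i<n. partial_deriv i G (\<xi> i) * (\<gamma> t i - x0 i))"
  proof (rule allI)
    fix t
    show "\<exists>\<xi>. \<gamma> t \<in> cube n x0 e \<longrightarrow> (\<forall>i<n. \<xi> i \<in> U) \<and> (\<forall>i l. \<bar>\<xi> i l - x0 l\<bar> \<le> \<bar>\<gamma> t l - x0 l\<bar>) \<and>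
      G (\<gamma> t) - G x0 = (\<Sum>i<n. partial_deriv i G (\<xi> i) * (\<gamma> t i - x0 i))"
    proof (cases "\<gamma> t \<in> cube n x0 e")
      case True
      show ?thesis
      proof (rule C_1_mean_value[OF C e(2) x0n True])
        fix \<xi> assume "\<And>i. i < n \<Longrightarrow> \<xi> i \<in> U" "\<And>i l. \<bar>\<xi> i l - x0 l\<bar> \<le> \<bar>\<gamma> t l - x0 l\<bar>"
          "G (\<gamma> t) - G x0 = (\<Sum>i<n. partial_deriv i G (\<xi> i) * (\<gamma> t i - x0 i))"
        then show ?thesis by (intro exI[of _ \<xi>]) simp
      qed
    qed auto
  qed
  then obtain \<xi> where \<xi>: "\<And>t i. \<gamma> t \<in> cube n x0 e \<Longrightarrow> i < n \<Longrightarrow> \<xi> t i \<in> U"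
      "\<And>t i l. \<gamma> t \<in> cube n x0 e \<Longrightarrow> \<bar>\<xi> t i l - x0 l\<bar> \<le> \<bar>\<gamma> t l - x0 l\<bar>"
      "\<And>t. \<gamma> t \<in> cube n x0 e \<Longrightarrow>
        G (\<gamma> t) - G x0 = (\<Sum>i<n. partial_deriv i G (\<xi> t i) * (\<gamma> t i - x0 i))"
    unfolding choice_iff by blast
  show ?thesis
  proof (rule that[of "\<lambda>t i. partial_deriv i G (\<xi> t i)"])
    fix i assume i: "i < n"
    have "((\<lambda>t. \<xi> t i) \<longlongrightarrow> x0) F"
      unfolding tendsto_coordinatewise
    proof
      fix l
      have "((\<lambda>t. \<gamma> t l - x0 l) \<longlongrightarrow> 0) F"
        using \<gamma>(1) by (simp add: tendsto_coordinatewise LIM_zero)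
      then have "((\<lambda>t. \<xi> t i l - x0 l) \<longlongrightarrow> 0) F"
      proof (rule Lim_null_comparison[rotated, OF tendsto_norm_zero])
        show "\<forall>\<^sub>F t in F. norm (\<xi> t i l - x0 l) \<le> norm (\<gamma> t l - x0 l)"
          using ev by eventually_elim (simp add: \<xi>(2))
      qed
      then show "((\<lambda>t. \<xi> t i l) \<longlongrightarrow> x0 l) F" by (rule LIM_zero_cancel)
    qed
    moreover have "continuous_on U (partial_deriv i G)"
      using C i ndomain_subset[OF U] by (auto intro: C_k_continuous_on[of 0] simp: continuous_map_Rn)
    moreover have "\<forall>\<^sub>F t in F. \<xi> t i \<in> U"
      using ev by eventually_elim (simp add: \<xi>(1) i)
    ultimately show "((\<lambda>t. partial_deriv i G (\<xi> t i)) \<longlongrightarrow> partial_deriv i G x0) F"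
      using x0 by (intro continuous_on_tendsto_compose[of U "partial_deriv i G"])
  next
    show "\<forall>\<^sub>F t in F. G (\<gamma> t) - G x0 = (\<Sum>i<n. partial_deriv i G (\<xi> t i) * (\<gamma> t i - x0 i))"
      using ev by eventually_elim (rule \<xi>(3))
  qed
qed

lemma C_1_chain:
  assumes U: "ndomain n U" and C: "C_k (Suc 0) n U G" and "\<gamma> t0 \<in> U"
    and d: "\<And>i. i < n \<Longrightarrow> ((\<lambda>t. \<gamma> t i) has_real_derivative d i) (at t0)"
    and ev: "\<forall>\<^sub>F t in nhds t0. \<gamma> t \<in> Rn n"
  shows "((\<lambda>t. G (\<gamma> t)) has_real_derivative (\<Sum>i<n. partial_deriv i G (\<gamma> t0) * d i)) (at t0)"
proof -
  have ev': "\<forall>\<^sub>F t in at t0. \<gamma> t \<in> Rn n"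
    using ev unfolding eventually_at_filter by eventually_elim simp
  have "(\<gamma> \<longlongrightarrow> \<gamma> t0) (at t0)"
    unfolding tendsto_coordinatewise
  proof
    fix i
    show "((\<lambda>t. \<gamma> t i) \<longlongrightarrow> \<gamma> t0 i) (at t0)"
    proof (cases "i < n")
      case True
      then show ?thesis using DERIV_isCont[OF d] by (simp add: isCont_def)
    next
      \<comment> \<open>No derivative is given for these coordinates; they vanish near
        \<open>t0\<close> because the curve lies in \<open>Rn n\<close>.\<close>
      case False
      have "\<forall>\<^sub>F t in at t0. \<gamma> t i = \<gamma> t0 i"
        using ev' by eventually_elim
          (use False eventually_nhds_x_imp_x[OF ev] in \<open>simp add: Rn_iff\<close>)
      then show ?thesis by (rule tendsto_eventually)
    qed
  qed
  from C_1_caratheodory[OF U C \<open>\<gamma> t0 \<in> U\<close> this ev'] obtain q where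
    q: "\<And>i. i < n \<Longrightarrow> ((\<lambda>t. q t i) \<longlongrightarrow> partial_deriv i G (\<gamma> t0)) (at t0)"
    "\<forall>\<^sub>F t in at t0. G (\<gamma> t) - G (\<gamma> t0) = (\<Sum>i<n. q t i * (\<gamma> t i - \<gamma> t0 i))" by blast
  have "((\<lambda>t. \<Sum>i<n. q t i * ((\<gamma> t i - \<gamma> t0 i) / (t - t0))) \<longlongrightarrow>
      (\<Sum>i<n. partial_deriv i G (\<gamma> t0) * d i)) (at t0)"
    using q(1) d by (intro tendsto_sum tendsto_mult) (auto simp: has_field_derivative_iff)
  moreover have "\<forall>\<^sub>F t in at t0. (\<Sum>i<n. q t i * ((\<gamma> t i - \<gamma> t0 i) / (t - t0))) =
      (G (\<gamma> t) - G (\<gamma> t0)) / (t - t0)"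
    using q(2) by eventually_elim (simp add: sum_divide_distrib)
  ultimately show ?thesis
    unfolding has_field_derivative_iff by (rule Lim_transform_eventually)
qed

lemma continuous_on_into_Rn:
  assumes "\<And>x. x \<in> V \<Longrightarrow> F x \<in> Rn n" "\<And>i. i < n \<Longrightarrow> continuous_on V (\<lambda>x. F x i)"
  shows "continuous_on V F"
proof (rule continuous_on_coordinatewise_then_product)
  fix i
  show "continuous_on V (\<lambda>x. F x i)"
  proof (cases "i < n")
    case False
    then have "\<And>x. x \<in> V \<Longrightarrow> F x i = 0" using assms(1) by (auto simp: Rn_iff)
    then show ?thesis by (simp cong: continuous_on_cong)
  qed (rule assms(2))
qed

lemma has_partial_deriv_compose:
  assumes V: "ndomain m V" and U: "ndomain n U" and F: "F \<in> V \<rightarrow> U"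
    and CF: "\<And>l. l < n \<Longrightarrow> C_k (Suc 0) m V (\<lambda>x. F x l)" and CG: "C_k (Suc 0) n U G"
    and i: "i < m" and x: "x \<in> V"
  shows "((\<lambda>t. G (F (x(i := t)))) has_real_derivative
      (\<Sum>l<n. partial_deriv l G (F x) * partial_deriv i (\<lambda>x. F x l) x)) (at (x i))"
proof -
  \<comment> \<open>Written with \<open>x(i := x i)\<close> so that the base point is literally the
    value at \<open>t = x i\<close> of the curve \<open>F (x(i := t))\<close>.\<close>
  have "((\<lambda>t. G (F (x(i := t)))) has_real_derivative
      (\<Sum>l<n. partial_deriv l G (F (x(i := x i))) * partial_deriv i (\<lambda>x. F x l) x)) (at (x i))"
  proof (rule C_1_chain[OF U CG])
    show "F (x(i := x i)) \<in> U" using F x by auto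
    show "((\<lambda>t. F (x(i := t)) l) has_real_derivative partial_deriv i (\<lambda>x. F x l) x) (at (x i))"
      if "l < n" for l
      using C_k_has_partial_deriv[OF CF[OF that] i x] .
    show "\<forall>\<^sub>F t in nhds (x i). F (x(i := t)) \<in> Rn n"
      using ndomain_upd_eventually[OF V x i] by eventually_elim (use F ndomain_subset[OF U] in auto)
  qed
  then show ?thesis by simp
qed

lemma continuous_on_compose_C_k:
  assumes V: "ndomain m V" and U: "ndomain n U" and F: "F \<in> V \<rightarrow> U"
    and CF: "\<And>l. l < n \<Longrightarrow> C_k k m V (\<lambda>x. F x l)" and CG: "C_k k n U G"
  shows "continuous_on V (\<lambda>x. G (F x))"
proof (rule continuous_on_compose2[of U G V F])
  show "continuous_on U G" using C_k_continuous_on[OF CG ndomain_subset[OF U]] .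
  show "continuous_on V F"
    using F ndomain_subset[OF U] C_k_continuous_on[OF CF ndomain_subset[OF V]]
    by (intro continuous_on_into_Rn) auto
qed (use F in auto)

lemma C_k_Suc_0: "C_k (Suc k) n U g \<Longrightarrow> C_k (Suc 0) n U g"
  by (induction k) (auto dest: C_k_Suc_leD simp del: C_k.simps)

text \<open>The chain rule gives products of \<open>partial_deriv l G\<close> along \<open>F\<close>
  with partial derivatives of \<open>F\<close>. Hence \<open>G\<close> varies in the induction,
  while \<open>F\<close> stays fixed and is needed at one order less.\<close>

lemma C_k_compose:
  assumes V: "ndomain m V" and U: "ndomain n U" and F: "F \<in> V \<rightarrow> U"
  shows "\<lbrakk>\<And>l. l < n \<Longrightarrow> C_k k m V (\<lambda>x. F x l); C_k k n U G\<rbrakk> \<Longrightarrow> C_k k m V (\<lambda>x. G (F x))"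
proof (induction k arbitrary: G)
  case 0
  then show ?case
    using continuous_on_compose_C_k[OF V U F, of 0 G]
    by (simp add: continuous_map_Rn ndomain_subset[OF V] ndomain_subset[OF U])
next
  case (Suc k)
  show ?case
  proof (rule C_k_SucI[OF V continuous_on_compose_C_k[OF V U F Suc.prems]])
    show "((\<lambda>t. G (F (x(i := t)))) has_real_derivative
        (\<Sum>l<n. partial_deriv l G (F x) * partial_deriv i (\<lambda>x. F x l) x)) (at (x i))"
      if "i < m" "x \<in> V" for i x
      using Suc.prems that by (intro has_partial_deriv_compose[OF V U F] C_k_Suc_0[of k])
    show "C_k k m V (\<lambda>x. \<Sum>l<n. partial_deriv l G (F x) * partial_deriv i (\<lambda>x. F x l) x)"
      if "i < m" for i
    proof (rule C_k_sum[OF V], rule C_k_mult[OF V])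
      fix l assume "l \<in> {..<n}"
      then show "C_k k m V (partial_deriv i (\<lambda>x. F x l))" "C_k k m V (\<lambda>x. partial_deriv l G (F x))"
        using Suc.prems that Suc.IH[of "partial_deriv l G", OF C_k_Suc_leD[OF Suc.prems(1)]] by auto
    qed
  qed
qed

section \<open>Smooth one-sided inverses\<close>

lemma smooth_map_subset:
  "smooth_map m V n U F \<Longrightarrow> V' \<subseteq> V \<Longrightarrow> F \<in> V' \<rightarrow> U' \<Longrightarrow> smooth_map m V' n U' F"
  unfolding smooth_map_def using C_k_subset by blast

lemma smooth_map_C_k: "smooth_map m V n U F \<Longrightarrow> i < n \<Longrightarrow> C_k k m V (\<lambda>x. F x i)"
  by (simp add: smooth_map_def)

lemma smooth_map_into: "smooth_map m V n U F \<Longrightarrow> F \<in> V \<rightarrow> U"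
  by (simp add: smooth_map_def)

lemma smooth_map_cong:
  assumes "ndomain m V" "smooth_map m V n U F" "\<And>x. x \<in> V \<Longrightarrow> F x = F' x"
  shows "smooth_map m V n U F'"
  unfolding smooth_map_def
proof (intro conjI allI impI)
  show "F' \<in> V \<rightarrow> U" using smooth_map_into[OF assms(2)] assms(3) by (metis Pi_iff)
  show "C_k k m V (\<lambda>x. F' x i)" if "i < n" for i k
    by (rule C_k_cong_imp[OF assms(1) _ smooth_map_C_k[OF assms(2) that]]) (simp add: assms(3))
qed

lemma smooth_map_compose:
  assumes V: "ndomain m V" and U: "ndomain n U" and F: "smooth_map m V n U F" "smooth_map n U k W G"
  shows "smooth_map m V k W (\<lambda>x. G (F x))"
  unfolding smooth_map_def
proof (intro conjI allI impI)
  show "(\<lambda>x. G (F x)) \<in> V \<rightarrow> W" using F by (auto simp: smooth_map_def)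
  show "C_k l m V (\<lambda>x. G (F x) i)" if "i < k" for i l
    by (rule C_k_compose[OF V U smooth_map_into[OF F(1)]])
       (use F that in \<open>auto intro: smooth_map_C_k\<close>)
qed

lemma smooth_map_ident: "ndomain m V \<Longrightarrow> V \<subseteq> U \<Longrightarrow> smooth_map m V m U (\<lambda>x. x)"
  by (auto simp: smooth_map_def intro: C_k_coord)

lemma smooth_map_continuous_on:
  assumes "ndomain m V" "U \<subseteq> Rn n" "smooth_map m V n U F"
  shows "continuous_on V F"
  using smooth_map_into[OF assms(3)] assms(2)
    C_k_continuous_on[OF smooth_map_C_k[OF assms(3)] ndomain_subset[OF assms(1)]]
  by (intro continuous_on_into_Rn) auto

lemma ndomain_preimage:
  assumes V: "ndomain m V" and "continuous_on V F" "F \<in> V \<rightarrow> Rn n" and S: "ndomain n S"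
  shows "ndomain m {x \<in> V. F x \<in> S}"
proof -
  obtain T where T: "open T" "S = Rn n \<inter> T"
    using S unfolding ndomain_openin openin_open by blast
  then have "{x \<in> V. F x \<in> S} = {x \<in> V. F x \<in> T}" using assms(3) by auto
  then show ?thesis using ndomain_vimage[OF V assms(2) T(1)] by simp
qed

lemma ndomain_smooth_preimage:
  assumes "ndomain m V" "U \<subseteq> Rn n" "smooth_map m V n U F" "ndomain n S"
  shows "ndomain m {x \<in> V. F x \<in> S}"
  by (rule ndomain_preimage[OF assms(1) smooth_map_continuous_on[OF assms(1-3)] _ assms(4)])
     (use smooth_map_into[OF assms(3)] assms(2) in auto)

section \<open>The derivative as a linear map\<close>

text \<open>\<open>diff0\<close> with a free base point: a change of coordinates moves
  \<open>p\<close> to \<open>\<Psi> p\<close>, which need not be the origin.\<close>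

definition total_deriv ::
    "nat \<Rightarrow> ((nat \<Rightarrow> real) \<Rightarrow> nat \<Rightarrow> real) \<Rightarrow> (nat \<Rightarrow> real) \<Rightarrow> (nat \<Rightarrow> real) \<Rightarrow> nat \<Rightarrow> real" where
  "total_deriv m F x v = (\<lambda>i. \<Sum>j<m. partial_deriv j (\<lambda>y. F y i) x * v j)"

lemma total_deriv_cong:
  assumes "ndomain m V" "x \<in> V" "\<And>y. y \<in> V \<Longrightarrow> F y = F' y"
  shows "total_deriv m F x v = total_deriv m F' x v"
  unfolding total_deriv_def
proof (intro ext sum.cong refl)
  fix i j assume "j \<in> {..<m}"
  then have "partial_deriv j (\<lambda>y. F y i) x = partial_deriv j (\<lambda>y. F' y i) x"
    by (intro partial_deriv_cong[OF assms(1,2)]) (simp_all add: assms(3))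
  then show "partial_deriv j (\<lambda>y. F y i) x * v j = partial_deriv j (\<lambda>y. F' y i) x * v j" by simp
qed

lemma partial_deriv_const: "partial_deriv j (\<lambda>y. c) x = 0"
  by (simp add: partial_deriv_def)

lemma partial_deriv_coord: "partial_deriv j (\<lambda>y. y i) x = (if i = j then 1 else 0)"
  by (auto intro!: partial_deriv_eqI derivative_eq_intros)

lemma total_deriv_in_Rn:
  assumes V: "ndomain m V" and U: "U \<subseteq> Rn n" and F: "F \<in> V \<rightarrow> U" and x: "x \<in> V"
  shows "total_deriv m F x v \<in> Rn n"
  unfolding Rn_iff total_deriv_def
proof (intro allI impI sum.neutral ballI)
  fix i j assume "n \<le> i" "j \<in> {..<m}"
  then have "partial_deriv j (\<lambda>y. F y i) x = partial_deriv j (\<lambda>y. 0) x"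
    using U F by (intro partial_deriv_cong[OF V x]) (auto simp: Rn_iff)
  then show "partial_deriv j (\<lambda>y. F y i) x * v j = 0" by (simp add: partial_deriv_const)
qed

lemma total_deriv_ident: "v \<in> Rn m \<Longrightarrow> total_deriv m (\<lambda>y. y) x v = v"
  by (auto simp: total_deriv_def partial_deriv_coord Rn_iff if_distrib[of "\<lambda>c. c * _"] fun_eq_iff
      cong: if_cong)

lemma total_deriv_compose:
  assumes V: "ndomain m V" and U: "ndomain n U" and W: "W \<subseteq> Rn k"
    and F: "smooth_map m V n U F" and G: "smooth_map n U k W G" and x: "x \<in> V"
  shows "total_deriv m (\<lambda>x. G (F x)) x v = total_deriv n G (F x) (total_deriv m F x v)"
proof
  fix i
  show "total_deriv m (\<lambda>x. G (F x)) x v i = total_deriv n G (F x) (total_deriv m F x v) i"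
  proof (cases "i < k")
    case True
    have "partial_deriv j (\<lambda>x. G (F x) i) x =
        (\<Sum>l<n. partial_deriv l (\<lambda>y. G y i) (F x) * partial_deriv j (\<lambda>x. F x l) x)" if "j < m" for j
      by (rule partial_deriv_eqI, rule has_partial_deriv_compose[OF V U smooth_map_into[OF F]])
         (use F G True that x in \<open>auto intro: smooth_map_C_k simp del: C_k.simps\<close>)
    then have "total_deriv m (\<lambda>x. G (F x)) x v i =
        (\<Sum>j<m. \<Sum>l<n. partial_deriv l (\<lambda>y. G y i) (F x) * (partial_deriv j (\<lambda>x. F x l) x * v j))"
      by (simp add: total_deriv_def sum_distrib_right mult.assoc)
    also have "\<dots> = (\<Sum>l<n. \<Sum>j<m. partial_deriv l (\<lambda>y. G y i) (F x) * (partial_deriv j (\<lambda>x. F x l) x * v j))"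
      by (rule sum.swap)
    finally show ?thesis by (simp add: total_deriv_def sum_distrib_left)
  next
    case False
    have "F x \<in> U" using smooth_map_into[OF F] x by auto
    have "total_deriv m (\<lambda>x. G (F x)) x v \<in> Rn k"
      by (rule total_deriv_in_Rn[OF V W smooth_map_into x], rule smooth_map_compose[OF V U F G])
    moreover have "total_deriv n G (F x) (total_deriv m F x v) \<in> Rn k"
      by (rule total_deriv_in_Rn[OF U W smooth_map_into[OF G] \<open>F x \<in> U\<close>])
    ultimately show ?thesis using False by (simp add: Rn_iff)
  qed
qed

section \<open>The inverse function theorem for maps changing one coordinate\<close>

definition local_inverse ::
    "nat \<Rightarrow> (nat \<Rightarrow> real) \<Rightarrow> (nat \<Rightarrow> real) set \<Rightarrow> (nat \<Rightarrow> real) set \<Rightarrow>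
      ((nat \<Rightarrow> real) \<Rightarrow> nat \<Rightarrow> real) \<Rightarrow> ((nat \<Rightarrow> real) \<Rightarrow> nat \<Rightarrow> real) \<Rightarrow> bool" where
  "local_inverse m p A B \<Psi> \<Phi> \<longleftrightarrow> ndomain m A \<and> p \<in> A \<and> ndomain m B \<and>
     smooth_map m A m B \<Psi> \<and> smooth_map m B m A \<Phi> \<and>
     (\<forall>x\<in>A. \<Phi> (\<Psi> x) = x) \<and> (\<forall>y\<in>B. \<Psi> (\<Phi> y) = y)"

text \<open>Invariance of domain: an injective continuous map from an open subset of
  \<open>Rn m\<close> into \<open>Rn m\<close> is open, and an open injection has a continuous
  inverse. No derivative enters.\<close>

lemma open_inverse_upd:
  assumes A: "ndomain m A" and j: "j < m" and "continuous_on A G"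
    and inj: "inj_on (\<lambda>x. x(j := G x)) A"
  defines "E \<equiv> \<lambda>x. x(j := G x)"
  shows "ndomain m (E ` A)" "continuous_on (E ` A) (inv_into A E)"
proof -
  have E: "E \<in> A \<rightarrow> Rn m" using ndomain_subset[OF A] j by (auto simp: E_def intro!: upd_in_Rn)
  have cont: "continuous_on A E"
  proof (rule continuous_on_into_Rn)
    show "continuous_on A (\<lambda>x. E x i)" for i
      using assms(3) by (cases "i = j") (auto simp: E_def intro: continuous_on_coord)
  qed (use E in auto)
  \<comment> \<open>Stated for every open subset of \<open>A\<close>, as openness of the map is what
    makes its inverse continuous.\<close>
  have im: "ndomain m (E ` V)" if "ndomain m V" "V \<subseteq> A" for V
    unfolding ndomain_def
  proof (rule invariance_of_domain_Euclidean_space)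
    show "openin (Euclidean_space m) V" using that(1) by (simp add: ndomain_def)
    have "continuous_map (top_of_set V) (top_of_set (Rn m)) E"
      using cont that(2) E by (auto intro: continuous_on_subset)
    then show "continuous_map (subtopology (Euclidean_space m) V) (Euclidean_space m) E"
      using ndomain_subset[OF that(1)]
      by (subst (1 2) Euclidean_space_eq) (simp add: subtopology_subtopology Int_absorb1)
    show "inj_on E V" using inj that(2) unfolding E_def by (rule inj_on_subset)
  qed
  show B: "ndomain m (E ` A)" using im[OF A] by simp
  show "continuous_on (E ` A) (inv_into A E)"
  proof (rule continuous_on_inverse_open_map[OF cont refl])
    show "inv_into A E (E x) = x" if "x \<in> A" for x
      using that inj unfolding E_def by (intro inv_into_f_f)
    show "openin (top_of_set (E ` A)) (E ` V)" if "openin (top_of_set A) V" for V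
    proof (rule openin_subset_trans)
      have "ndomain m V" using openin_trans[OF that] A by (simp add: ndomain_openin)
      then show "openin (top_of_set (Rn m)) (E ` V)"
        using im openin_imp_subset[OF that] by (simp add: ndomain_openin)
      show "E ` V \<subseteq> E ` A" using openin_imp_subset[OF that] by auto
      show "E ` A \<subseteq> Rn m" using E by auto
    qed
  qed
qed

text \<open>Near \<open>p\<close> the j-th partial derivative of \<open>G\<close> does not vanish,
  so by the mean value theorem \<open>G\<close> is injective along lines in direction
  \<open>j\<close>. The map fixes the other coordinates and is therefore injective, with a
  continuous inverse by \<open>open_inverse_upd\<close>. Differentiating
  \<open>G (\<Phi> y) = y j\<close> then bootstraps the inverse to smoothness.\<close>

lemma local_inverse_upd:
  assumes U: "ndomain m U" and p: "p \<in> U" and j: "j < m" and G: "\<And>k. C_k k m U G"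
    and nz: "partial_deriv j G p \<noteq> 0"
  obtains A B \<Phi> where "local_inverse m p A B (\<lambda>x. x(j := G x)) \<Phi>" "A \<subseteq> U"
proof -
  define E where "E x = x(j := G x)" for x :: "nat \<Rightarrow> real"
  have G1: "C_k (Suc 0) m U G" by (rule G)
  have dG: "C_k k m U (partial_deriv i G)" if "i < m" for i k
    using G[of "Suc k"] that by simp
  have "ndomain m {x \<in> U. partial_deriv j G x \<in> - {0}}"
    by (rule ndomain_vimage[OF U C_k_continuous_on[OF dG[OF j] ndomain_subset[OF U]]]) auto
  moreover have "p \<in> {x \<in> U. partial_deriv j G x \<in> - {0}}" using p nz by simp
  ultimately obtain e where e: "0 < e" "cube m p e \<subseteq> {x \<in> U. partial_deriv j G x \<in> - {0}}"
    by (rule ndomain_contains_cube)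
  define A where "A = cube m p e"
  have A: "ndomain m A" "p \<in> A" "A \<subseteq> U" "\<And>x. x \<in> A \<Longrightarrow> partial_deriv j G x \<noteq> 0"
    using e p ndomain_subset[OF U] mem_cube_self by (auto simp: A_def ndomain_cube)
  have lt: "G x \<noteq> G y" if xy: "x \<in> A" "y \<in> A" "\<And>i. i \<noteq> j \<Longrightarrow> x i = y i" "x j < y j" for x y
  proof
    assume eq: "G x = G y"
    have y: "x(j := y j) = y" using xy(3) by auto
    have line: "x(j := t) \<in> A" if "x j \<le> t" "t \<le> y j" for t
      using xy(1,2) that j upd_in_Rn[of x m j t] unfolding A_def cube_def
      by (force simp: abs_less_iff)
    have "\<exists>t. t > x j \<and> t < y j \<and> G (x(j := y j)) - G (x(j := x j)) =
        (y j - x j) * partial_deriv j G (x(j := t))"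
      using line A(3) by (intro MVT2[OF xy(4)] C_k_has_partial_deriv_upd[OF G1 j]) blast
    then obtain t where t: "t > x j" "t < y j" "0 = (y j - x j) * partial_deriv j G (x(j := t))"
      unfolding y fun_upd_triv eq diff_self by blast
    then have "partial_deriv j G (x(j := t)) = 0" by simp
    moreover have "x(j := t) \<in> A" using line t(1,2) by simp
    ultimately show False using A(4) by blast
  qed
  have inj: "inj_on E A"
  proof (rule inj_onI)
    fix x y assume xy: "x \<in> A" "y \<in> A" "E x = E y"
    then have off: "x i = y i" if "i \<noteq> j" for i
      using that by (auto simp: E_def dest!: fun_cong[of _ _ i])
    have "G x = G y" using fun_cong[OF xy(3), of j] by (simp add: E_def)
    then have "x j = y j"
      using lt[OF xy(1,2)] lt[OF xy(2,1)] off by (metis linorder_neqE_linordered_idom)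
    with off show "x = y" by (intro ext) metis
  qed
  define \<Phi> where "\<Phi> = inv_into A E"
  define B where "B = E ` A"
  have contG: "continuous_on A G"
    using C_k_continuous_on[OF G1 ndomain_subset[OF U]] A(3) by (rule continuous_on_subset)
  have B: "ndomain m B" and cont\<Phi>: "continuous_on B \<Phi>"
    using open_inverse_upd[OF A(1) j contG] inj unfolding E_def[abs_def] B_def \<Phi>_def by auto
  have \<Phi>A: "\<Phi> y \<in> A" and E\<Phi>: "E (\<Phi> y) = y" if "y \<in> B" for y
    using that by (auto simp: \<Phi>_def B_def inv_into_into f_inv_into_f)
  have \<Phi>E: "\<Phi> (E x) = x" if "x \<in> A" for x
    using that inj by (simp add: \<Phi>_def)
  have \<Phi>i: "\<Phi> y i = y i" if "y \<in> B" "i \<noteq> j" for y i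
    using fun_cong[OF E\<Phi>[OF that(1)], of i] that(2) by (simp add: E_def)
  have G\<Phi>: "G (\<Phi> y) = y j" if "y \<in> B" for y
    using fun_cong[OF E\<Phi>[OF that], of j] by (simp add: E_def)
  \<comment> \<open>Implicit differentiation of \<open>G (\<Phi> y) = y j\<close> in direction
    \<open>i\<close>: besides coordinate \<open>j\<close> of \<open>\<Phi> y\<close>, only
    coordinate \<open>i\<close> varies, at rate 1 when \<open>i \<noteq> j\<close>.\<close>
  define D where "D i y = (if i = j then 1 else - partial_deriv i G (\<Phi> y)) * inverse (partial_deriv j G (\<Phi> y))"
    for i y
  have deriv: "((\<lambda>t. \<Phi> (y(i := t)) j) has_real_derivative D i y) (at (y i))" if i: "i < m" and y: "y \<in> B" for i y
  proof -
    let ?F = "at (y i)" and ?\<gamma> = "\<lambda>t. \<Phi> (y(i := t))"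
    have "\<forall>\<^sub>F t in nhds (y i). y(i := t) \<in> B" by (rule ndomain_upd_eventually[OF B y i])
    then have evB: "\<forall>\<^sub>F t in ?F. y(i := t) \<in> B"
      unfolding eventually_at_filter by eventually_elim simp
    have "((\<lambda>t. y(i := t)) \<longlongrightarrow> y) ?F"
      unfolding tendsto_coordinatewise
    proof
      show "((\<lambda>t. (y(i := t)) l) \<longlongrightarrow> y l) ?F" for l by (cases "l = i") auto
    qed
    then have lim: "(?\<gamma> \<longlongrightarrow> \<Phi> y) ?F"
      using y evB by (intro continuous_on_tendsto_compose[OF cont\<Phi>])
    have evR: "\<forall>\<^sub>F t in ?F. ?\<gamma> t \<in> Rn m"
      using evB by eventually_elim (use \<Phi>A ndomain_subset[OF A(1)] in blast)
    have "\<Phi> y \<in> U" using \<Phi>A[OF y] A(3) by blast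
    from C_1_caratheodory[OF U G1 this lim evR] obtain q where
      q: "\<And>l. l < m \<Longrightarrow> ((\<lambda>t. q t l) \<longlongrightarrow> partial_deriv l G (\<Phi> y)) ?F"
      and ev: "\<forall>\<^sub>F t in ?F. G (?\<gamma> t) - G (\<Phi> y) = (\<Sum>l<m. q t l * (?\<gamma> t l - \<Phi> y l))" by blast
    have nz: "partial_deriv j G (\<Phi> y) \<noteq> 0" using A(4)[OF \<Phi>A[OF y]] .
    have evq: "\<forall>\<^sub>F t in ?F. q t j \<noteq> 0"
      using tendsto_imp_eventually_ne[OF q[OF j] nz] .
    have "\<forall>\<^sub>F t in ?F. t \<noteq> y i" by (simp add: eventually_at_filter)
    with ev evB evq have "\<forall>\<^sub>F t in ?F. (if i = j then 1 else - q t i) * inverse (q t j) =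
        (?\<gamma> t j - \<Phi> y j) / (t - y i)"
    proof eventually_elim
      case (elim t)
      have "(\<Sum>l<m. q t l * (?\<gamma> t l - \<Phi> y l)) =
          q t j * (?\<gamma> t j - \<Phi> y j) + (\<Sum>l\<in>{..<m} - {j}. q t l * (?\<gamma> t l - \<Phi> y l))"
        using j by (simp add: sum.remove[of _ j])
      also have "(\<Sum>l\<in>{..<m} - {j}. q t l * (?\<gamma> t l - \<Phi> y l)) =
          (\<Sum>l\<in>{..<m} - {j}. if l = i then q t i * (t - y i) else 0)"
        using y elim(2) by (intro sum.cong) (auto simp: \<Phi>i)
      also have "\<dots> = (if i = j then 0 else q t i * (t - y i))"
        using i by (simp add: sum.delta)
      finally have "(y(i := t)) j - y j =
          q t j * (?\<gamma> t j - \<Phi> y j) + (if i = j then 0 else q t i * (t - y i))"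
        using elim(1) by (simp only: G\<Phi>[OF elim(2)] G\<Phi>[OF y])
      then show ?case using elim(3,4) by (cases "i = j") (auto simp: field_simps)
    qed
    moreover have "((\<lambda>t. (if i = j then 1 else - q t i) * inverse (q t j)) \<longlongrightarrow> D i y) ?F"
      unfolding D_def using q i j nz by (cases "i = j") (auto intro!: tendsto_intros)
    ultimately show ?thesis
      unfolding has_field_derivative_iff
      by (simp only: fun_upd_triv) (rule Lim_transform_eventually)
  qed
  have \<Phi>U: "\<Phi> \<in> B \<rightarrow> U" using \<Phi>A A(3) by blast
  \<comment> \<open>All components are treated together: if every component is of class
    \<open>k\<close>, then so is each \<open>D l\<close>, and coordinate \<open>j\<close> gains one
    order. The other components are plain coordinates.\<close>
  have smooth\<Phi>: "C_k k m B (\<lambda>y. \<Phi> y i)" for k i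
  proof (induction k arbitrary: i)
    case 0
    show ?case
      using continuous_on_product_then_coordinatewise[OF cont\<Phi>]
      by (simp add: continuous_map_Rn ndomain_subset[OF B])
  next
    case (Suc k)
    show ?case
    proof (cases "i = j")
      case True
      show ?thesis unfolding True
      proof (rule C_k_SucI[OF B])
        show "continuous_on B (\<lambda>y. \<Phi> y j)"
          by (rule continuous_on_product_then_coordinatewise[OF cont\<Phi>])
        have "C_k k m B (\<lambda>y. partial_deriv l G (\<Phi> y))" if "l < m" for l
          by (rule C_k_compose[OF B U \<Phi>U Suc.IH dG[OF that]])
        then show "C_k k m B (D l)" if "l < m" for l
          unfolding D_def using that j A(4) \<Phi>A C_k_const[OF B]
          by (cases "l = j") (auto intro!: C_k_mult[OF B] C_k_uminus[OF B] C_k_inverse[OF B] simp del: C_k.simps)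
      qed (rule deriv)
    next
      case False
      show ?thesis
        by (rule C_k_cong_imp[OF B _ C_k_coord[OF B, of _ i]]) (simp add: \<Phi>i False)
    qed
  qed
  have smoothE: "C_k k m A (\<lambda>x. E x i)" for k i
  proof (cases "i = j")
    case True
    then show ?thesis using C_k_subset[OF G A(3)] by (simp add: E_def)
  qed (simp add: E_def C_k_coord[OF A(1)])
  have "local_inverse m p A B E \<Phi>"
    using A B smooth\<Phi> smoothE \<Phi>A E\<Phi> \<Phi>E by (auto simp: local_inverse_def smooth_map_def B_def)
  then show ?thesis using A(3) that unfolding E_def[abs_def] by blast
qed

section \<open>Exchanging coordinates for components of a map\<close>

text \<open>\<open>\<sigma>\<close> is partial so that \<open>dom \<sigma>\<close> records which
  coordinates have been exchanged and \<open>ran \<sigma>\<close> which components of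
  \<open>g\<close> have taken their places.\<close>

definition replace_coords ::
    "((nat \<Rightarrow> real) \<Rightarrow> nat \<Rightarrow> real) \<Rightarrow> (nat \<Rightarrow> nat option) \<Rightarrow> (nat \<Rightarrow> real) \<Rightarrow> nat \<Rightarrow> real" where
  "replace_coords g \<sigma> x = (\<lambda>i. case \<sigma> i of None \<Rightarrow> x i | Some l \<Rightarrow> g x l)"

text \<open>In the coordinates \<open>\<Psi> = replace_coords g \<sigma>\<close>, component
  \<open>l\<close> of \<open>g\<close> reads \<open>g (\<Phi> y) l\<close>. Putting it in place of
  coordinate \<open>i\<close> is the change treated by \<open>local_inverse_upd\<close>; composed
  with \<open>\<Psi>\<close>, which \<open>\<Phi>\<close> undoes, it just extends
  \<open>\<sigma>\<close> by one entry.\<close>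

lemma local_inverse_exchange:
  assumes U: "ndomain m U" and g: "smooth_map m U n V g"
    and LI: "local_inverse m p A B (replace_coords g \<sigma>) \<Phi>" and "A \<subseteq> U"
    and i: "i < m" and l: "l < n"
    and nz: "partial_deriv i (\<lambda>y. g (\<Phi> y) l) (replace_coords g \<sigma> p) \<noteq> 0"
  obtains A' B' \<Phi>' where "local_inverse m p A' B' (replace_coords g (\<sigma>(i \<mapsto> l))) \<Phi>'" "A' \<subseteq> U"
proof -
  let ?\<Psi> = "replace_coords g \<sigma>" and ?E = "\<lambda>y. y(i := g (\<Phi> y) l)"
  have A: "ndomain m A" "p \<in> A" and B: "ndomain m B"
    and \<Psi>: "smooth_map m A m B ?\<Psi>" and \<Phi>: "smooth_map m B m A \<Phi>"
    and inv: "\<And>x. x \<in> A \<Longrightarrow> \<Phi> (?\<Psi> x) = x" "\<And>y. y \<in> B \<Longrightarrow> ?\<Psi> (\<Phi> y) = y"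
    using LI by (auto simp: local_inverse_def)
  have gA: "smooth_map m A n V g"
    using smooth_map_subset[OF g \<open>A \<subseteq> U\<close>] smooth_map_into[OF g] \<open>A \<subseteq> U\<close> by blast
  have p: "?\<Psi> p \<in> B" using smooth_map_into[OF \<Psi>] A(2) by auto
  have "C_k k m B (\<lambda>y. g (\<Phi> y) l)" for k
    using smooth_map_compose[OF B A(1) \<Phi> gA] l by (rule smooth_map_C_k)
  from local_inverse_upd[OF B p i this nz] obtain A1 B1 \<Theta> where
    LI1: "local_inverse m (?\<Psi> p) A1 B1 ?E \<Theta>" and "A1 \<subseteq> B" by blast
  have A1: "ndomain m A1" "?\<Psi> p \<in> A1" and B1: "ndomain m B1"
    and E: "smooth_map m A1 m B1 ?E" and \<Theta>: "smooth_map m B1 m A1 \<Theta>"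
    and inv1: "\<And>x. x \<in> A1 \<Longrightarrow> \<Theta> (?E x) = x" "\<And>y. y \<in> B1 \<Longrightarrow> ?E (\<Theta> y) = y"
    using LI1 by (auto simp: local_inverse_def)
  define A' where "A' = {x \<in> A. ?\<Psi> x \<in> A1}"
  have A': "ndomain m A'"
    unfolding A'_def by (rule ndomain_smooth_preimage[OF A(1) ndomain_subset[OF B] \<Psi> A1(1)])
  have sub: "A' \<subseteq> A" "p \<in> A'" using A(2) A1(2) by (auto simp: A'_def)
  have eq: "?E (?\<Psi> x) = replace_coords g (\<sigma>(i \<mapsto> l)) x" if "x \<in> A'" for x
  proof -
    have "\<Phi> (?\<Psi> x) = x" using inv(1) that sub(1) by blast
    then have "?E (?\<Psi> x) = (?\<Psi> x)(i := g x l)" by simp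
    then show ?thesis by (auto simp: replace_coords_def fun_eq_iff)
  qed
  have "smooth_map m A' m A1 ?\<Psi>"
    by (rule smooth_map_subset[OF \<Psi> sub(1)]) (auto simp: A'_def)
  then have "smooth_map m A' m B1 (\<lambda>x. ?E (?\<Psi> x))"
    by (rule smooth_map_compose[OF A' A1(1) _ E])
  then have 1: "smooth_map m A' m B1 (replace_coords g (\<sigma>(i \<mapsto> l)))"
    by (rule smooth_map_cong[OF A']) (rule eq)
  have \<Theta>B: "\<Theta> y \<in> A1" "\<Theta> y \<in> B" if "y \<in> B1" for y
    using smooth_map_into[OF \<Theta>] \<open>A1 \<subseteq> B\<close> that by auto
  have into: "\<Phi> (\<Theta> y) \<in> A'" if "y \<in> B1" for y
    using \<Theta>B[OF that] inv(2) smooth_map_into[OF \<Phi>] by (auto simp: A'_def)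
  have "smooth_map m B1 m B \<Theta>"
    using smooth_map_subset[OF \<Theta> subset_refl] \<Theta>B(2) by blast
  then have "smooth_map m B1 m A (\<lambda>y. \<Phi> (\<Theta> y))"
    by (rule smooth_map_compose[OF B1 B _ \<Phi>])
  then have 2: "smooth_map m B1 m A' (\<lambda>y. \<Phi> (\<Theta> y))"
    by (rule smooth_map_subset) (use into in auto)
  have "local_inverse m p A' B1 (replace_coords g (\<sigma>(i \<mapsto> l))) (\<lambda>y. \<Phi> (\<Theta> y))"
    unfolding local_inverse_def
  proof (intro conjI ballI A' sub(2) B1 1 2)
    fix x assume x: "x \<in> A'"
    then have "?\<Psi> x \<in> A1" "x \<in> A" by (auto simp: A'_def)
    then show "\<Phi> (\<Theta> (replace_coords g (\<sigma>(i \<mapsto> l)) x)) = x"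
      using inv1(1)[of "?\<Psi> x", unfolded eq[OF x]] by (simp add: inv(1))
  next
    fix y assume y: "y \<in> B1"
    show "replace_coords g (\<sigma>(i \<mapsto> l)) (\<Phi> (\<Theta> y)) = y"
      by (simp only: eq[OF into[OF y], symmetric] inv(2)[OF \<Theta>B(2)[OF y]] inv1(2)[OF y])
  qed
  then show ?thesis using sub(1) \<open>A \<subseteq> U\<close> that by blast
qed

text \<open>The third part reads the derivative of \<open>g\<close> in the new coordinates. It turns
  a hypothesis on the derivative at \<open>p\<close> into the nonvanishing of a partial derivative
  of \<open>g (\<Phi> y)\<close>.\<close>

lemma total_deriv_local_inverse:
  assumes LI: "local_inverse m p A B \<Psi> \<Phi>"
  shows "v \<in> Rn m \<Longrightarrow> total_deriv m \<Phi> (\<Psi> p) (total_deriv m \<Psi> p v) = v"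
    and "v \<in> Rn m \<Longrightarrow> total_deriv m \<Psi> p (total_deriv m \<Phi> (\<Psi> p) v) = v"
    and "smooth_map m A n V g \<Longrightarrow> V \<subseteq> Rn n \<Longrightarrow> v \<in> Rn m \<Longrightarrow>
      total_deriv m g p v = total_deriv m (\<lambda>y. g (\<Phi> y)) (\<Psi> p) (total_deriv m \<Psi> p v)"
proof -
  have A: "ndomain m A" "p \<in> A" and B: "ndomain m B"
    and \<Psi>: "smooth_map m A m B \<Psi>" and \<Phi>: "smooth_map m B m A \<Phi>"
    and inv: "\<And>x. x \<in> A \<Longrightarrow> \<Phi> (\<Psi> x) = x" "\<And>y. y \<in> B \<Longrightarrow> \<Psi> (\<Phi> y) = y"
    using LI by (auto simp: local_inverse_def)
  have p: "\<Psi> p \<in> B" using smooth_map_into[OF \<Psi>] A(2) by auto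
  show 1: "total_deriv m \<Phi> (\<Psi> p) (total_deriv m \<Psi> p v) = v" if "v \<in> Rn m" for v
  proof -
    have "total_deriv m \<Phi> (\<Psi> p) (total_deriv m \<Psi> p v) = total_deriv m (\<lambda>x. \<Phi> (\<Psi> x)) p v"
      by (rule total_deriv_compose[OF A(1) B ndomain_subset[OF A(1)] \<Psi> \<Phi> A(2), symmetric])
    also have "\<dots> = total_deriv m (\<lambda>x. x) p v"
      by (rule total_deriv_cong[OF A]) (rule inv(1))
    finally show ?thesis by (simp add: total_deriv_ident that)
  qed
  show "total_deriv m \<Psi> p (total_deriv m \<Phi> (\<Psi> p) v) = v" if "v \<in> Rn m"
  proof -
    have "total_deriv m \<Psi> (\<Phi> (\<Psi> p)) (total_deriv m \<Phi> (\<Psi> p) v) =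
        total_deriv m (\<lambda>x. \<Psi> (\<Phi> x)) (\<Psi> p) v"
      by (rule total_deriv_compose[OF B A(1) ndomain_subset[OF B] \<Phi> \<Psi> p, symmetric])
    also have "\<dots> = total_deriv m (\<lambda>x. x) (\<Psi> p) v"
      by (rule total_deriv_cong[OF B p]) (rule inv(2))
    finally show ?thesis by (simp add: total_deriv_ident that inv(1)[OF A(2)])
  qed
  show "total_deriv m g p v = total_deriv m (\<lambda>y. g (\<Phi> y)) (\<Psi> p) (total_deriv m \<Psi> p v)"
    if "smooth_map m A n V g" "V \<subseteq> Rn n" "v \<in> Rn m"
    using total_deriv_compose[OF B A(1) that(2) \<Phi> that(1) p, of "total_deriv m \<Psi> p v"]
    by (simp add: 1[OF that(3)] inv(1)[OF A(2)])
qed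

lemma total_deriv_replace_coords:
  "\<sigma> i = Some l \<Longrightarrow> total_deriv m (replace_coords g \<sigma>) p v i = total_deriv m g p v l"
  by (simp add: total_deriv_def replace_coords_def)

lemma local_inverse_replace_none:
  "ndomain m U \<Longrightarrow> p \<in> U \<Longrightarrow> local_inverse m p U U (replace_coords g Map.empty) (\<lambda>x. x)"
  by (auto simp: local_inverse_def replace_coords_def[abs_def] intro: smooth_map_ident)

definition axis_vec :: "nat \<Rightarrow> nat \<Rightarrow> real" where
  "axis_vec k = (\<lambda>i. if i = k then 1 else 0)"

lemma axis_vec_in_Rn: "k < m \<Longrightarrow> axis_vec k \<in> Rn m"
  by (auto simp: axis_vec_def Rn_iff)

lemma total_deriv_axis_vec:
  "k < m \<Longrightarrow> total_deriv m F x (axis_vec k) l = partial_deriv k (\<lambda>y. F y l) x"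
  by (simp add: total_deriv_def axis_vec_def if_distrib[of "\<lambda>c. _ * c"] cong: if_cong)

text \<open>The vector \<open>u\<close> that the current coordinates see as the k-th axis vector is
  nonzero, so by injectivity some component \<open>l\<close> of \<open>g\<close> varies along it. In
  these coordinates that is a nonzero k-th partial derivative, and coordinate \<open>k\<close> can
  be exchanged.\<close>

lemma replace_all_coords:
  assumes U: "ndomain m U" and p: "p \<in> U" and V: "V \<subseteq> Rn n" and g: "smooth_map m U n V g"
    and inj: "\<And>v. v \<in> Rn m \<Longrightarrow> total_deriv m g p v = 0 \<Longrightarrow> v = 0"
  shows "k \<le> m \<Longrightarrow> \<exists>\<sigma> A B \<Phi>. dom \<sigma> = {..<k} \<and> ran \<sigma> \<subseteq> {..<n} \<and> A \<subseteq> U \<and>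
      local_inverse m p A B (replace_coords g \<sigma>) \<Phi>"
proof (induction k)
  case 0
  then show ?case
    using local_inverse_replace_none[OF U p, of g] by (intro exI[of _ Map.empty]) auto
next
  case (Suc k)
  then obtain \<sigma> A B \<Phi> where \<sigma>: "dom \<sigma> = {..<k}" "ran \<sigma> \<subseteq> {..<n}" and "A \<subseteq> U"
    and LI: "local_inverse m p A B (replace_coords g \<sigma>) \<Phi>" by auto
  let ?\<Psi> = "replace_coords g \<sigma>"
  have k: "k < m" using Suc.prems by simp
  have B: "ndomain m B" "?\<Psi> p \<in> B" and A: "ndomain m A" and \<Phi>: "\<Phi> \<in> B \<rightarrow> A"
    using LI by (auto simp: local_inverse_def smooth_map_def)
  define u where "u = total_deriv m \<Phi> (?\<Psi> p) (axis_vec k)"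
  have u: "u \<in> Rn m"
    unfolding u_def by (rule total_deriv_in_Rn[OF B(1) ndomain_subset[OF A] \<Phi> B(2)])
  have \<Psi>u: "total_deriv m ?\<Psi> p u = axis_vec k"
    unfolding u_def by (rule total_deriv_local_inverse(2)[OF LI axis_vec_in_Rn[OF k]])
  have "u \<noteq> 0"
  proof
    assume "u = 0"
    then have "axis_vec k k = 0" unfolding \<Psi>u[symmetric] by (simp add: total_deriv_def)
    then show False by (simp add: axis_vec_def)
  qed
  then obtain l where l: "total_deriv m g p u l \<noteq> 0"
    using inj[OF u] by (auto simp: fun_eq_iff)
  have "total_deriv m g p u \<in> Rn n"
    by (rule total_deriv_in_Rn[OF U V smooth_map_into[OF g] p])
  with l have ln: "l < n" by (auto simp: Rn_iff not_le[symmetric])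
  have gA: "smooth_map m A n V g"
    using smooth_map_subset[OF g \<open>A \<subseteq> U\<close>] smooth_map_into[OF g] \<open>A \<subseteq> U\<close> by blast
  have "partial_deriv k (\<lambda>y. g (\<Phi> y) l) (?\<Psi> p) \<noteq> 0"
    using l by (simp add: total_deriv_local_inverse(3)[OF LI gA V u] \<Psi>u total_deriv_axis_vec[OF k])
  from local_inverse_exchange[OF U g LI \<open>A \<subseteq> U\<close> k ln this] obtain A' B' \<Phi>' where
    "local_inverse m p A' B' (replace_coords g (\<sigma>(k \<mapsto> l))) \<Phi>'" "A' \<subseteq> U" .
  moreover have "dom (\<sigma>(k \<mapsto> l)) = {..<Suc k}" using \<sigma>(1) by auto
  moreover have "ran (\<sigma>(k \<mapsto> l)) \<subseteq> {..<n}" using \<sigma>(2) ln by (auto simp: ran_def)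
  ultimately show ?case by blast
qed

text \<open>Take \<open>v\<close> mapped by the derivative to the k-th axis vector. In the current
  coordinates, component \<open>k\<close> of \<open>g\<close> has a nonzero partial derivative along
  some \<open>j\<close> in which \<open>v\<close> has a nonzero entry. Such a \<open>j\<close> is
  still unexchanged, because exchanged coordinates are components \<open>l < k\<close> of
  \<open>g\<close> and these are stationary along \<open>v\<close>; so no earlier exchange is
  undone.\<close>

lemma use_all_components:
  assumes U: "ndomain m U" and p: "p \<in> U" and V: "V \<subseteq> Rn n" and g: "smooth_map m U n V g"
    and surj: "\<And>w. w \<in> Rn n \<Longrightarrow> \<exists>v\<in>Rn m. total_deriv m g p v = w"
  shows "k \<le> n \<Longrightarrow> \<exists>\<sigma> A B \<Phi>. dom \<sigma> \<subseteq> {..<m} \<and> ran \<sigma> = {..<k} \<and> A \<subseteq> U \<and>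
      local_inverse m p A B (replace_coords g \<sigma>) \<Phi>"
proof (induction k)
  case 0
  then show ?case
    using local_inverse_replace_none[OF U p, of g] by (intro exI[of _ Map.empty]) auto
next
  case (Suc k)
  then obtain \<sigma> A B \<Phi> where \<sigma>: "dom \<sigma> \<subseteq> {..<m}" "ran \<sigma> = {..<k}" and "A \<subseteq> U"
    and LI: "local_inverse m p A B (replace_coords g \<sigma>) \<Phi>" by auto
  let ?\<Psi> = "replace_coords g \<sigma>"
  have k: "k < n" using Suc.prems by simp
  obtain v where v: "v \<in> Rn m" "total_deriv m g p v = axis_vec k"
    using surj[OF axis_vec_in_Rn[OF k]] by blast
  have gA: "smooth_map m A n V g"
    using smooth_map_subset[OF g \<open>A \<subseteq> U\<close>] smooth_map_into[OF g] \<open>A \<subseteq> U\<close> by blast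
  have "total_deriv m (\<lambda>y. g (\<Phi> y)) (?\<Psi> p) (total_deriv m ?\<Psi> p v) k = 1"
    unfolding total_deriv_local_inverse(3)[OF LI gA V v(1), symmetric] v(2)
    by (simp add: axis_vec_def)
  then have "\<exists>j\<in>{..<m}. partial_deriv j (\<lambda>y. g (\<Phi> y) k) (?\<Psi> p) * total_deriv m ?\<Psi> p v j \<noteq> 0"
    unfolding total_deriv_def[of m "\<lambda>y. g (\<Phi> y)"]
    by (metis (no_types, lifting) sum.neutral zero_neq_one)
  then obtain j where j: "j < m" "partial_deriv j (\<lambda>y. g (\<Phi> y) k) (?\<Psi> p) \<noteq> 0"
    "total_deriv m ?\<Psi> p v j \<noteq> 0" by auto
  have "\<sigma> j = None"
  proof (rule ccontr)
    assume "\<sigma> j \<noteq> None"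
    then obtain l where l: "\<sigma> j = Some l" by auto
    then have "l < k" using \<sigma>(2) by (auto simp: ran_def)
    then show False
      using j(3) total_deriv_replace_coords[of \<sigma> j l m g p v, OF l] v(2) by (simp add: axis_vec_def)
  qed
  from local_inverse_exchange[OF U g LI \<open>A \<subseteq> U\<close> j(1) k j(2)] obtain A' B' \<Phi>' where
    "local_inverse m p A' B' (replace_coords g (\<sigma>(j \<mapsto> k))) \<Phi>'" "A' \<subseteq> U" .
  moreover have "dom (\<sigma>(j \<mapsto> k)) \<subseteq> {..<m}" using \<sigma>(1) j(1) by auto
  moreover have "ran (\<sigma>(j \<mapsto> k)) = {..<Suc k}" 
    using \<sigma>(2) \<open>\<sigma> j = None\<close> by (simp add: ran_map_upd lessThan_Suc)
  ultimately show ?case by blast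
qed

section \<open>Left and right inverses\<close>

text \<open>Exchanged coordinates take their value from \<open>y\<close> and the others are frozen
  at \<open>p\<close>. Both one-sided inverses of \<open>g\<close> are this map followed by
  \<open>\<Phi>\<close>.\<close>

lemma smooth_map_replace_coords_const:
  assumes U: "ndomain n U" and "p \<in> Rn m" "dom \<sigma> \<subseteq> {..<m}"
  shows "smooth_map n U m (Rn m) (\<lambda>y i. case \<sigma> i of None \<Rightarrow> p i | Some l \<Rightarrow> y l)"
  unfolding smooth_map_def
proof (intro conjI allI impI funcsetI)
  fix y show "(\<lambda>i. case \<sigma> i of None \<Rightarrow> p i | Some l \<Rightarrow> y l) \<in> Rn m"
    using assms(2,3) by (auto simp: Rn_iff dom_def split: option.split)
next
  fix i k show "C_k k n U (\<lambda>y. case \<sigma> i of None \<Rightarrow> p i | Some l \<Rightarrow> y l)"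
    by (cases "\<sigma> i") (simp_all del: C_k.simps add: C_k_const[OF U] C_k_coord[OF U])
qed

text \<open>Once all coordinates are exchanged, the change of coordinates depends on
  \<open>x\<close> only through \<open>g x\<close>: on \<open>A\<close> it equals
  \<open>z (g x)\<close>. Undoing it by \<open>\<Phi>\<close> therefore recovers \<open>x\<close>
  from \<open>g x\<close>.\<close>

lemma smooth_left_inverse:
  assumes U: "ndomain m U" and p: "p \<in> U" and V: "ndomain n V" and g: "smooth_map m U n V g"
    and inj: "\<And>v. v \<in> Rn m \<Longrightarrow> total_deriv m g p v = 0 \<Longrightarrow> v = 0"
  obtains A B \<rho> where "ndomain m A" "p \<in> A" "A \<subseteq> U" "ndomain n B" "B \<subseteq> V" "g \<in> A \<rightarrow> B"
    "smooth_map n B m A \<rho>" "\<And>x. x \<in> A \<Longrightarrow> \<rho> (g x) = x"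
proof -
  from replace_all_coords[OF U p ndomain_subset[OF V] g inj, of m] obtain \<sigma> A B \<Phi>
    where \<sigma>: "dom \<sigma> = {..<m}" "ran \<sigma> \<subseteq> {..<n}" and "A \<subseteq> U"
      and LI: "local_inverse m p A B (replace_coords g \<sigma>) \<Phi>" by auto
  have A: "ndomain m A" "p \<in> A" and B: "ndomain m B"
    and \<Psi>: "smooth_map m A m B (replace_coords g \<sigma>)" and \<Phi>: "smooth_map m B m A \<Phi>"
    and inv: "\<And>x. x \<in> A \<Longrightarrow> \<Phi> (replace_coords g \<sigma> x) = x"
    using LI by (auto simp: local_inverse_def)
  define z where "z y i = (case \<sigma> i of None \<Rightarrow> p i | Some l \<Rightarrow> y l)" for y :: "nat \<Rightarrow> real" and i
  have pn: "p \<in> Rn m" using p U ndomain_subset by blast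
  have z: "smooth_map n V m (Rn m) z"
    using smooth_map_replace_coords_const[OF V pn] \<sigma>(1) unfolding z_def[abs_def] by auto
  define B' where "B' = {y \<in> V. z y \<in> B}"
  have B': "ndomain n B'"
    unfolding B'_def by (rule ndomain_smooth_preimage[OF V subset_refl z B])
  have zg: "z (g x) = replace_coords g \<sigma> x" if "x \<in> A" for x
  proof
    fix i
    have "x \<in> Rn m" using that A(1) ndomain_subset by blast
    moreover have "\<sigma> i \<noteq> None" if "i < m" using that \<sigma>(1) by blast
    ultimately show "z (g x) i = replace_coords g \<sigma> x i"
      using pn by (cases "i < m") (auto simp: z_def replace_coords_def Rn_iff split: option.split)
  qed
  have "smooth_map n B' m B z" by (rule smooth_map_subset[OF z]) (auto simp: B'_def)
  then have "smooth_map n B' m A (\<lambda>y. \<Phi> (z y))"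
    by (rule smooth_map_compose[OF B' B _ \<Phi>])
  moreover have "g \<in> A \<rightarrow> B'"
    using smooth_map_into[OF g] smooth_map_into[OF \<Psi>] \<open>A \<subseteq> U\<close> by (auto simp: B'_def zg)
  moreover have "\<Phi> (z (g x)) = x" if "x \<in> A" for x using inv that by (simp add: zg)
  moreover have "B' \<subseteq> V" by (auto simp: B'_def)
  ultimately show ?thesis using A B' \<open>A \<subseteq> U\<close> by (intro that)
qed

text \<open>Once every component of \<open>g\<close> is among the new coordinates, the point
  \<open>\<Phi> (z y)\<close> with new coordinates \<open>z y\<close> is mapped by \<open>g\<close>
  to \<open>y\<close>. Freezing the remaining coordinates at \<open>p\<close> makes the section pass
  through \<open>p\<close>.\<close>

lemma smooth_right_inverse:
  assumes U: "ndomain m U" and p: "p \<in> U" and V: "ndomain n V" and g: "smooth_map m U n V g"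
    and surj: "\<And>w. w \<in> Rn n \<Longrightarrow> \<exists>v\<in>Rn m. total_deriv m g p v = w"
  obtains B s where "ndomain n B" "g p \<in> B" "B \<subseteq> V" "smooth_map n B m U s" "s (g p) = p"
    "\<And>y. y \<in> B \<Longrightarrow> g (s y) = y"
proof -
  from use_all_components[OF U p ndomain_subset[OF V] g surj, of n] obtain \<sigma> A B \<Phi>
    where \<sigma>: "dom \<sigma> \<subseteq> {..<m}" "ran \<sigma> = {..<n}" and "A \<subseteq> U"
      and LI: "local_inverse m p A B (replace_coords g \<sigma>) \<Phi>" by auto
  have A: "ndomain m A" "p \<in> A" and B: "ndomain m B"
    and \<Psi>: "smooth_map m A m B (replace_coords g \<sigma>)" and \<Phi>: "smooth_map m B m A \<Phi>"
    and inv: "\<And>x. x \<in> A \<Longrightarrow> \<Phi> (replace_coords g \<sigma> x) = x"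
      "\<And>y. y \<in> B \<Longrightarrow> replace_coords g \<sigma> (\<Phi> y) = y"
    using LI by (auto simp: local_inverse_def)
  define z where "z y i = (case \<sigma> i of None \<Rightarrow> p i | Some l \<Rightarrow> y l)" for y :: "nat \<Rightarrow> real" and i
  have pn: "p \<in> Rn m" using p U ndomain_subset by blast
  have z: "smooth_map n V m (Rn m) z"
    using smooth_map_replace_coords_const[OF V pn \<sigma>(1)] unfolding z_def[abs_def] .
  define B' where "B' = {y \<in> V. z y \<in> B}"
  have B': "ndomain n B'"
    unfolding B'_def by (rule ndomain_smooth_preimage[OF V subset_refl z B])
  have zp: "z (g p) = replace_coords g \<sigma> p"
    by (auto simp: z_def replace_coords_def)
  have "smooth_map n B' m B z" by (rule smooth_map_subset[OF z]) (auto simp: B'_def)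
  then have "smooth_map n B' m A (\<lambda>y. \<Phi> (z y))"
    by (rule smooth_map_compose[OF B' B _ \<Phi>])
  then have "smooth_map n B' m U (\<lambda>y. \<Phi> (z y))"
    using \<open>A \<subseteq> U\<close> by (auto simp: smooth_map_def)
  moreover have "g p \<in> B'"
    using smooth_map_into[OF g] smooth_map_into[OF \<Psi>] p A(2) by (auto simp: B'_def zp)
  moreover have "\<Phi> (z (g p)) = p" using inv(1) A(2) by (simp add: zp)
  moreover have "g (\<Phi> (z y)) = y" if y: "y \<in> B'" for y
  proof
    fix l
    have zB: "z y \<in> B" using y by (simp add: B'_def)
    then have "\<Phi> (z y) \<in> U" using smooth_map_into[OF \<Phi>] \<open>A \<subseteq> U\<close> by auto
    then have Rn: "g (\<Phi> (z y)) \<in> Rn n" "y \<in> Rn n"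
      using smooth_map_into[OF g] ndomain_subset[OF V] y by (auto simp: B'_def)
    show "g (\<Phi> (z y)) l = y l"
    proof (cases "l < n")
      case True
      then have "l \<in> ran \<sigma>" by (simp add: \<sigma>(2))
      then obtain i where "\<sigma> i = Some l" unfolding ran_def by blast
      then show ?thesis
        using fun_cong[OF inv(2)[OF zB], of i] by (simp add: z_def replace_coords_def)
    next
      case False
      then show ?thesis using Rn by (simp add: Rn_iff)
    qed
  qed
  moreover have "B' \<subseteq> V" by (auto simp: B'_def)
  ultimately show ?thesis using B' by (intro that)
qed

section \<open>Diffeological spaces and charts\<close>

lemma plotD:
  assumes "diffeological_space X" "(n, U, P) \<in> plots X"
  shows "ndomain n U" "P \<in> U \<rightarrow> points X" "P \<in> extensional U"
  using assms unfolding diffeological_space_def params_def by (auto simp: PiE_def)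

lemma plot_compose:
  assumes "diffeological_space X" "(n, U, P) \<in> plots X" "ndomain m V" "smooth_map m V n U F"
  shows "(m, V, compose V P F) \<in> plots X"
proof -
  have "\<forall>(n, U, P) \<in> plots X. \<forall>m V F. ndomain m V \<and> smooth_map m V n U F \<longrightarrow>
      (m, V, compose V P F) \<in> plots X"
    using assms(1) unfolding diffeological_space_def by (elim conjE)
  from bspec[OF this assms(2)] show ?thesis using assms(3,4) by simp
qed

lemma domain_space_points [simp]: "points (domain_space n U) = U"
  by (simp add: domain_space_def)

lemma subspace_diff_points [simp]: "points (subspace_diff X A) = A"
  by (simp add: subspace_diff_def)

lemma prod_diff_points [simp]: "points (prod_diff X Y) = points X \<times> points Y"
  by (simp add: prod_diff_def)

lemma plots_domain_space:
  "(m, V, F) \<in> plots (domain_space n U) \<longleftrightarrow>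
    ndomain m V \<and> F \<in> extensional V \<and> smooth_map m V n U F"
  by (auto simp: domain_space_def params_def PiE_def smooth_map_def)

lemma plots_subspace_diff:
  "(m, V, F) \<in> plots (subspace_diff X A) \<longleftrightarrow> (m, V, F) \<in> plots X \<and> F ` V \<subseteq> A"
  by (simp add: subspace_diff_def)

lemma plots_prod_diff:
  "(n, U, P) \<in> plots (prod_diff X Y) \<longleftrightarrow>
    ndomain n U \<and> P \<in> extensional U \<and> P \<in> U \<rightarrow> points X \<times> points Y \<and>
    (n, U, compose U fst P) \<in> plots X \<and> (n, U, compose U snd P) \<in> plots Y"
  by (auto simp: prod_diff_def params_def PiE_def)

lemma pullback_points:
  "points (pullback Z g X f) = {(z, x). z \<in> points Z \<and> x \<in> points X \<and> g z = f x}"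
  by (simp add: pullback_def)

lemma plots_pullback:
  "(n, U, P) \<in> plots (pullback Z g X f) \<longleftrightarrow>
    (n, U, P) \<in> plots (prod_diff Z X) \<and> P ` U \<subseteq> points (pullback Z g X f)"
  by (simp add: pullback_def plots_subspace_diff)

lemma smooth_map_restrict:
  "ndomain m V \<Longrightarrow> smooth_map m V n U (restrict F V) \<longleftrightarrow> smooth_map m V n U F"
  by (rule iffI; erule smooth_map_cong[rotated]) auto

lemma identity_plot:
  "ndomain m V \<Longrightarrow> V \<subseteq> U \<Longrightarrow> (m, V, \<lambda>v\<in>V. v) \<in> plots (domain_space m U)"
  by (simp add: plots_domain_space smooth_map_restrict smooth_map_ident)

lemma D_open_domain_space:
  assumes U: "ndomain n U"
  shows "D_open (domain_space n U) A \<longleftrightarrow> ndomain n A \<and> A \<subseteq> U"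
proof
  assume A: "D_open (domain_space n U) A"
  then have "A \<subseteq> U" by (simp add: D_open_def)
  have "ndomain n {u \<in> U. (\<lambda>v\<in>U. v) u \<in> A}"
    using A identity_plot[OF U subset_refl] unfolding D_open_def ndomain_def by blast
  also have "{u \<in> U. (\<lambda>v\<in>U. v) u \<in> A} = A" using \<open>A \<subseteq> U\<close> by auto
  finally show "ndomain n A \<and> A \<subseteq> U" using \<open>A \<subseteq> U\<close> by blast
next
  assume A: "ndomain n A \<and> A \<subseteq> U"
  have "ndomain m {v \<in> V. F v \<in> A}" if "(m, V, F) \<in> plots (domain_space n U)" for m V F
    using that A ndomain_smooth_preimage[OF _ ndomain_subset[OF U]]
    by (auto simp: plots_domain_space)
  then show "D_open (domain_space n U) A"
    using A by (auto simp: D_open_def ndomain_def)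
qed

text \<open>A plot through which plots lift locally, with germwise unique lifts. This is what is needed
  of a diffeological etale chart, and it is stable under translations of the domain.\<close>

definition etale_plot ::
    "'a diff_space \<Rightarrow> nat \<Rightarrow> (nat \<Rightarrow> real) set \<Rightarrow> ((nat \<Rightarrow> real) \<Rightarrow> 'a) \<Rightarrow> bool" where
  "etale_plot X n U \<phi> \<longleftrightarrow> (n, U, \<phi>) \<in> plots X \<and>
    (\<forall>k V Q v u. (k, V, Q) \<in> plots X \<and> v \<in> V \<and> u \<in> U \<and> Q v = \<phi> u \<longrightarrow>
      (\<exists>W h. ndomain k W \<and> v \<in> W \<and> W \<subseteq> V \<and> smooth_map k W n U h \<and> h v = u \<and>
        (\<forall>w\<in>W. \<phi> (h w) = Q w))) \<and>
    (\<forall>k W h h' v. ndomain k W \<and> v \<in> W \<and> smooth_map k W n U h \<and> smooth_map k W n U h' \<and>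
      h v = h' v \<and> (\<forall>w\<in>W. \<phi> (h w) = \<phi> (h' w)) \<longrightarrow>
      (\<exists>W'. ndomain k W' \<and> v \<in> W' \<and> W' \<subseteq> W \<and> (\<forall>w\<in>W'. h w = h' w)))"

lemma etale_plotI:
  assumes "(n, U, \<phi>) \<in> plots X"
    and lift: "\<And>k V Q v u. \<lbrakk>(k, V, Q) \<in> plots X; v \<in> V; u \<in> U; Q v = \<phi> u\<rbrakk> \<Longrightarrow>
      \<exists>W h. ndomain k W \<and> v \<in> W \<and> W \<subseteq> V \<and> smooth_map k W n U h \<and> h v = u \<and>
        (\<forall>w\<in>W. \<phi> (h w) = Q w)"
    and unique: "\<And>k W h h' v. \<lbrakk>ndomain k W; v \<in> W; smooth_map k W n U h; smooth_map k W n U h';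
        h v = h' v; \<forall>w\<in>W. \<phi> (h w) = \<phi> (h' w)\<rbrakk> \<Longrightarrow>
      \<exists>W'. ndomain k W' \<and> v \<in> W' \<and> W' \<subseteq> W \<and> (\<forall>w\<in>W'. h w = h' w)"
  shows "etale_plot X n U \<phi>"
  unfolding etale_plot_def
proof (intro conjI allI impI assms(1); elim conjE)
qed (rule lift unique; assumption)+

lemma etale_plot_lift:
  assumes "etale_plot X n U \<phi>" "(k, V, Q) \<in> plots X" "v \<in> V" "u \<in> U" "Q v = \<phi> u"
  obtains W h where "ndomain k W" "v \<in> W" "W \<subseteq> V" "smooth_map k W n U h" "h v = u"
    "\<forall>w\<in>W. \<phi> (h w) = Q w"
proof -
  have "\<exists>W h. ndomain k W \<and> v \<in> W \<and> W \<subseteq> V \<and> smooth_map k W n U h \<and> h v = u \<and>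
      (\<forall>w\<in>W. \<phi> (h w) = Q w)"
    using assms(1)[unfolded etale_plot_def, THEN conjunct2, THEN conjunct1,
        THEN spec[of _ k], THEN spec[of _ V], THEN spec[of _ Q], THEN spec[of _ v], THEN spec[of _ u]]
      assms(2-5) by simp
  then show ?thesis using that by blast
qed

lemma etale_plot_unique:
  assumes "etale_plot X n U \<phi>" "ndomain k W" "v \<in> W" "smooth_map k W n U h" "smooth_map k W n U h'"
    "h v = h' v" "\<And>w. w \<in> W \<Longrightarrow> \<phi> (h w) = \<phi> (h' w)"
  obtains W' where "ndomain k W'" "v \<in> W'" "W' \<subseteq> W" "\<forall>w\<in>W'. h w = h' w"
proof -
  have "\<exists>W'. ndomain k W' \<and> v \<in> W' \<and> W' \<subseteq> W \<and> (\<forall>w\<in>W'. h w = h' w)"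
    using assms(1)[unfolded etale_plot_def, THEN conjunct2, THEN conjunct2,
        THEN spec[of _ k], THEN spec[of _ W], THEN spec[of _ h], THEN spec[of _ h'], THEN spec[of _ v]]
      assms(2-7) by simp
  then show ?thesis using that by blast
qed

text \<open>D-open sets of the pullback are tested on this plot, which is how they yield open sets
  of parameters in the uniqueness of lifts.\<close>

lemma graph_plot:
  assumes W: "ndomain k W" "W \<subseteq> V" and h: "smooth_map k W n U h" and "\<And>w. w \<in> W \<Longrightarrow> Q w = \<phi> (h w)"
  shows "(k, W, \<lambda>w\<in>W. (w, h w)) \<in> plots (pullback (domain_space k V) Q (domain_space n U) \<phi>)"
proof -
  have "compose W fst (\<lambda>w\<in>W. (w, h w)) = (\<lambda>w\<in>W. w)" "compose W snd (\<lambda>w\<in>W. (w, h w)) = restrict h W"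
    by (auto simp: compose_def)
  moreover have "(k, W, restrict h W) \<in> plots (domain_space n U)"
    using W h by (simp add: plots_domain_space smooth_map_restrict)
  ultimately show ?thesis
    using W assms(4) smooth_map_into[OF h] identity_plot[OF W]
    by (auto simp: plots_pullback plots_prod_diff pullback_points)
qed

text \<open>A local inverse of the projection of the pullback near \<open>(v, u)\<close> is a
  section, and its second component is the lift. Two lifts of one plot with a common value give two
  sections through the same point, and the projection is injective on a D-open set around that
  point. The restriction of \<open>\<phi>\<close> reflects that plots are \<open>undefined\<close>
  off their domain.\<close>

lemma diff_etale_imp_etale_plot:
  assumes X: "diffeological_space X" and U: "ndomain n U" and e: "diff_etale (domain_space n U) X \<phi>"
  shows "etale_plot X n U (restrict \<phi> U)"
proof -
  have "(n, U, compose U \<phi> (\<lambda>u\<in>U. u)) \<in> plots X"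
    using e identity_plot[OF U subset_refl] unfolding diff_etale_def diff_smooth_def by blast
  also have "compose U \<phi> (\<lambda>u\<in>U. u) = restrict \<phi> U" by (auto simp: compose_def)
  finally have plot: "(n, U, restrict \<phi> U) \<in> plots X" .
  have et: "etale (pullback (domain_space k V) Q (domain_space n U) \<phi>) (domain_space k V) fst"
    if "(k, V, Q) \<in> plots X" for k V Q
    using e that unfolding diff_etale_def by blast
  have 1: "\<exists>W h. ndomain k W \<and> v \<in> W \<and> W \<subseteq> V \<and> smooth_map k W n U h \<and> h v = u \<and>
        (\<forall>w\<in>W. restrict \<phi> U (h w) = Q w)"
    if Q: "(k, V, Q) \<in> plots X" and vu: "v \<in> V" "u \<in> U" "Q v = restrict \<phi> U u" for k V Q v u
  proof -
    let ?PB = "pullback (domain_space k V) Q (domain_space n U) \<phi>"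
    have vuP: "(v, u) \<in> points ?PB" using vu by (simp add: pullback_points)
    obtain W W' where W: "D_open ?PB W" "(v, u) \<in> W" "D_open (domain_space k V) W'" "v \<in> W'"
      and d: "diffeomorphism (subspace_diff ?PB W) (subspace_diff (domain_space k V) W') fst"
      using et[OF Q] vuP unfolding etale_def by fastforce
    have W': "ndomain k W'" "W' \<subseteq> V"
      using W(3) D_open_domain_space[OF plotD(1)[OF X Q]] by auto
    define s where "s = inv_into W fst"
    have bij: "bij_betw fst W W'" and s: "diff_smooth (subspace_diff (domain_space k V) W') (subspace_diff ?PB W) s"
      using d by (auto simp: diffeomorphism_def s_def)
    have sW: "s w \<in> W" "fst (s w) = w" if "w \<in> W'" for w
      using bij that unfolding s_def
      by (auto simp: bij_betw_def inv_into_into f_inv_into_f)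
    have sv: "s v = (v, u)"
      using bij W(2) inv_into_f_f[of fst W "(v, u)"] by (auto simp: s_def bij_betw_def)
    have "(k, W', \<lambda>w\<in>W'. w) \<in> plots (subspace_diff (domain_space k V) W')"
      using identity_plot[OF W'] by (auto simp: plots_subspace_diff)
    then have "(k, W', compose W' s (\<lambda>w\<in>W'. w)) \<in> plots (subspace_diff ?PB W)"
      using s unfolding diff_smooth_def by blast
    then have "(k, W', compose W' snd (compose W' s (\<lambda>w\<in>W'. w))) \<in> plots (domain_space n U)"
      by (simp add: plots_subspace_diff plots_pullback plots_prod_diff)
    then have "smooth_map k W' n U (compose W' snd (compose W' s (\<lambda>w\<in>W'. w)))"
      by (simp add: plots_domain_space)
    then have h: "smooth_map k W' n U (\<lambda>w. snd (s w))"
      by (rule smooth_map_cong[OF W'(1)]) (simp add: compose_def)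
    have "restrict \<phi> U (snd (s w)) = Q w" if "w \<in> W'" for w
    proof -
      have "s w \<in> points ?PB" using sW(1)[OF that] W(1) by (auto simp: D_open_def)
      then show ?thesis using sW(2)[OF that] by (auto simp: pullback_points)
    qed
    with h W' W(4) sv show ?thesis by (intro exI[of _ W'] exI[of _ "\<lambda>w. snd (s w)"]) auto
  qed
  have 2: "\<exists>W'. ndomain k W' \<and> v \<in> W' \<and> W' \<subseteq> W \<and> (\<forall>w\<in>W'. h w = h' w)"
    if W: "ndomain k W" "v \<in> W" and h: "smooth_map k W n U h" "smooth_map k W n U h'"
      and v: "h v = h' v" and eq: "\<forall>w\<in>W. restrict \<phi> U (h w) = restrict \<phi> U (h' w)" for k W h h' v
  proof -
    \<comment> \<open>\<open>h\<close> and \<open>h'\<close> both lift this one plot, so their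
      graphs are plots of the same pullback.\<close>
    define Q where "Q = compose W (restrict \<phi> U) h"
    have Q: "(k, W, Q) \<in> plots X" unfolding Q_def by (rule plot_compose[OF X plot W(1) h(1)])
    have Qh: "Q w = \<phi> (h w)" "Q w = \<phi> (h' w)" if "w \<in> W" for w
      using smooth_map_into[OF h(1)] smooth_map_into[OF h(2)] that eq
      by (auto simp: Q_def compose_def Pi_iff)
    let ?PB = "pullback (domain_space k W) Q (domain_space n U) \<phi>"
    have "(v, h v) \<in> points ?PB"
      using smooth_map_into[OF h(1)] W(2) Qh(1) by (auto simp: pullback_points)
    then obtain S S' where S: "D_open ?PB S" "(v, h v) \<in> S"
      and d: "diffeomorphism (subspace_diff ?PB S) (subspace_diff (domain_space k W) S') fst"
      using et[OF Q] unfolding etale_def by blast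
    have inj: "inj_on fst S" using d by (simp add: diffeomorphism_def bij_betw_def)
    have op: "ndomain k {w \<in> W. (w, g w) \<in> S}"
      if g: "smooth_map k W n U g" "\<And>w. w \<in> W \<Longrightarrow> Q w = \<phi> (g w)" for g
    proof -
      have "openin (Euclidean_space k) {w \<in> W. (\<lambda>w\<in>W. (w, g w)) w \<in> S}"
        using S(1) graph_plot[of k W W n U g Q \<phi>, OF W(1) subset_refl g] unfolding D_open_def by blast
      also have "{w \<in> W. (\<lambda>w\<in>W. (w, g w)) w \<in> S} = {w \<in> W. (w, g w) \<in> S}" by auto
      finally show ?thesis by (simp add: ndomain_def)
    qed
    let ?W' = "{w \<in> W. (w, h w) \<in> S} \<inter> {w \<in> W. (w, h' w) \<in> S}"
    have "ndomain k ?W'" using op[OF h(1) Qh(1)] op[OF h(2) Qh(2)] by (rule ndomain_Int)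
    moreover have "v \<in> ?W'" using W(2) S(2) v by auto
    moreover have "h w = h' w" if "w \<in> ?W'" for w
      using inj_onD[OF inj, of "(w, h w)" "(w, h' w)"] that by auto
    ultimately show ?thesis by blast
  qed
  show ?thesis
    by (rule etale_plotI[OF plot 1 2])
qed

lemma smooth_map_translate:
  assumes "ndomain k W" "smooth_map k W n U h" "\<And>w. w \<in> W \<Longrightarrow> (\<lambda>i. h w i + a i) \<in> U'"
  shows "smooth_map k W n U' (\<lambda>w i. h w i + a i)"
  using assms(2,3) C_k_add[OF assms(1) _ C_k_const[OF assms(1)]]
  by (simp add: smooth_map_def del: C_k.simps)

text \<open>Tangent vectors come from plots centered at the origin, whereas a chart reaches a given
  point at some parameter \<open>a\<close>. Lifts through the translated chart are lifts through
  \<open>\<phi>\<close> shifted by \<open>-a\<close>.\<close>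

lemma etale_plot_translate:
  assumes X: "diffeological_space X" and e: "etale_plot X n U \<phi>" and a: "a \<in> U"
  defines "U' \<equiv> {u \<in> Rn n. (\<lambda>i. u i + a i) \<in> U}"
  shows "etale_plot X n U' (\<lambda>u\<in>U'. \<phi> (\<lambda>i. u i + a i))"
proof -
  let ?\<tau> = "\<lambda>u i. u i + a i"
  have plot: "(n, U, \<phi>) \<in> plots X" using e by (simp add: etale_plot_def)
  have U: "ndomain n U" by (rule plotD(1)[OF X plot])
  have an: "a \<in> Rn n" using a ndomain_subset[OF U] by blast
  have "smooth_map n (Rn n) n (Rn n) ?\<tau>"
    using an by (intro smooth_map_translate[OF ndomain_Rn smooth_map_ident[OF ndomain_Rn subset_refl]])
      (auto simp: Rn_iff)
  note \<tau> = this
  have U': "ndomain n U'"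
    unfolding U'_def by (rule ndomain_smooth_preimage[OF ndomain_Rn subset_refl \<tau> U])
  have \<tau>U: "smooth_map n U' n U ?\<tau>"
    by (rule smooth_map_subset[OF \<tau>]) (auto simp: U'_def)
  have 0: "(n, U', \<lambda>u\<in>U'. \<phi> (?\<tau> u)) \<in> plots X"
    using plot_compose[OF X plot U' \<tau>U] by (simp add: compose_def)
  have 1: "\<exists>W h. ndomain k W \<and> v \<in> W \<and> W \<subseteq> V \<and> smooth_map k W n U' h \<and> h v = u \<and>
        (\<forall>w\<in>W. (\<lambda>u\<in>U'. \<phi> (?\<tau> u)) (h w) = Q w)"
    if Q: "(k, V, Q) \<in> plots X" and vu: "v \<in> V" "u \<in> U'" "Q v = (\<lambda>u\<in>U'. \<phi> (?\<tau> u)) u" for k V Q v u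
  proof -
    have "?\<tau> u \<in> U" "Q v = \<phi> (?\<tau> u)" using vu by (auto simp: U'_def)
    then obtain W h where
      W: "ndomain k W" "v \<in> W" "W \<subseteq> V" and h: "smooth_map k W n U h" "h v = ?\<tau> u"
      "\<forall>w\<in>W. \<phi> (h w) = Q w" by (rule etale_plot_lift[OF e Q vu(1)])
    have hU': "(\<lambda>i. h w i + - a i) \<in> U'" if "w \<in> W" for w
      using smooth_map_into[OF h(1)] that an ndomain_subset[OF U] by (auto simp: U'_def Rn_iff subset_iff Pi_iff)
    have "smooth_map k W n U' (\<lambda>w i. h w i + - a i)"
      by (rule smooth_map_translate[OF W(1) h(1), of "\<lambda>i. - a i"]) (rule hU')
    then show ?thesis
      using W h(2,3) hU' by (intro exI[of _ W] exI[of _ "\<lambda>w i. h w i + - a i"]) auto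
  qed
  have 2: "\<exists>W'. ndomain k W' \<and> v \<in> W' \<and> W' \<subseteq> W \<and> (\<forall>w\<in>W'. h w = h' w)"
    if W: "ndomain k W" "v \<in> W" and h: "smooth_map k W n U' h" "smooth_map k W n U' h'"
      and v: "h v = h' v"
      and eq: "\<forall>w\<in>W. (\<lambda>u\<in>U'. \<phi> (?\<tau> u)) (h w) = (\<lambda>u\<in>U'. \<phi> (?\<tau> u)) (h' w)" for k W h h' v
  proof -
    have hU': "h w \<in> U'" "h' w \<in> U'" if "w \<in> W" for w
      using smooth_map_into[OF h(1)] smooth_map_into[OF h(2)] that by auto
    have "smooth_map k W n U (\<lambda>w. ?\<tau> (h w))" "smooth_map k W n U (\<lambda>w. ?\<tau> (h' w))"
      by (rule smooth_map_compose[OF W(1) U' h(1) \<tau>U], rule smooth_map_compose[OF W(1) U' h(2) \<tau>U])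
    moreover have "?\<tau> (h v) = ?\<tau> (h' v)" by (simp add: v)
    moreover have "\<phi> (?\<tau> (h w)) = \<phi> (?\<tau> (h' w))" if "w \<in> W" for w
      using eq that hU' by auto
    ultimately obtain W' where "ndomain k W'" "v \<in> W'" "W' \<subseteq> W"
      "\<forall>w\<in>W'. ?\<tau> (h w) = ?\<tau> (h' w)"
      by (rule etale_plot_unique[OF e W])
    moreover have "h w = h' w" if "?\<tau> (h w) = ?\<tau> (h' w)" for w
    proof
      show "h w i = h' w i" for i using fun_cong[OF that, of i] by simp
    qed
    ultimately show ?thesis by blast
  qed
  show ?thesis
    by (rule etale_plotI[OF 0 1 2])
qed

lemma diff_etale_manifold_chart:
  assumes X: "diff_etale_manifold n X" and x: "x \<in> points X"
  obtains U \<phi> where "etale_plot X n U \<phi>" "0 \<in> U" "\<phi> 0 = x"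
proof -
  have dX: "diffeological_space X" using X by (simp add: diff_etale_manifold_def)
  obtain U \<phi> a where U: "ndomain n U" "diff_etale (domain_space n U) X \<phi>" "a \<in> U" "\<phi> a = x"
  proof -
    from X obtain \<A> where \<A>: "\<forall>(U, \<phi>)\<in>\<A>. ndomain n U \<and> diff_etale (domain_space n U) X \<phi>"
      "(\<Union>(U, \<phi>)\<in>\<A>. \<phi> ` U) = points X"
      unfolding diff_etale_manifold_def by (elim conjE exE)
    from x obtain U \<phi> a where "(U, \<phi>) \<in> \<A>" "a \<in> U" "\<phi> a = x"
      unfolding \<A>(2)[symmetric] by auto
    with \<A>(1) that show thesis by auto
  qed
  define U' where "U' = {u \<in> Rn n. (\<lambda>i. u i + a i) \<in> U}"
  have "0 \<in> U'" using U(3) by (auto simp: U'_def Rn_iff)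
  moreover have "(\<lambda>u\<in>U'. restrict \<phi> U (\<lambda>i. u i + a i)) 0 = x"
    using \<open>0 \<in> U'\<close> U(3,4) by simp
  moreover have "etale_plot X n U' (\<lambda>u\<in>U'. restrict \<phi> U (\<lambda>i. u i + a i))"
    unfolding U'_def
    by (rule etale_plot_translate[OF dX diff_etale_imp_etale_plot[OF dX U(1,2)] U(3)])
  ultimately show ?thesis by (intro that)
qed

section \<open>Internal tangent spaces\<close>

lemma diff0_eq_total_deriv: "diff0 m F v = total_deriv m F 0 v"
  by (simp add: diff0_def total_deriv_def)

lemma diff0_add: "diff0 m F (v + w) i = diff0 m F v i + diff0 m F w i"
  by (simp add: diff0_def distrib_left sum.distrib)

lemma diff0_scale: "diff0 m F (\<lambda>i. c * v i) i = c * diff0 m F v i"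
  by (simp add: diff0_def sum_distrib_left mult_ac)

lemma diff0_zero: "diff0 m F 0 i = 0"
  by (simp add: diff0_def)

lemma centered_plotsD:
  assumes "diffeological_space X" "(n, U, P) \<in> centered_plots X x"
  shows "(n, U, P) \<in> plots X" "ndomain n U" "0 \<in> U" "P 0 = x"
  using assms plotD(1) by (auto simp: centered_plots_def)

lemma represents_morphismE:
  assumes "represents_morphism (k, V, Q) (n, U, P) F"
  obtains W where "W \<subseteq> V" "ndomain k W" "0 \<in> W" "smooth_map k W n U F" "F 0 = 0"
    "\<forall>w\<in>W. Q w = P (F w)"
  using assms unfolding represents_morphism_def by auto

lemma represents_morphismI:
  assumes "W \<subseteq> V" "ndomain k W" "0 \<in> W" "smooth_map k W n U F" "F 0 = 0"
    "\<And>w. w \<in> W \<Longrightarrow> Q w = P (F w)"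
  shows "represents_morphism (k, V, Q) (n, U, P) F"
  using assms unfolding represents_morphism_def by auto

lemma represents_morphism_ident:
  "ndomain n U \<Longrightarrow> 0 \<in> U \<Longrightarrow> represents_morphism (n, U, P) (n, U, P) (\<lambda>x. x)"
  by (rule represents_morphismI[OF subset_refl]) (auto intro: smooth_map_ident)

lemma diff0_ident: "v \<in> Rn n \<Longrightarrow> diff0 n (\<lambda>x. x) v = v"
  by (simp add: diff0_eq_total_deriv total_deriv_ident)

lemma represents_morphism_diff0_in_Rn:
  assumes "represents_morphism (k, V, Q) (n, U, P) F" "ndomain n U"
  shows "diff0 k F v \<in> Rn n"
proof -
  obtain W where W: "ndomain k W" "0 \<in> W" "smooth_map k W n U F"
    using assms(1) by (rule represents_morphismE)
  show ?thesis
    unfolding diff0_eq_total_deriv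
    by (rule total_deriv_in_Rn[OF W(1) ndomain_subset[OF assms(2)] smooth_map_into[OF W(3)] W(2)])
qed

lemma represents_morphism_compose:
  assumes F: "represents_morphism (k, V, Q) (n, U, P) F" and G: "represents_morphism (n, U, P) (l, S, R) G"
    and U: "ndomain n U" and S: "ndomain l S"
  shows "represents_morphism (k, V, Q) (l, S, R) (\<lambda>x. G (F x))"
    and "diff0 k (\<lambda>x. G (F x)) v = diff0 n G (diff0 k F v)"
proof -
  obtain W where W: "W \<subseteq> V" "ndomain k W" "0 \<in> W" "smooth_map k W n U F" "F 0 = 0"
    "\<forall>w\<in>W. Q w = P (F w)" using F by (rule represents_morphismE)
  obtain W1 where W1: "W1 \<subseteq> U" "ndomain n W1" "0 \<in> W1" "smooth_map n W1 l S G" "G 0 = 0"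
    "\<forall>w\<in>W1. P w = R (G w)" using G by (rule represents_morphismE)
  define W' where "W' = {w \<in> W. F w \<in> W1}"
  have W': "ndomain k W'"
    unfolding W'_def by (rule ndomain_smooth_preimage[OF W(2) ndomain_subset[OF U] W(4) W1(2)])
  have sub: "W' \<subseteq> W" "0 \<in> W'" using W(3,5) W1(3) by (auto simp: W'_def)
  have FW': "smooth_map k W' n W1 F"
    by (rule smooth_map_subset[OF W(4) sub(1)]) (auto simp: W'_def)
  show "represents_morphism (k, V, Q) (l, S, R) (\<lambda>x. G (F x))"
  proof (rule represents_morphismI[OF _ W' sub(2)])
    show "smooth_map k W' l S (\<lambda>x. G (F x))" by (rule smooth_map_compose[OF W' W1(2) FW' W1(4)])
    show "Q w = R (G (F w))" if "w \<in> W'" for w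
      using that W(6) W1(6) by (auto simp: W'_def)
  qed (use W(1,5) W1(5) sub in auto)
  show "diff0 k (\<lambda>x. G (F x)) v = diff0 n G (diff0 k F v)"
    using total_deriv_compose[OF W' W1(2) ndomain_subset[OF S] FW' W1(4) sub(2), of v]
    by (simp add: diff0_eq_total_deriv W(5))
qed

text \<open>Together with \<open>etale_plot_morphism_unique\<close> this expresses that a centered
  chart is terminal among centered plots. Surjectivity of its structure map rests on existence
  alone, injectivity on both.\<close>

lemma etale_plot_morphism_exists:
  assumes X: "diffeological_space X" and e: "etale_plot X n U \<phi>" and p: "0 \<in> U" "\<phi> 0 = x"
    and q: "q \<in> centered_plots X x"
  shows "\<exists>h. represents_morphism q (n, U, \<phi>) h"
proof -
  obtain k V Q where q': "q = (k, V, Q)" by (cases q)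
  note c = centered_plotsD[OF X q[unfolded q']]
  have "Q 0 = \<phi> 0" using c(4) p(2) by simp
  then obtain W h where
    "ndomain k W" "0 \<in> W" "W \<subseteq> V" "smooth_map k W n U h" "h 0 = 0"
    "\<forall>w\<in>W. \<phi> (h w) = Q w" by (rule etale_plot_lift[OF e c(1,3) p(1)])
  then have "represents_morphism (k, V, Q) (n, U, \<phi>) h"
    by (intro represents_morphismI) auto
  then show ?thesis unfolding q' by blast
qed

text \<open>Two lifts that agree at the origin agree near it, and differentials at the origin depend
  only on germs.\<close>

lemma etale_plot_morphism_unique:
  assumes X: "diffeological_space X" and e: "etale_plot X n U \<phi>"
    and h: "represents_morphism q (n, U, \<phi>) h" "represents_morphism q (n, U, \<phi>) h'"
  shows "diff0 (fst q) h v = diff0 (fst q) h' v"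
proof -
  obtain k V Q where q': "q = (k, V, Q)" by (cases q)
  obtain W where W: "W \<subseteq> V" "ndomain k W" "0 \<in> W" "smooth_map k W n U h" "h 0 = 0"
    "\<forall>w\<in>W. Q w = \<phi> (h w)" using h(1)[unfolded q'] by (rule represents_morphismE)
  obtain W1 where W1: "W1 \<subseteq> V" "ndomain k W1" "0 \<in> W1" "smooth_map k W1 n U h'" "h' 0 = 0"
    "\<forall>w\<in>W1. Q w = \<phi> (h' w)" using h(2)[unfolded q'] by (rule represents_morphismE)
  have "ndomain k (W \<inter> W1)" "0 \<in> W \<inter> W1" using W W1 by (auto intro: ndomain_Int)
  moreover have "smooth_map k (W \<inter> W1) n U h" "smooth_map k (W \<inter> W1) n U h'"
    using smooth_map_into[OF W(4)] smooth_map_into[OF W1(4)]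
    by (intro smooth_map_subset[OF W(4)] smooth_map_subset[OF W1(4)]; auto)+
  moreover have "h 0 = h' 0" by (simp add: W(5) W1(5))
  moreover have "\<phi> (h w) = \<phi> (h' w)" if "w \<in> W \<inter> W1" for w
    using W(6) W1(6) that by (metis IntE)
  ultimately obtain W' where "ndomain k W'" "0 \<in> W'" "W' \<subseteq> W \<inter> W1" "\<forall>w\<in>W'. h w = h' w"
    by (rule etale_plot_unique[OF e])
  then have "total_deriv k h 0 v = total_deriv k h' 0 v" by (intro total_deriv_cong) auto
  then show ?thesis by (simp add: q' diff0_eq_total_deriv)
qed

section \<open>Cosets of the relations and the structure map of a chart\<close>

lemma subspace_tangent_relations: "fam.subspace (tangent_relations X x)"
  unfolding tangent_relations_def by (rule fam.subspace_span)

lemma coset_eq_iff: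
  assumes "fam.subspace R"
  shows "\<xi> +o R = \<eta> +o R \<longleftrightarrow> \<xi> - \<eta> \<in> R"
proof
  assume eq: "\<xi> +o R = \<eta> +o R"
  have "\<xi> + 0 \<in> \<xi> +o R" by (rule set_plus_intro2[OF fam.subspace_0[OF assms]])
  then obtain r where "r \<in> R" "\<xi> = \<eta> + r" unfolding eq by (auto simp: elt_set_plus_def)
  then show "\<xi> - \<eta> \<in> R" by simp
next
  have sub: "\<xi> +o R \<subseteq> \<eta> +o R" if "\<xi> - \<eta> \<in> R" for \<xi> \<eta>
  proof
    fix z assume "z \<in> \<xi> +o R"
    then obtain r where r: "r \<in> R" "z = \<xi> + r" by (auto simp: elt_set_plus_def)
    have "z = \<eta> + ((\<xi> - \<eta>) + r)" by (simp add: r(2))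
    then show "z \<in> \<eta> +o R"
      using fam.subspace_add[OF assms that r(1)] set_plus_intro2 by metis
  qed
  assume "\<xi> - \<eta> \<in> R"
  moreover have "\<eta> - \<xi> \<in> R"
    using fam.subspace_neg[OF assms \<open>\<xi> - \<eta> \<in> R\<close>] by simp
  ultimately show "\<xi> +o R = \<eta> +o R" using sub by blast
qed

lemma subspace_set_plus: "fam.subspace R \<Longrightarrow> R + R = R"
proof (rule equalityI; rule subsetI)
  assume R: "fam.subspace R"
  show "z \<in> R" if "z \<in> R + R" for z using that fam.subspace_add[OF R] by (auto elim: set_plus_elim)
  show "z \<in> R + R" if "z \<in> R" for z using set_plus_intro[OF that fam.subspace_0[OF R]] by simp
qed

lemma coset_add: "fam.subspace R \<Longrightarrow> (\<xi> +o R) + (\<eta> +o R) = (\<xi> + \<eta>) +o R"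
  by (simp add: set_plus_rearrange subspace_set_plus)

lemma coset_scale:
  assumes R: "fam.subspace R"
  shows "fam_scale c ` (\<xi> +o R) + R = fam_scale c \<xi> +o R"
proof (rule equalityI; rule subsetI)
  fix z assume "z \<in> fam_scale c ` (\<xi> +o R) + R"
  then obtain r s where "r \<in> R" "s \<in> R" "z = fam_scale c (\<xi> + r) + s"
    by (auto simp: set_plus_def elt_set_plus_def)
  moreover have "fam_scale c (\<xi> + r) + s = fam_scale c \<xi> + (fam_scale c r + s)"
    by (simp add: fam.scale_right_distrib add.assoc)
  ultimately show "z \<in> fam_scale c \<xi> +o R"
    using fam.subspace_add[OF R fam.subspace_scale[OF R]] by (simp add: set_plus_intro2)
next
  fix z assume "z \<in> fam_scale c \<xi> +o R"
  then obtain r where "r \<in> R" "z = fam_scale c (\<xi> + 0) + r" by (auto simp: elt_set_plus_def)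
  then show "z \<in> fam_scale c ` (\<xi> +o R) + R"
    using fam.subspace_0[OF R] by (blast intro: set_plus_intro2 set_plus_intro)
qed

lemma tangent_inj_add: "tangent_inj p (v + w) = tangent_inj p v + tangent_inj p w"
  by (auto simp: tangent_inj_def fun_eq_iff)

lemma tangent_inj_scale: "tangent_inj p (\<lambda>i. c * v i) = fam_scale c (tangent_inj p v)"
  by (auto simp: tangent_inj_def fam_scale_def fun_eq_iff)

lemma plot_diff_add: "plot_diff X x p v + plot_diff X x p w = plot_diff X x p (v + w)"
  by (simp add: plot_diff_def coset_add subspace_tangent_relations tangent_inj_add)

lemma tangent_scale_plot_diff:
  "tangent_scale X x c (plot_diff X x p v) = plot_diff X x p (\<lambda>i. c * v i)"
  by (simp add: tangent_scale_def plot_diff_def coset_scale subspace_tangent_relations tangent_inj_scale)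

lemma plot_diff_in_tangent_space:
  assumes "p \<in> centered_plots X x" "v \<in> Rn (fst p)"
  shows "plot_diff X x p v \<in> tangent_space X x"
proof -
  have "{q. tangent_inj p v q \<noteq> 0} \<subseteq> {p}" by (auto simp: tangent_inj_def)
  then have "finite {q. tangent_inj p v q \<noteq> 0}" by (rule finite_subset) simp
  then have "tangent_inj p v \<in> tangent_sum X x"
    using assms by (auto simp: tangent_sum_def tangent_inj_def Rn_iff)
  then show ?thesis by (simp add: tangent_space_def plot_diff_def)
qed

lemma plot_diff_morphism:
  assumes "q \<in> centered_plots X x" "p \<in> centered_plots X x" "represents_morphism q p F" "v \<in> Rn (fst q)"
  shows "plot_diff X x q v = plot_diff X x p (diff0 (fst q) F v)"
proof -
  have "tangent_inj q v - tangent_inj p (diff0 (fst q) F v) \<in> tangent_relations X x"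
    unfolding tangent_relations_def by (rule fam.span_base) (use assms in blast)
  then show ?thesis by (simp add: plot_diff_def coset_eq_iff subspace_tangent_relations)
qed

text \<open>Every summand of a tangent vector can be moved to the chart along a morphism from its
  plot; there the finitely many contributions add up.\<close>

lemma plot_diff_surj:
  assumes X: "diffeological_space X" and e: "etale_plot X n U \<phi>" and p: "0 \<in> U" "\<phi> 0 = x"
    and A: "A \<in> tangent_space X x"
  obtains v where "v \<in> Rn n" "A = plot_diff X x (n, U, \<phi>) v"
proof -
  let ?R = "tangent_relations X x" and ?p = "(n, U, \<phi>)"
  have cp: "?p \<in> centered_plots X x" using e p by (simp add: centered_plots_def etale_plot_def)
  have U: "ndomain n U" using centered_plotsD(2)[OF X cp] .
  have sum: "\<exists>v\<in>Rn n. \<xi> +o ?R = plot_diff X x ?p v"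
    if "finite S" "S \<subseteq> centered_plots X x" "\<And>q. q \<in> S \<Longrightarrow> \<xi> q \<in> Rn (fst q)" "\<And>q. q \<notin> S \<Longrightarrow> \<xi> q = 0"
    for S \<xi>
    using that
  proof (induction S arbitrary: \<xi> rule: finite_induct)
    case empty
    then have "\<xi> = tangent_inj ?p 0" by (auto simp: tangent_inj_def fun_eq_iff)
    then have "\<xi> +o ?R = plot_diff X x ?p 0" by (simp add: plot_diff_def)
    then show ?case by (auto simp: Rn_iff intro!: bexI[of _ 0])
  next
    case (insert q S)
    have "\<exists>v\<in>Rn n. \<xi>(q := 0) +o ?R = plot_diff X x ?p v"
    proof (rule insert.IH)
      show "S \<subseteq> centered_plots X x" using insert.prems(1) by blast
      show "(\<xi>(q := 0)) r \<in> Rn (fst r)" if "r \<in> S" for r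
        using insert.prems(2)[of r] that insert.hyps(2) by (cases "r = q") auto
      show "(\<xi>(q := 0)) r = 0" if "r \<notin> S" for r
        using insert.prems(3)[of r] that by (cases "r = q") auto
    qed
    then obtain v where v: "v \<in> Rn n" "\<xi>(q := 0) +o ?R = plot_diff X x ?p v" by blast
    have q: "q \<in> centered_plots X x" "\<xi> q \<in> Rn (fst q)" using insert.prems by auto
    obtain h where h: "represents_morphism q ?p h"
      using etale_plot_morphism_exists[OF X e p q(1)] by blast
    have w: "diff0 (fst q) h (\<xi> q) \<in> Rn n"
      using represents_morphism_diff0_in_Rn[OF _ U] h by (metis fst_conv prod_cases3)
    have "\<xi> = \<xi>(q := 0) + tangent_inj q (\<xi> q)" by (auto simp: tangent_inj_def fun_eq_iff)
    then have "\<xi> +o ?R = (\<xi>(q := 0) +o ?R) + plot_diff X x q (\<xi> q)"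
      by (metis coset_add plot_diff_def subspace_tangent_relations)
    also have "\<dots> = plot_diff X x ?p (v + diff0 (fst q) h (\<xi> q))"
      by (simp add: v(2) plot_diff_morphism[OF q(1) cp h q(2)] plot_diff_add)
    finally have "\<xi> +o ?R = plot_diff X x ?p (v + diff0 (fst q) h (\<xi> q))" .
    moreover have "v + diff0 (fst q) h (\<xi> q) \<in> Rn n" using v(1) w by (simp add: Rn_iff)
    ultimately show ?case by blast
  qed
  obtain \<xi> where \<xi>: "\<xi> \<in> tangent_sum X x" "A = \<xi> +o ?R"
    using A by (auto simp: tangent_space_def)
  have "\<exists>v\<in>Rn n. \<xi> +o ?R = plot_diff X x ?p v"
  proof (rule sum[of "{q. \<xi> q \<noteq> 0}"])
    have s: "if q \<in> centered_plots X x then \<xi> q \<in> Rn (fst q) else \<xi> q = 0" for q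
      using \<xi>(1) unfolding tangent_sum_def by blast
    show "finite {q. \<xi> q \<noteq> 0}" using \<xi>(1) by (simp add: tangent_sum_def)
    show "{q. \<xi> q \<noteq> 0} \<subseteq> centered_plots X x"
    proof
      fix q assume "q \<in> {q. \<xi> q \<noteq> 0}"
      then show "q \<in> centered_plots X x" using s[of q] by (auto split: if_splits)
    qed
    show "\<xi> q \<in> Rn (fst q)" for q using s[of q] by (auto simp: Rn_iff split: if_splits)
  qed auto
  then show ?thesis using \<xi>(2) that by blast
qed

text \<open>For \<open>H q\<close> a lift of \<open>q\<close> through a chart, this vanishes on the tangent relations and inverts the
  structure map of the chart.\<close>

definition lift_deriv ::
    "('a param \<Rightarrow> (nat \<Rightarrow> real) \<Rightarrow> nat \<Rightarrow> real) \<Rightarrow> ('a param \<Rightarrow> nat \<Rightarrow> real) \<Rightarrow> nat \<Rightarrow> real" where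
  "lift_deriv H \<xi> i = (\<Sum>q\<in>{q. \<xi> q \<noteq> 0}. diff0 (fst q) (H q) (\<xi> q) i)"

text \<open>Families with different supports can be compared once the sums run over a common index
  set; the additional terms are zero.\<close>

lemma lift_deriv_superset:
  assumes "finite S" "{q. \<xi> q \<noteq> 0} \<subseteq> S"
  shows "lift_deriv H \<xi> i = (\<Sum>q\<in>S. diff0 (fst q) (H q) (\<xi> q) i)"
  unfolding lift_deriv_def using assms by (intro sum.mono_neutral_left) (auto simp: diff0_zero)

lemma lift_deriv_add:
  assumes "finite {q. \<xi> q \<noteq> 0}" "finite {q. \<eta> q \<noteq> 0}"
  shows "lift_deriv H (\<xi> + \<eta>) i = lift_deriv H \<xi> i + lift_deriv H \<eta> i"
proof -
  let ?S = "{q. \<xi> q \<noteq> 0} \<union> {q. \<eta> q \<noteq> 0}"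
  have "lift_deriv H (\<xi> + \<eta>) i = (\<Sum>q\<in>?S. diff0 (fst q) (H q) ((\<xi> + \<eta>) q) i)"
    by (rule lift_deriv_superset) (use assms in auto)
  also have "\<dots> = (\<Sum>q\<in>?S. diff0 (fst q) (H q) (\<xi> q) i) + (\<Sum>q\<in>?S. diff0 (fst q) (H q) (\<eta> q) i)"
    by (simp add: diff0_add sum.distrib)
  also have "(\<Sum>q\<in>?S. diff0 (fst q) (H q) (\<xi> q) i) = lift_deriv H \<xi> i"
    by (rule lift_deriv_superset[symmetric]) (use assms in auto)
  also have "(\<Sum>q\<in>?S. diff0 (fst q) (H q) (\<eta> q) i) = lift_deriv H \<eta> i"
    by (rule lift_deriv_superset[symmetric]) (use assms in auto)
  finally show ?thesis .
qed

lemma lift_deriv_scale: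
  assumes "finite {q. \<xi> q \<noteq> 0}"
  shows "lift_deriv H (fam_scale c \<xi>) i = c * lift_deriv H \<xi> i"
proof -
  have "{q. fam_scale c \<xi> q \<noteq> 0} \<subseteq> {q. \<xi> q \<noteq> 0}" by (auto simp: fam_scale_def fun_eq_iff)
  from lift_deriv_superset[OF assms this] show ?thesis
    by (simp add: lift_deriv_def fam_scale_def diff0_scale sum_distrib_left)
qed

lemma finite_tangent_inj: "finite {q. tangent_inj p v q \<noteq> 0}"
  by (rule finite_subset[of _ "{p}"]) (auto simp: tangent_inj_def)

lemma lift_deriv_tangent_inj: "lift_deriv H (tangent_inj p v) i = diff0 (fst p) (H p) v i"
  by (subst lift_deriv_superset[of "{p}"]) (auto simp: tangent_inj_def)

lemma lift_deriv_diff: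
  assumes "finite {q. \<xi> q \<noteq> 0}" "finite {q. \<eta> q \<noteq> 0}"
  shows "lift_deriv H (\<xi> - \<eta>) i = lift_deriv H \<xi> i - lift_deriv H \<eta> i"
proof -
  have "{q. (\<xi> - \<eta>) q \<noteq> 0} \<subseteq> {q. \<xi> q \<noteq> 0} \<union> {q. \<eta> q \<noteq> 0}"
  proof
    fix q assume "q \<in> {q. (\<xi> - \<eta>) q \<noteq> 0}"
    then show "q \<in> {q. \<xi> q \<noteq> 0} \<union> {q. \<eta> q \<noteq> 0}"
      by (cases "\<xi> q = 0"; cases "\<eta> q = 0") simp_all
  qed
  then have "finite {q. (\<xi> - \<eta>) q \<noteq> 0}" by (rule finite_subset) (use assms in simp)
  from lift_deriv_add[OF this assms(2), of H i]
  have "lift_deriv H ((\<xi> - \<eta>) + \<eta>) i = lift_deriv H (\<xi> - \<eta>) i + lift_deriv H \<eta> i" .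
  then show ?thesis by (simp only: diff_add_cancel)
qed

text \<open>A lift composed with a morphism is again a lift, with the same differential as the
  chosen one, so \<open>lift_deriv\<close> vanishes on the generators of the relations. On the
  summand of the chart it is the identity, because the identity map is a lift of the chart through
  itself.\<close>

lemma plot_diff_inj:
  assumes X: "diffeological_space X" and e: "etale_plot X n U \<phi>" and p: "0 \<in> U" "\<phi> 0 = x"
  shows "inj_on (plot_diff X x (n, U, \<phi>)) (Rn n)"
proof (rule inj_onI)
  let ?p = "(n, U, \<phi>)"
  fix v w assume vw: "v \<in> Rn n" "w \<in> Rn n" "plot_diff X x ?p v = plot_diff X x ?p w"
  have cp: "?p \<in> centered_plots X x" using e p by (simp add: centered_plots_def etale_plot_def)
  have U: "ndomain n U" using centered_plotsD(2)[OF X cp] .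
  define H where "H q = (SOME h. represents_morphism q ?p h)" for q
  have H: "represents_morphism q ?p (H q)" if "q \<in> centered_plots X x" for q
    unfolding H_def by (rule someI_ex[OF etale_plot_morphism_exists[OF X e p that]])
  \<comment> \<open>Finite support is included because additivity of \<open>lift_deriv\<close>
    relies on it: a sum over an infinite support is 0 by convention.\<close>
  let ?K = "{\<xi>. finite {q. \<xi> q \<noteq> 0} \<and> (\<forall>i. lift_deriv H \<xi> i = 0)}"
  have "fam.subspace ?K"
  proof (rule fam.subspaceI)
    show "0 \<in> ?K" by (simp add: lift_deriv_def)
    fix \<xi> \<eta> :: "'a param \<Rightarrow> nat \<Rightarrow> real" and c :: real
    assume \<xi>: "\<xi> \<in> ?K"
    have "{q. fam_scale c \<xi> q \<noteq> 0} \<subseteq> {q. \<xi> q \<noteq> 0}" by (auto simp: fam_scale_def fun_eq_iff)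
    then show "fam_scale c \<xi> \<in> ?K" using \<xi> finite_subset by (auto simp: lift_deriv_scale)
    assume \<eta>: "\<eta> \<in> ?K"
    have "finite {q. (\<xi> + \<eta>) q \<noteq> 0}"
      by (rule finite_subset[of _ "{q. \<xi> q \<noteq> 0} \<union> {q. \<eta> q \<noteq> 0}"]) (use \<xi> \<eta> in auto)
    then show "\<xi> + \<eta> \<in> ?K" using \<xi> \<eta> by (auto simp: lift_deriv_add)
  qed
  moreover have "{tangent_inj q v - tangent_inj p (diff0 (fst q) F v) | q p F v.
       q \<in> centered_plots X x \<and> p \<in> centered_plots X x \<and> represents_morphism q p F \<and>
       v \<in> Rn (fst q)} \<subseteq> ?K"
  proof clarify
    fix k V Q l S R F v
    assume q: "(k, V, Q) \<in> centered_plots X x" and r: "(l, S, R) \<in> centered_plots X x"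
      and F: "represents_morphism (k, V, Q) (l, S, R) F"
    let ?q = "(k, V, Q)" and ?r = "(l, S, R)"
    have S: "ndomain l S" using centered_plotsD(2)[OF X r] .
    have "diff0 k (H ?q) v = diff0 k (\<lambda>x. H ?r (F x)) v"
      using etale_plot_morphism_unique[OF X e H[OF q] represents_morphism_compose(1)[OF F H[OF r] S U]]
      by simp
    also have "\<dots> = diff0 l (H ?r) (diff0 k F v)"
      by (rule represents_morphism_compose(2)[OF F H[OF r] S U])
    finally have "lift_deriv H (tangent_inj ?q v - tangent_inj ?r (diff0 k F v)) i = 0" for i
      by (simp add: lift_deriv_diff finite_tangent_inj lift_deriv_tangent_inj)
    moreover have "finite {z. (tangent_inj ?q v - tangent_inj ?r (diff0 k F v)) z \<noteq> 0}"
      by (rule finite_subset[of _ "{?q, ?r}"]) (auto simp: tangent_inj_def)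
    ultimately show "finite {z. (tangent_inj ?q v - tangent_inj ?r (diff0 (fst ?q) F v)) z \<noteq> 0} \<and>
      (\<forall>i. lift_deriv H (tangent_inj ?q v - tangent_inj ?r (diff0 (fst ?q) F v)) i = 0)" by simp
  qed
  ultimately have "tangent_relations X x \<subseteq> ?K"
    unfolding tangent_relations_def by (intro fam.span_minimal)
  moreover have "tangent_inj ?p v - tangent_inj ?p w \<in> tangent_relations X x"
    using vw(3) by (simp add: plot_diff_def coset_eq_iff subspace_tangent_relations)
  ultimately have "lift_deriv H (tangent_inj ?p v - tangent_inj ?p w) i = 0" for i by auto
  then have "diff0 n (H ?p) v i = diff0 n (H ?p) w i" for i
    by (simp add: lift_deriv_diff finite_tangent_inj lift_deriv_tangent_inj)
  then have "diff0 n (H ?p) v = diff0 n (H ?p) w" by (rule ext)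
  \<comment> \<open>The chosen lift \<open>H ?p\<close> may differ from the identity map, but
    uniqueness gives it the same differential.\<close>
  moreover have "diff0 n (H ?p) u = u" if "u \<in> Rn n" for u
    using etale_plot_morphism_unique[OF X e H[OF cp] represents_morphism_ident[OF U p(1)], of u]
    by (simp add: diff0_ident[OF that])
  ultimately show "v = w" using vw(1,2) by metis
qed

section \<open>The internal tangent map in charts\<close>

lemma centered_plots_map:
  assumes "diff_smooth X Y f" "(k, V, Q) \<in> centered_plots X x"
  shows "(k, V, compose V f Q) \<in> centered_plots Y (f x)"
  using assms by (auto simp: centered_plots_def diff_smooth_def compose_def)

lemma represents_morphism_map:
  assumes "represents_morphism (k, V, Q) (n, U, P) F"
  shows "represents_morphism (k, V, compose V f Q) (n, U, compose U f P) F"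
proof -
  obtain W where W: "W \<subseteq> V" "ndomain k W" "0 \<in> W" "smooth_map k W n U F" "F 0 = 0"
    "\<forall>w\<in>W. Q w = P (F w)" using assms by (rule represents_morphismE)
  show ?thesis
    by (rule represents_morphismI[OF W(1-5)])
       (use W(1,6) smooth_map_into[OF W(4)] in \<open>auto simp: compose_def\<close>)
qed

text \<open>The \<open>THE\<close> in \<open>tangent_map\<close> requires existence and uniqueness.
  As the structure map of the chart is bijective, the prescribed values on the chart alone determine
  a map \<open>L\<close>. It takes the prescribed values on every other plot as well, since such a
  plot lifts through the chart and the lift is also a morphism between the plots composed with
  \<open>f\<close>.\<close>

lemma tangent_map_plot_diff:
  assumes X: "diffeological_space X" and f: "diff_smooth X Y f"
    and e: "etale_plot X n U \<phi>" and p: "0 \<in> U" "\<phi> 0 = x" and v: "v \<in> Rn n"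
  shows "tangent_map X Y f x (plot_diff X x (n, U, \<phi>) v) =
    plot_diff Y (f x) (n, U, compose U f \<phi>) v"
proof -
  let ?p = "(n, U, \<phi>)" and ?fp = "(n, U, compose U f \<phi>)" and ?T = "tangent_space X x"
  let ?d = "plot_diff X x ?p" and ?fd = "plot_diff Y (f x) ?fp"
  let ?spec = "\<lambda>L. L \<in> extensional ?T \<and> tangent_linear X x Y (f x) L \<and>
     (\<forall>(n, U, P) \<in> centered_plots X x. \<forall>v \<in> Rn n.
        L (plot_diff X x (n, U, P) v) = plot_diff Y (f x) (n, U, compose U f P) v)"
  have cp: "?p \<in> centered_plots X x" using e p by (simp add: centered_plots_def etale_plot_def)
  have U: "ndomain n U" using centered_plotsD(2)[OF X cp] .
  have cfp: "?fp \<in> centered_plots Y (f x)" by (rule centered_plots_map[OF f cp])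
  have inj: "inj_on ?d (Rn n)" by (rule plot_diff_inj[OF X e p])
  define L where "L = (\<lambda>A\<in>?T. ?fd (the_inv_into (Rn n) ?d A))"
  have dT: "?d v \<in> ?T" if "v \<in> Rn n" for v
    using plot_diff_in_tangent_space[OF cp] that by simp
  have L: "L (?d v) = ?fd v" if "v \<in> Rn n" for v
    using that dT by (simp add: L_def the_inv_into_f_f[OF inj])
  have "?spec L"
  proof (intro conjI)
    show "L \<in> extensional ?T" by (simp add: L_def)
    show "tangent_linear X x Y (f x) L"
      unfolding tangent_linear_def
    proof (intro conjI allI ballI funcsetI)
      fix A assume "A \<in> ?T"
      then obtain v where v: "v \<in> Rn n" "A = ?d v" by (rule plot_diff_surj[OF X e p])
      show "L A \<in> tangent_space Y (f x)"
        using plot_diff_in_tangent_space[OF cfp] v by (simp add: L)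
      have sv: "(\<lambda>i. c * v i) \<in> Rn n" for c using v(1) by (simp add: Rn_iff)
      show "L (tangent_scale X x c A) = tangent_scale Y (f x) c (L A)" for c
        by (simp add: v(2) L[OF v(1)] L[OF sv] tangent_scale_plot_diff)
      fix B assume "B \<in> ?T"
      then obtain w where w: "w \<in> Rn n" "B = ?d w" by (rule plot_diff_surj[OF X e p])
      have "v + w \<in> Rn n" using v(1) w(1) by (simp add: Rn_iff)
      then show "L (A + B) = L A + L B"
        by (simp add: v(2) w(2) plot_diff_add L v(1) w(1))
    qed
    show "\<forall>(k, V, Q) \<in> centered_plots X x. \<forall>v \<in> Rn k.
        L (plot_diff X x (k, V, Q) v) = plot_diff Y (f x) (k, V, compose V f Q) v"
    proof clarify
      fix k V Q v assume q: "(k, V, Q) \<in> centered_plots X x" and v: "v \<in> Rn k"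
      obtain h where h: "represents_morphism (k, V, Q) ?p h"
        using etale_plot_morphism_exists[OF X e p q] by blast
      have "L (plot_diff X x (k, V, Q) v) = L (?d (diff0 k h v))"
        using plot_diff_morphism[OF q cp h] v by simp
      also have "\<dots> = ?fd (diff0 k h v)"
        by (rule L[OF represents_morphism_diff0_in_Rn[OF h U]])
      also have "\<dots> = plot_diff Y (f x) (k, V, compose V f Q) v"
        using plot_diff_morphism[OF centered_plots_map[OF f q] cfp represents_morphism_map[OF h]] v
        by simp
      finally show "L (plot_diff X x (k, V, Q) v) = plot_diff Y (f x) (k, V, compose V f Q) v" .
    qed
  qed
  moreover have "L' = L" if "?spec L'" for L'
  proof (rule extensionalityI[of _ ?T])
    show "L' \<in> extensional ?T" using that by blast
    show "L \<in> extensional ?T" by (simp add: L_def)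
    fix A assume "A \<in> ?T"
    then obtain v where v: "v \<in> Rn n" "A = ?d v" by (rule plot_diff_surj[OF X e p])
    have "L' (?d v) = ?fd v" using that cp v(1) by fast
    then show "L' A = L A" by (simp add: v L)
  qed
  ultimately have "tangent_map X Y f x = L"
    unfolding tangent_map_def by (rule the_equality)
  then show ?thesis by (simp add: L[OF v])
qed

text \<open>\<open>f\<close> after \<open>\<phi>\<close> is a centered plot of the target and
  \<open>g\<close> is a morphism from it to \<open>\<psi>\<close>, so between the two charts the
  tangent map is the differential of \<open>g\<close>.\<close>

lemma tangent_map_chart:
  assumes X: "diffeological_space X" and Y: "diffeological_space Y" and f: "diff_smooth X Y f"
    and e: "etale_plot X m A \<phi>" and p: "0 \<in> A" "\<phi> 0 = x"
    and e': "etale_plot Y n B \<psi>" and p': "0 \<in> B" "\<psi> 0 = f x"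
    and g: "represents_morphism (m, A, compose A f \<phi>) (n, B, \<psi>) g" and v: "v \<in> Rn m"
  shows "tangent_map X Y f x (plot_diff X x (m, A, \<phi>) v) = plot_diff Y (f x) (n, B, \<psi>) (diff0 m g v)"
proof -
  have cp: "(m, A, \<phi>) \<in> centered_plots X x" using e p by (simp add: centered_plots_def etale_plot_def)
  have cp': "(n, B, \<psi>) \<in> centered_plots Y (f x)" using e' p' by (simp add: centered_plots_def etale_plot_def)
  show ?thesis
    using plot_diff_morphism[OF centered_plots_map[OF f cp] cp' g] v
    by (simp add: tangent_map_plot_diff[OF X f e p v])
qed

lemma diff0_surj:
  assumes X: "diffeological_space X" and Y: "diffeological_space Y" and f: "diff_smooth X Y f"
    and e: "etale_plot X m A \<phi>" and p: "0 \<in> A" "\<phi> 0 = x"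
    and e': "etale_plot Y n B \<psi>" and p': "0 \<in> B" "\<psi> 0 = f x"
    and g: "represents_morphism (m, A, compose A f \<phi>) (n, B, \<psi>) g"
    and surj: "tangent_map X Y f x ` tangent_space X x = tangent_space Y (f x)" and w: "w \<in> Rn n"
  shows "\<exists>v\<in>Rn m. diff0 m g v = w"
proof -
  have cp': "(n, B, \<psi>) \<in> centered_plots Y (f x)" using e' p' by (simp add: centered_plots_def etale_plot_def)
  have "plot_diff Y (f x) (n, B, \<psi>) w \<in> tangent_map X Y f x ` tangent_space X x"
    unfolding surj using plot_diff_in_tangent_space[OF cp'] w by simp
  then obtain A' where A': "A' \<in> tangent_space X x" "plot_diff Y (f x) (n, B, \<psi>) w = tangent_map X Y f x A'"
    by blast
  obtain v where v: "v \<in> Rn m" "A' = plot_diff X x (m, A, \<phi>) v"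
    using A'(1) by (rule plot_diff_surj[OF X e p])
  have "plot_diff Y (f x) (n, B, \<psi>) w = plot_diff Y (f x) (n, B, \<psi>) (diff0 m g v)"
    using A'(2) v(2) tangent_map_chart[OF X Y f e p e' p' g v(1)] by simp
  then have "w = diff0 m g v"
    using w represents_morphism_diff0_in_Rn[OF g centered_plotsD(2)[OF Y cp']]
    by (rule inj_onD[OF plot_diff_inj[OF Y e' p']])
  then show ?thesis using v(1) by blast
qed

lemma diff0_inj:
  assumes X: "diffeological_space X" and Y: "diffeological_space Y" and f: "diff_smooth X Y f"
    and e: "etale_plot X m A \<phi>" and p: "0 \<in> A" "\<phi> 0 = x"
    and e': "etale_plot Y n B \<psi>" and p': "0 \<in> B" "\<psi> 0 = f x"
    and g: "represents_morphism (m, A, compose A f \<phi>) (n, B, \<psi>) g"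
    and inj: "inj_on (tangent_map X Y f x) (tangent_space X x)"
    and v: "v \<in> Rn m" "diff0 m g v = 0"
  shows "v = 0"
proof -
  have cp: "(m, A, \<phi>) \<in> centered_plots X x" using e p by (simp add: centered_plots_def etale_plot_def)
  have 0: "0 \<in> Rn m" by (simp add: Rn_iff)
  have "diff0 m g v = diff0 m g 0" using v(2) by (simp add: fun_eq_iff diff0_zero)
  then have "tangent_map X Y f x (plot_diff X x (m, A, \<phi>) v) = tangent_map X Y f x (plot_diff X x (m, A, \<phi>) 0)"
    by (simp add: tangent_map_chart[OF X Y f e p e' p' g v(1)] tangent_map_chart[OF X Y f e p e' p' g 0])
  then have "plot_diff X x (m, A, \<phi>) v = plot_diff X x (m, A, \<phi>) 0"
    using plot_diff_in_tangent_space[OF cp] v(1) 0 by (intro inj_onD[OF inj]) auto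
  then show ?thesis using v(1) 0 by (rule inj_onD[OF plot_diff_inj[OF X e p]])
qed

section \<open>Submersions, immersions and etale maps\<close>

lemma compose_fst_snd_plot:
  assumes "(l, S, R) \<in> plots (pullback (domain_space k U) P X f)"
  shows "ndomain l S" "smooth_map l S k U (\<lambda>t. fst (R t))" "(l, S, compose S snd R) \<in> plots X"
    "\<And>t. t \<in> S \<Longrightarrow> fst (R t) \<in> U \<and> P (fst (R t)) = f (snd (R t))"
proof -
  show S: "ndomain l S" and "(l, S, compose S snd R) \<in> plots X"
    using assms by (auto simp: plots_pullback plots_prod_diff)
  have "smooth_map l S k U (compose S fst R)"
    using assms by (simp add: plots_pullback plots_prod_diff plots_domain_space)
  then show "smooth_map l S k U (\<lambda>t. fst (R t))"
    by (rule smooth_map_cong[OF S]) (simp add: compose_def)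
  have "R ` S \<subseteq> points (pullback (domain_space k U) P X f)"
    using assms by (simp add: plots_pullback)
  then show "fst (R t) \<in> U \<and> P (fst (R t)) = f (snd (R t))" if "t \<in> S" for t
    using that by (auto simp: pullback_points)
qed

lemma diff_smooth_fst_pullback:
  "diff_smooth (pullback (domain_space k U) P X f) (domain_space k U) fst"
  by (auto simp: diff_smooth_def pullback_points plots_pullback plots_prod_diff)

lemma plots_subspace_domain_space:
  assumes "(l, S, R) \<in> plots (subspace_diff (domain_space k U) T)"
  shows "(l, S, R) \<in> plots (domain_space k T)"
  using assms by (auto simp: plots_subspace_diff plots_domain_space smooth_map_def)

text \<open>Serves twice: as the retraction of an immersion, whose target is the whole product, and,
  once its values are known to lie in the pullback, as the section of a submersion.\<close>

lemma diff_smooth_chart_graph: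
  assumes X: "diffeological_space X" and \<phi>: "(m, A, \<phi>) \<in> plots X"
    and T: "ndomain k T" "T \<subseteq> U" and s: "smooth_map k T m A s"
  shows "diff_smooth (domain_space k T) (prod_diff (domain_space k U) X) (\<lambda>r. (r, \<phi> (s r)))"
  unfolding diff_smooth_def
proof (intro conjI ballI)
  have A: "ndomain m A" by (rule plotD(1)[OF X \<phi>])
  have into: "(r, \<phi> (s r)) \<in> U \<times> points X" if "r \<in> T" for r
    using that T(2) smooth_map_into[OF s] plotD(2)[OF X \<phi>] by auto
  then show "(\<lambda>r. (r, \<phi> (s r))) \<in> points (domain_space k T) \<rightarrow> points (prod_diff (domain_space k U) X)"
    by auto
  have "(l, S, compose S (\<lambda>r. (r, \<phi> (s r))) R) \<in> plots (prod_diff (domain_space k U) X)"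
    if R: "(l, S, R) \<in> plots (domain_space k T)" for l S R
  proof -
    have S: "ndomain l S" and R': "R \<in> extensional S" "smooth_map l S k T R"
      using R by (auto simp: plots_domain_space)
    have RT: "R t \<in> T" if "t \<in> S" for t using smooth_map_into[OF R'(2)] that by auto
    have "compose S fst (compose S (\<lambda>r. (r, \<phi> (s r))) R) = R"
      using R'(1) by (auto simp: compose_def fun_eq_iff extensional_def)
    moreover have "compose S snd (compose S (\<lambda>r. (r, \<phi> (s r))) R) = compose S \<phi> (\<lambda>t. s (R t))"
      by (auto simp: compose_def)
    moreover have "(l, S, compose S \<phi> (\<lambda>t. s (R t))) \<in> plots X"
      by (rule plot_compose[OF X \<phi> S smooth_map_compose[OF S T(1) R'(2) s]])
    moreover have "smooth_map l S k U R"
      using R'(2) T(2) by (auto simp: smooth_map_def)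
    moreover have "compose S (\<lambda>r. (r, \<phi> (s r))) R \<in> S \<rightarrow> U \<times> points X"
      using into RT by (auto simp: compose_def)
    ultimately show ?thesis using S R'(1) by (simp add: plots_prod_diff plots_domain_space)
  qed
  then show "case p of (l, S, R) \<Rightarrow> (l, S, compose S (\<lambda>r. (r, \<phi> (s r))) R) \<in> plots (prod_diff (domain_space k U) X)"
    if "p \<in> plots (domain_space k T)" for p
    using that by (cases p) auto
qed

lemma diff_smooth_chart_section:
  assumes X: "diffeological_space X" and \<phi>: "(m, A, \<phi>) \<in> plots X"
    and T: "ndomain k T" "T \<subseteq> U" and s: "smooth_map k T m A s"
    and P: "\<And>r. r \<in> T \<Longrightarrow> P r = f (\<phi> (s r))"
  shows "diff_smooth (subspace_diff (domain_space k U) T) (pullback (domain_space k U) P X f)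
    (\<lambda>r. (r, \<phi> (s r)))"
proof -
  let ?\<sigma> = "\<lambda>r. (r, \<phi> (s r))" and ?PB = "pullback (domain_space k U) P X f"
  have g: "diff_smooth (domain_space k T) (prod_diff (domain_space k U) X) ?\<sigma>"
    by (rule diff_smooth_chart_graph[OF X \<phi> T s])
  have into: "?\<sigma> r \<in> points ?PB" if "r \<in> T" for r
    using g that P[OF that] by (auto simp: pullback_points diff_smooth_def)
  have "(l, S, compose S ?\<sigma> R) \<in> plots ?PB"
    if "(l, S, R) \<in> plots (subspace_diff (domain_space k U) T)" for l S R
  proof -
    have R: "(l, S, R) \<in> plots (domain_space k T)" by (rule plots_subspace_domain_space[OF that])
    then have "compose S ?\<sigma> R ` S \<subseteq> points ?PB"
      using into smooth_map_into[of l S k T R] by (auto simp: compose_def plots_domain_space)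
    then show ?thesis using g R by (auto simp: plots_pullback diff_smooth_def)
  qed
  with into show ?thesis by (auto simp: diff_smooth_def)
qed

text \<open>\<open>g\<close> represents the map \<open>f\<close> and \<open>h\<close> the plot \<open>P\<close> in charts centered at \<open>x0\<close> and \<open>f x0\<close>.\<close>

lemma local_representation:
  assumes M: "diff_etale_manifold m M" and N: "diff_etale_manifold n N" and f: "diff_smooth M N f"
    and P: "(k, U, P) \<in> plots N" and z0: "(r0, x0) \<in> points (pullback (domain_space k U) P M f)"
  obtains A \<phi> B \<psi> A' g V h where
    "etale_plot M m A \<phi>" "0 \<in> A" "\<phi> 0 = x0" "etale_plot N n B \<psi>" "0 \<in> B" "\<psi> 0 = f x0"
    "represents_morphism (m, A, compose A f \<phi>) (n, B, \<psi>) g"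
    "ndomain m A'" "0 \<in> A'" "A' \<subseteq> A" "smooth_map m A' n B g" "g 0 = 0" "\<forall>a\<in>A'. \<psi> (g a) = f (\<phi> a)"
    "ndomain k V" "r0 \<in> V" "V \<subseteq> U" "smooth_map k V n B h" "h r0 = 0" "\<forall>r\<in>V. \<psi> (h r) = P r"
proof -
  have dM: "diffeological_space M" and dN: "diffeological_space N"
    using M N by (auto simp: diff_etale_manifold_def)
  have z: "r0 \<in> U" "x0 \<in> points M" "P r0 = f x0" using z0 by (auto simp: pullback_points)
  have fx: "f x0 \<in> points N" using f z(2) by (auto simp: diff_smooth_def)
  obtain A \<phi> where \<phi>: "etale_plot M m A \<phi>" "0 \<in> A" "\<phi> 0 = x0"
    by (rule diff_etale_manifold_chart[OF M z(2)])
  obtain B \<psi> where \<psi>: "etale_plot N n B \<psi>" "0 \<in> B" "\<psi> 0 = f x0"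
    by (rule diff_etale_manifold_chart[OF N fx])
  have "(m, A, \<phi>) \<in> centered_plots M x0" using \<phi> by (simp add: centered_plots_def etale_plot_def)
  then have "(m, A, compose A f \<phi>) \<in> centered_plots N (f x0)" by (rule centered_plots_map[OF f])
  then obtain g where g: "represents_morphism (m, A, compose A f \<phi>) (n, B, \<psi>) g"
    using etale_plot_morphism_exists[OF dN \<psi>] by blast
  then obtain A' where A': "A' \<subseteq> A" "ndomain m A'" "0 \<in> A'" "smooth_map m A' n B g" "g 0 = 0"
    "\<forall>a\<in>A'. compose A f \<phi> a = \<psi> (g a)" by (rule represents_morphismE)
  have A6: "\<forall>a\<in>A'. \<psi> (g a) = f (\<phi> a)"
  proof
    fix a assume "a \<in> A'"
    then show "\<psi> (g a) = f (\<phi> a)" using A'(1,6) by (auto simp: compose_def subset_iff)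
  qed
  have "P r0 = \<psi> 0" using z(3) \<psi>(3) by simp
  then obtain V h where
    "ndomain k V" "r0 \<in> V" "V \<subseteq> U" "smooth_map k V n B h" "h r0 = 0" "\<forall>r\<in>V. \<psi> (h r) = P r"
    by (rule etale_plot_lift[OF \<psi>(1) P z(1) \<psi>(2)])
  then show ?thesis by (rule that[OF \<phi> \<psi> g A'(2,3,1,4,5) A6])
qed

lemma surjective_diff_submersion:
  assumes M: "diff_etale_manifold m M" and N: "diff_etale_manifold n N" and f: "diff_smooth M N f"
    and surj: "\<And>x. x \<in> points M \<Longrightarrow> tangent_map M N f x ` tangent_space M x = tangent_space N (f x)"
  shows "diff_submersion M N f"
proof -
  have dM: "diffeological_space M" and dN: "diffeological_space N"
    using M N by (auto simp: diff_etale_manifold_def)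
  have "submersion (pullback (domain_space k U) P M f) (domain_space k U) fst"
    if P: "(k, U, P) \<in> plots N" for k U P
  proof -
    let ?PB = "pullback (domain_space k U) P M f"
    have U: "ndomain k U" by (rule plotD(1)[OF dN P])
    have "\<exists>W \<sigma>. D_open (domain_space k U) W \<and> diff_smooth (subspace_diff (domain_space k U) W) ?PB \<sigma> \<and>
        (\<forall>y\<in>W. fst (\<sigma> y) = y) \<and> z0 \<in> \<sigma> ` W" if z0: "z0 \<in> points ?PB" for z0
    proof -
      obtain r0 x0 where z: "z0 = (r0, x0)" by (cases z0)
      obtain A \<phi> B \<psi> A' g V h where \<phi>: "etale_plot M m A \<phi>" "0 \<in> A" "\<phi> 0 = x0"
        and \<psi>: "etale_plot N n B \<psi>" "0 \<in> B" "\<psi> 0 = f x0"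
        and g: "represents_morphism (m, A, compose A f \<phi>) (n, B, \<psi>) g"
        and A': "ndomain m A'" "0 \<in> A'" "A' \<subseteq> A" "smooth_map m A' n B g" "g 0 = 0"
          "\<forall>a\<in>A'. \<psi> (g a) = f (\<phi> a)"
        and V: "ndomain k V" "r0 \<in> V" "V \<subseteq> U" "smooth_map k V n B h" "h r0 = 0"
          "\<forall>r\<in>V. \<psi> (h r) = P r"
        by (rule local_representation[OF M N f P z0[unfolded z]])
      have pl\<phi>: "(m, A, \<phi>) \<in> plots M" and pl\<psi>: "(n, B, \<psi>) \<in> plots N"
        using \<phi>(1) \<psi>(1) by (auto simp: etale_plot_def)
      have B: "ndomain n B" by (rule plotD(1)[OF dN pl\<psi>])
      have x0: "x0 \<in> points M" using z0 z by (simp add: pullback_points)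
      have ds: "\<exists>v\<in>Rn m. total_deriv m g 0 v = w" if "w \<in> Rn n" for w
        using diff0_surj[OF dM dN f \<phi> \<psi> g surj[OF x0] that] by (simp add: diff0_eq_total_deriv)
      obtain B1 s where B1: "ndomain n B1" "g 0 \<in> B1" "B1 \<subseteq> B" and s: "smooth_map n B1 m A' s"
        "s (g 0) = 0" "\<And>y. y \<in> B1 \<Longrightarrow> g (s y) = y"
        using smooth_right_inverse[OF A'(1,2) B A'(4) ds] by blast
      define T where "T = {r \<in> V. h r \<in> B1}"
      have T: "ndomain k T" "T \<subseteq> U"
        unfolding T_def using ndomain_smooth_preimage[OF V(1) ndomain_subset[OF B] V(4) B1(1)] V(3) by auto
      have "smooth_map k T n B1 h"
        by (rule smooth_map_subset[OF V(4)]) (auto simp: T_def)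
      from smooth_map_compose[OF T(1) B1(1) this s(1)]
      have "smooth_map k T m A' (\<lambda>r. s (h r))" .
      then have sh: "smooth_map k T m A (\<lambda>r. s (h r))"
        using A'(3) by (auto simp: smooth_map_def)
      \<comment> \<open>On \<open>T\<close> the section property gives \<open>f (\<phi> (s (h r))) =
        \<psi> (g (s (h r))) = \<psi> (h r) = P r\<close>.\<close>
      have Pr: "P r = f (\<phi> (s (h r)))" if "r \<in> T" for r
      proof -
        have r: "h r \<in> B1" "r \<in> V" using that by (auto simp: T_def)
        then have "s (h r) \<in> A'" using smooth_map_into[OF s(1)] by auto
        then have "f (\<phi> (s (h r))) = \<psi> (g (s (h r)))" using A'(6) by simp
        also have "\<dots> = P r" using s(3)[OF r(1)] V(6) r(2) by simp
        finally show ?thesis by simp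
      qed
      have "diff_smooth (subspace_diff (domain_space k U) T) ?PB (\<lambda>r. (r, \<phi> (s (h r))))"
        by (rule diff_smooth_chart_section[OF dM pl\<phi> T sh]) (rule Pr)
      moreover have "D_open (domain_space k U) T" using T by (simp add: D_open_domain_space[OF U])
      \<comment> \<open>The section meets \<open>z0\<close> because \<open>h r0 = 0 = g 0\<close>
        and \<open>s (g 0) = 0\<close>, which is the parameter of \<open>x0\<close>.\<close>
      moreover have "z0 \<in> (\<lambda>r. (r, \<phi> (s (h r)))) ` T"
      proof (rule image_eqI)
        show "r0 \<in> T" using V(2,5) B1(2) A'(5) by (simp add: T_def)
        show "z0 = (r0, \<phi> (s (h r0)))" using z V(5) A'(5) s(2) \<phi>(3) by simp
      qed
      ultimately show ?thesis by (intro exI[of _ T] exI[of _ "\<lambda>r. (r, \<phi> (s (h r)))"]) auto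
    qed
    then show ?thesis using diff_smooth_fst_pullback unfolding submersion_def by blast
  qed
  then show ?thesis unfolding diff_submersion_def using f by auto
qed

lemma injective_diff_immersion:
  assumes M: "diff_etale_manifold m M" and N: "diff_etale_manifold n N" and f: "diff_smooth M N f"
    and inj: "\<And>x. x \<in> points M \<Longrightarrow> inj_on (tangent_map M N f x) (tangent_space M x)"
  shows "diff_immersion M N f"
proof -
  have dM: "diffeological_space M" and dN: "diffeological_space N"
    using M N by (auto simp: diff_etale_manifold_def)
  have "\<exists>W V \<rho>. D_open (pullback (domain_space k U) P M f) W \<and> z0 \<in> W \<and>
      ndomain k V \<and> V \<subseteq> U \<and> fst ` W \<subseteq> V \<and>
      diff_smooth (domain_space k V) (prod_diff (domain_space k U) M) \<rho> \<and> (\<forall>z\<in>W. \<rho> (fst z) = z)"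
    if P: "(k, U, P) \<in> plots N" and z0: "z0 \<in> points (pullback (domain_space k U) P M f)" for k U P z0
  proof -
    let ?PB = "pullback (domain_space k U) P M f"
    have U: "ndomain k U" by (rule plotD(1)[OF dN P])
    obtain r0 x0 where z: "z0 = (r0, x0)" by (cases z0)
    obtain A \<phi> B \<psi> A' g V h where \<phi>: "etale_plot M m A \<phi>" "0 \<in> A" "\<phi> 0 = x0"
      and \<psi>: "etale_plot N n B \<psi>" "0 \<in> B" "\<psi> 0 = f x0"
      and g: "represents_morphism (m, A, compose A f \<phi>) (n, B, \<psi>) g"
      and A': "ndomain m A'" "0 \<in> A'" "A' \<subseteq> A" "smooth_map m A' n B g" "g 0 = 0"
        "\<forall>a\<in>A'. \<psi> (g a) = f (\<phi> a)"
      and V: "ndomain k V" "r0 \<in> V" "V \<subseteq> U" "smooth_map k V n B h" "h r0 = 0"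
        "\<forall>r\<in>V. \<psi> (h r) = P r"
      by (rule local_representation[OF M N f P z0[unfolded z]])
    have pl\<phi>: "(m, A, \<phi>) \<in> plots M" and pl\<psi>: "(n, B, \<psi>) \<in> plots N"
      using \<phi>(1) \<psi>(1) by (auto simp: etale_plot_def)
    have A: "ndomain m A" and B: "ndomain n B" using plotD(1) dM pl\<phi> dN pl\<psi> by auto
    have x0: "x0 \<in> points M" using z0 z by (simp add: pullback_points)
    have di: "v = 0" if "v \<in> Rn m" "total_deriv m g 0 v = 0" for v
      using diff0_inj[OF dM dN f \<phi> \<psi> g inj[OF x0] that(1)] that(2) by (simp add: diff0_eq_total_deriv)
    obtain A1 B1 \<rho> where A1: "ndomain m A1" "0 \<in> A1" "A1 \<subseteq> A'" and B1: "ndomain n B1" "B1 \<subseteq> B"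
      and gAB: "g \<in> A1 \<rightarrow> B1" and \<rho>: "smooth_map n B1 m A1 \<rho>" "\<And>x. x \<in> A1 \<Longrightarrow> \<rho> (g x) = x"
      using smooth_left_inverse[OF A'(1,2) B A'(4) di] by blast
    define T where "T = {r \<in> V. h r \<in> B1}"
    have T: "ndomain k T" "T \<subseteq> U" "T \<subseteq> V"
      unfolding T_def using ndomain_smooth_preimage[OF V(1) ndomain_subset[OF B] V(4) B1(1)] V(3) by auto
    have "smooth_map k T n B1 h"
      by (rule smooth_map_subset[OF V(4)]) (auto simp: T_def)
    from smooth_map_compose[OF T(1) B1(1) this \<rho>(1)]
    have "smooth_map k T m A1 (\<lambda>r. \<rho> (h r))" .
    then have sh: "smooth_map k T m A (\<lambda>r. \<rho> (h r))"
      using A'(3) A1(3) by (auto simp: smooth_map_def)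
    \<comment> \<open>The condition matches parameters, not points:
      \<open>f (\<phi> a) = P r\<close> would still allow \<open>g a \<noteq> h r\<close>, as
      \<open>\<psi>\<close> need not be injective, and \<open>\<rho>\<close> recovers
      \<open>a\<close> only from \<open>g a\<close>.\<close>
    define W where "W = {(r, x). r \<in> T \<and> (\<exists>a\<in>A1. \<phi> a = x \<and> g a = h r)}"
    have "W \<subseteq> points ?PB"
    proof
      fix z assume "z \<in> W"
      then obtain r a where ra: "z = (r, \<phi> a)" "r \<in> T" "a \<in> A1" "g a = h r" by (auto simp: W_def)
      have "P r = \<psi> (g a)" using V(6) T(3) ra(2,4) by auto
      also have "\<dots> = f (\<phi> a)" using A'(6) A1(3) ra(3) by auto
      finally show "z \<in> points ?PB"
        using ra T(2) plotD(2)[OF dM pl\<phi>] A1(3) A'(3) by (auto simp: pullback_points)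
    qed
    \<comment> \<open>Near \<open>t0\<close> the second component of \<open>R\<close> lifts through
      \<open>\<phi>\<close> to a map \<open>h'\<close> starting at the witness \<open>a1\<close>.
      Then \<open>g\<close> after \<open>h'\<close> and \<open>h\<close> after the first component
      of \<open>R\<close> lift the same plot of \<open>N\<close> through \<open>\<psi>\<close> and
      agree at \<open>t0\<close>, hence nearby, and \<open>h' t\<close> is a witness for
      \<open>R t\<close>.\<close>
    moreover have "ndomain l {t \<in> S. R t \<in> W}" if R: "(l, S, R) \<in> plots ?PB" for l S R
    proof (rule ndomainI)
      note R' = compose_fst_snd_plot[OF R]
      fix t0 assume "t0 \<in> {t \<in> S. R t \<in> W}"
      then obtain a1 where t0: "t0 \<in> S" "fst (R t0) \<in> T"
        and a1: "a1 \<in> A1" "\<phi> a1 = snd (R t0)" "g a1 = h (fst (R t0))"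
        by (auto simp: W_def)
      have a1A: "a1 \<in> A" using a1(1) A1(3) A'(3) by blast
      have eq0: "compose S snd R t0 = \<phi> a1" using t0(1) a1(2) by (simp add: compose_def)
      obtain C h' where C: "ndomain l C" "t0 \<in> C" "C \<subseteq> S" and h': "smooth_map l C m A h'" "h' t0 = a1"
        "\<forall>t\<in>C. \<phi> (h' t) = compose S snd R t"
        by (rule etale_plot_lift[OF \<phi>(1) R'(3) t0(1) a1A eq0])
      define C1 where "C1 = {t \<in> C. h' t \<in> A1} \<inter> {t \<in> S. fst (R t) \<in> T}"
      have C1: "ndomain l C1"
        unfolding C1_def
        by (intro ndomain_Int ndomain_smooth_preimage[OF C(1) ndomain_subset[OF A] h'(1) A1(1)]
            ndomain_smooth_preimage[OF R'(1) ndomain_subset[OF U] R'(2) T(1)])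
      have sub: "C1 \<subseteq> C" "C1 \<subseteq> S" "t0 \<in> C1" using C(2) h'(2) a1(1) t0 by (auto simp: C1_def)
      have "smooth_map l C1 m A' h'"
        by (rule smooth_map_subset[OF h'(1) sub(1)]) (use A1(3) in \<open>auto simp: C1_def\<close>)
      then have 1: "smooth_map l C1 n B (\<lambda>t. g (h' t))"
        by (rule smooth_map_compose[OF C1 A'(1) _ A'(4)])
      have "smooth_map l C1 k V (\<lambda>t. fst (R t))"
        by (rule smooth_map_subset[OF R'(2) sub(2)]) (use T(3) in \<open>auto simp: C1_def\<close>)
      then have 2: "smooth_map l C1 n B (\<lambda>t. h (fst (R t)))"
        by (rule smooth_map_compose[OF C1 V(1) _ V(4)])
      have 3: "g (h' t0) = h (fst (R t0))" using a1(3) h'(2) by simp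
      have 4: "\<psi> (g (h' t)) = \<psi> (h (fst (R t)))" if "t \<in> C1" for t
      proof -
        have t: "t \<in> C" "t \<in> S" "h' t \<in> A1" "fst (R t) \<in> T" using that sub by (auto simp: C1_def)
        have "\<psi> (g (h' t)) = f (\<phi> (h' t))" using A'(6) A1(3) t(3) by blast
        also have "\<dots> = f (snd (R t))" using h'(3) t(1,2) by (simp add: compose_def)
        also have "\<dots> = P (fst (R t))" using R'(4)[OF t(2)] by simp
        also have "\<dots> = \<psi> (h (fst (R t)))" using V(6) T(3) t(4) by auto
        finally show ?thesis .
      qed
      obtain C2 where C2: "ndomain l C2" "t0 \<in> C2" "C2 \<subseteq> C1" "\<forall>t\<in>C2. g (h' t) = h (fst (R t))"
        by (rule etale_plot_unique[OF \<psi>(1) C1 sub(3) 1 2 3 4])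
      have "R t \<in> W" if "t \<in> C2" for t
      proof -
        have t: "t \<in> C" "t \<in> S" "h' t \<in> A1" "fst (R t) \<in> T"
          using that C2(3) sub by (auto simp: C1_def)
        have "\<phi> (h' t) = snd (R t)" using h'(3) t(1,2) by (simp add: compose_def)
        moreover have "g (h' t) = h (fst (R t))" using C2(4) that by blast
        ultimately show ?thesis using t(3,4) by (auto simp: W_def case_prod_beta)
      qed
      then show "\<exists>C. ndomain l C \<and> t0 \<in> C \<and> C \<subseteq> {t \<in> S. R t \<in> W}"
        using C2(1-3) sub(2) by (intro exI[of _ C2]) auto
    qed
    ultimately have "D_open ?PB W" by (auto simp: D_open_def ndomain_def)
    moreover have "z0 \<in> W"
    proof -
      have "g 0 \<in> B1" using gAB A1(2) by auto
      then show ?thesis using V(2,5) A'(5) A1(2) \<phi>(3) z by (auto simp: W_def T_def)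
    qed
    moreover have "diff_smooth (domain_space k T) (prod_diff (domain_space k U) M) (\<lambda>r. (r, \<phi> (\<rho> (h r))))"
      by (rule diff_smooth_chart_graph[OF dM pl\<phi> T(1,2) sh])
    \<comment> \<open>Here \<open>\<rho> (h r) = \<rho> (g a) = a\<close>, so the second component
      comes back as \<open>\<phi> a\<close>.\<close>
    moreover have "(fst z, \<phi> (\<rho> (h (fst z)))) = z" if zW: "z \<in> W" for z
    proof -
      obtain r a where ra: "z = (r, \<phi> a)" "a \<in> A1" "g a = h r" using zW by (auto simp: W_def)
      show ?thesis using \<rho>(2)[OF ra(2)] by (simp add: ra(1) ra(3)[symmetric])
    qed
    moreover have "fst ` W \<subseteq> T" by (auto simp: W_def)
    ultimately show ?thesis
      using T(1,2) by (intro exI[of _ W] exI[of _ T] exI[of _ "\<lambda>r. (r, \<phi> (\<rho> (h r)))"]) auto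
  qed
  then show ?thesis unfolding diff_immersion_def using f by auto
qed

text \<open>Applied to the identity plot of \<open>S\<close>, the section is itself a plot of
  \<open>X\<close>, and preimages of D-open sets under plots are open.\<close>

lemma diff_smooth_section_vimage:
  assumes \<sigma>: "diff_smooth (subspace_diff (domain_space k U) S) X \<sigma>" and W: "D_open X W"
    and S: "ndomain k S" "S \<subseteq> U"
  shows "ndomain k {r \<in> S. \<sigma> r \<in> W}"
proof -
  have "(k, S, \<lambda>r\<in>S. r) \<in> plots (subspace_diff (domain_space k U) S)"
    using identity_plot[OF S] by (auto simp: plots_subspace_diff)
  then have "(k, S, compose S \<sigma> (\<lambda>r\<in>S. r)) \<in> plots X"
    using \<sigma> unfolding diff_smooth_def by blast
  then have "openin (Euclidean_space k) {r \<in> S. compose S \<sigma> (\<lambda>r\<in>S. r) r \<in> W}"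
    using W unfolding D_open_def by blast
  also have "{r \<in> S. compose S \<sigma> (\<lambda>r\<in>S. r) r \<in> W} = {r \<in> S. \<sigma> r \<in> W}"
    by (auto simp: compose_def)
  finally show ?thesis by (simp add: ndomain_def)
qed

text \<open>Where a section \<open>\<sigma>\<close> and a retraction \<open>\<rho>\<close> are both defined, they coincide and
  invert the projection of the pullback.\<close>

lemma diff_etaleI:
  assumes Y: "diffeological_space Y" and sub: "diff_submersion X Y f" and imm: "diff_immersion X Y f"
  shows "diff_etale X Y f"
proof -
  have "etale (pullback (domain_space k U) P X f) (domain_space k U) fst"
    if P: "(k, U, P) \<in> plots Y" for k U P
    unfolding etale_def
  proof (intro conjI ballI)
    let ?PB = "pullback (domain_space k U) P X f" and ?D = "domain_space k U"
    have U: "ndomain k U" by (rule plotD(1)[OF Y P])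
    show "fst \<in> points ?PB \<rightarrow> points ?D" by (auto simp: pullback_points)
    fix z0 assume z0: "z0 \<in> points ?PB"
    have "submersion ?PB ?D fst" using sub P unfolding diff_submersion_def by blast
    then obtain S \<sigma> where S: "D_open ?D S" and \<sigma>: "diff_smooth (subspace_diff ?D S) ?PB \<sigma>"
      "\<forall>r\<in>S. fst (\<sigma> r) = r" "z0 \<in> \<sigma> ` S"
      using z0 unfolding submersion_def by blast
    have S': "ndomain k S" "S \<subseteq> U" using S by (auto simp: D_open_domain_space[OF U])
    have "\<exists>W V \<rho>. D_open ?PB W \<and> z0 \<in> W \<and> ndomain k V \<and> V \<subseteq> U \<and> fst ` W \<subseteq> V \<and>
        diff_smooth (domain_space k V) (prod_diff ?D X) \<rho> \<and> (\<forall>z\<in>W. \<rho> (fst z) = z)"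
      using imm P z0 unfolding diff_immersion_def by blast
    then obtain W \<rho> where W: "D_open ?PB W" "z0 \<in> W" "\<forall>z\<in>W. \<rho> (fst z) = z" by blast
    \<comment> \<open>The section and the retraction have unrelated domains. \<open>V1\<close> and
      \<open>W1\<close> are cut down so that the section maps \<open>V1\<close> into
      \<open>W1\<close> and the projection maps \<open>W1\<close> back to \<open>V1\<close>.\<close>
    define V1 where "V1 = {r \<in> S. \<sigma> r \<in> W}"
    define W1 where "W1 = {z \<in> W. fst z \<in> V1}"
    have V1: "ndomain k V1" "V1 \<subseteq> U"
      unfolding V1_def using diff_smooth_section_vimage[OF \<sigma>(1) W(1) S'] S'(2) by auto
    have \<sigma>1: "\<sigma> r \<in> W1" "fst (\<sigma> r) = r" if "r \<in> V1" for r
      using that \<sigma>(2) by (auto simp: V1_def W1_def)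
    have \<sigma>fst: "\<sigma> (fst z) = z" if "z \<in> W1" for z
    proof -
      have z: "z \<in> W" "fst z \<in> V1" using that by (auto simp: W1_def)
      \<comment> \<open>\<open>\<sigma> (fst z)\<close> and \<open>z\<close> both lie in
        \<open>W\<close> over the same parameter, and on \<open>W\<close> the retraction recovers a
        point from its parameter.\<close>
      have "\<sigma> (fst z) = \<rho> (fst (\<sigma> (fst z)))" using W(3) z(2) by (simp add: V1_def)
      also have "\<dots> = z" using \<sigma>1(2)[OF z(2)] W(3) z(1) by simp
      finally show ?thesis .
    qed
    have inj: "inj_on fst W1" by (rule inj_on_inverseI) (rule \<sigma>fst)
    have bij: "bij_betw fst W1 V1"
      by (rule bij_betw_byWitness[where f' = \<sigma>]) (use \<sigma>1 \<sigma>fst in \<open>auto simp: W1_def\<close>)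
    have inv: "inv_into W1 fst r = \<sigma> r" if "r \<in> V1" for r
      using inv_into_f_eq[OF inj \<sigma>1(1)[OF that] \<sigma>1(2)[OF that]] .
    have W1: "D_open ?PB W1"
      unfolding D_open_def
    proof (intro conjI ballI)
      show "W1 \<subseteq> points ?PB" using W(1) by (auto simp: W1_def D_open_def)
      have "openin (Euclidean_space l) {t \<in> T. R t \<in> W1}" if R: "(l, T, R) \<in> plots ?PB" for l T R
      proof -
        note R' = compose_fst_snd_plot[OF R]
        have "ndomain l {t \<in> T. fst (R t) \<in> V1}"
          by (rule ndomain_smooth_preimage[OF R'(1) ndomain_subset[OF U] R'(2) V1(1)])
        moreover have "ndomain l {t \<in> T. R t \<in> W}"
          using W(1) R unfolding D_open_def ndomain_def by blast
        ultimately have "ndomain l ({t \<in> T. fst (R t) \<in> V1} \<inter> {t \<in> T. R t \<in> W})" by (rule ndomain_Int)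
        also have "{t \<in> T. fst (R t) \<in> V1} \<inter> {t \<in> T. R t \<in> W} = {t \<in> T. R t \<in> W1}"
          by (auto simp: W1_def)
        finally show ?thesis by (simp add: ndomain_def)
      qed
      then show "case p of (l, T, R) \<Rightarrow> openin (Euclidean_space l) {t \<in> T. R t \<in> W1}"
        if "p \<in> plots ?PB" for p using that by (cases p) auto
    qed
    have "diff_smooth (subspace_diff ?PB W1) (subspace_diff ?D V1) fst"
    proof -
      have "(l, T, compose T fst R) \<in> plots (subspace_diff ?D V1)"
        if R: "(l, T, R) \<in> plots (subspace_diff ?PB W1)" for l T R
      proof -
        have "(l, T, compose T fst R) \<in> plots ?D"
          using R diff_smooth_fst_pullback[of k U P X f] by (auto simp: diff_smooth_def plots_subspace_diff)
        moreover have "fst (R t) \<in> V1" if "t \<in> T" for t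
        proof -
          have "R t \<in> W1" using R that by (auto simp: plots_subspace_diff)
          then show ?thesis by (simp add: W1_def)
        qed
        ultimately show ?thesis by (auto simp: plots_subspace_diff compose_def)
      qed
      moreover have "fst \<in> W1 \<rightarrow> V1" by (auto simp: W1_def)
      ultimately show ?thesis by (auto simp: diff_smooth_def)
    qed
    moreover have "diff_smooth (subspace_diff ?D V1) (subspace_diff ?PB W1) (inv_into W1 fst)"
    proof -
      have "(l, T, compose T (inv_into W1 fst) R) \<in> plots (subspace_diff ?PB W1)"
        if R: "(l, T, R) \<in> plots (subspace_diff ?D V1)" for l T R
      proof -
        have RV: "R t \<in> V1" if "t \<in> T" for t using R that by (auto simp: plots_subspace_diff)
        have eq: "compose T (inv_into W1 fst) R = compose T \<sigma> R"
          using RV inv by (auto simp: compose_def fun_eq_iff)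
        have "(l, T, R) \<in> plots (subspace_diff ?D S)"
          using R by (auto simp: plots_subspace_diff V1_def)
        then have "(l, T, compose T \<sigma> R) \<in> plots ?PB" using \<sigma>(1) unfolding diff_smooth_def by blast
        moreover have "compose T \<sigma> R ` T \<subseteq> W1" using RV \<sigma>1(1) by (auto simp: compose_def)
        ultimately show ?thesis by (simp add: eq plots_subspace_diff)
      qed
      moreover have "inv_into W1 fst \<in> V1 \<rightarrow> W1" using inv \<sigma>1(1) by auto
      ultimately show ?thesis by (auto simp: diff_smooth_def)
    qed
    ultimately have "diffeomorphism (subspace_diff ?PB W1) (subspace_diff ?D V1) fst"
      using bij by (simp add: diffeomorphism_def)
    moreover have "z0 \<in> W1" "fst z0 \<in> V1"
      using \<sigma>(2,3) W(2) by (auto simp: W1_def V1_def)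
    moreover have "D_open ?D V1" using V1 by (simp add: D_open_domain_space[OF U])
    ultimately show "\<exists>W W'. D_open ?PB W \<and> z0 \<in> W \<and> D_open ?D W' \<and> fst z0 \<in> W' \<and>
        diffeomorphism (subspace_diff ?PB W) (subspace_diff ?D W') fst"
      using W1 by blast
  qed
  then show ?thesis using sub unfolding diff_etale_def diff_submersion_def by auto
qed

theorem theorem6p13:
  fixes M :: "'a diff_space" and N :: "'b diff_space" and f :: "'a \<Rightarrow> 'b" and m n :: nat
  assumes "diff_etale_manifold m M" and "diff_etale_manifold n N" and "diff_smooth M N f"
  shows "((\<forall>x \<in> points M. tangent_map M N f x ` tangent_space M x = tangent_space N (f x)) \<longrightarrow>
            diff_submersion M N f) \<and>
         ((\<forall>x \<in> points M. inj_on (tangent_map M N f x) (tangent_space M x)) \<longrightarrow>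
            diff_immersion M N f) \<and>
         ((\<forall>x \<in> points M.
             bij_betw (tangent_map M N f x) (tangent_space M x) (tangent_space N (f x))) \<longrightarrow>
            diff_etale M N f)"
proof (intro conjI impI)
  have N: "diffeological_space N" using assms(2) by (simp add: diff_etale_manifold_def)
  show sub: "diff_submersion M N f"
    if "\<forall>x \<in> points M. tangent_map M N f x ` tangent_space M x = tangent_space N (f x)"
    using surjective_diff_submersion[OF assms] that by simp
  show imm: "diff_immersion M N f"
    if "\<forall>x \<in> points M. inj_on (tangent_map M N f x) (tangent_space M x)"
    using injective_diff_immersion[OF assms] that by simp
  show "diff_etale M N f"
    if "\<forall>x \<in> points M.
      bij_betw (tangent_map M N f x) (tangent_space M x) (tangent_space N (f x))"
    by (rule diff_etaleI[OF N sub imm]) (use that in \<open>auto simp: bij_betw_def\<close>)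
qed

end
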